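(* Let $\mathcal{I}$ satisfy (A1)–(A7), (A10), (A11), let $\mathcal{O}$ be its set of rimpoints and let $T$ be the set consisting of all reflections $\sigma_\ell$ ($\ell$ a line) and all half-turns (about finite points), as permutations of $\mathcal{O}$. Then $(\mathcal{O},T)$ is an abstract oval all of whose secant lines are Pascalian.
   Context: $\mathcal{I}$ is an incidence structure of (finite) points and lines. Betweenness: for collinear $A,B,C$, $B$ is between $A$ and $C$ if every line through $B$ meets at least one line of each pair of intersecting lines through $A$ and $C$ respectively; segments and rays are defined as usual. Rays $r,s$ with endpoints $R,S$ are parallel if non-collinear and every line meeting one of them meets the other or the segment $\overline{RS}$; lines are parallel if they contain parallel rays. A rimpoint is a pair $(a,b)$ of parallel lines such that some line $\ell$ is parallel to both and some line meets $a,b,\ell$; $(a,b)=(c,d)$ if any two of $a,b,c,d$ are equal or parallel; $(a,b)$ is incident with $\ell$ if $\ell\in\{a,b\}$ or $\ell$ is parallel to both and some line meets $a,b,\ell$. "Point" means finite point or rimpoint; $AB$ is the line through distinct points $A,B$. For a rimpoint $X$ and finite point $A$, $X^A$ is the other rimpoint on $XA$; $X\mapsto X^A$ is the half-turn about $A$; permutations compose left to right. Axioms: (A1) two distinct points lie on a unique line; (A2) each line is on at least one point; (A3) there exist three non-collinear points and three collinear points; (A4) of three collinear points, at least one has the property that every line through it meets at least one of each pair of intersecting lines through the other two; (A5) if $P$ is not on $\ell$, there are two distinct lines on $P$ not meeting $\ell$ such that each line meeting $\ell$ meets at least one of them; (A6) any two non-collinear rays have a common parallel line; (A7) if $A,\dots,F$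 are rimpoints such that $AB\cap DE$, $BC\cap EF$, $CD\cap FA$ exist as finite points, they are collinear; (A10) given distinct finite points $P,Q$ there exist lines $\ell$ on $P$ and $m$ on $Q$ such that two common parallels to $\ell$ and $m$ meet on $PQ$; (A11) if $X$ is a rimpoint not on a line $\ell$, there is a unique point $R$ on $\ell$ such that for every finite point $S$ on $\ell$, two common parallels to $\ell$ and $X^{SR}X^{RS}$ meet on $XR$. Every line carries exactly two rimpoints. $AB//CD$ means lines $AB$, $CD$ meet in a finite point. A cyclic order $\mathcal{C}$ on $\mathcal{O}$ is compatible with $//$ if $AC//BD \iff (\mathcal{C}(A,B,C)\wedge\mathcal{C}(C,D,A))\vee(\mathcal{C}(A,D,C)\wedge\mathcal{C}(C,B,A))$. An order-preserving axial map is a non-identity permutation $\alpha$ of $\mathcal{O}$ preserving a cyclic order compatible with $//$, with a line $\ell$ (axis) such that for all rimpoints $X,Y$, if $XY^\alpha$ and $YX^\alpha$ meet, they meet in a finite point on $\ell$. For non-parallel lines $\ell,m$ with rimpoints $\{L_1,L_2\}$, $\{M_1,M_2\}$ labelled so that $L_1M_2//L_2M_1$, $\ell\bowtie m$ is the finite point $L_1M_2\cap L_2M_1$. The reflection $\sigma_\ell$ fixes the rimpoints of $\ell$ and sends a rimpoint $A$ not on $\ell$ to $A^O$, $O=\ell\bowtie A^\alpha A^{\alpha^{-1}}$, for any order-preserving axial map $\alpha$ with axis $\ell$ (independent of $\alpha$ under the axioms). An abstract oval is a pair $(O,S)$ with $O$ a set, $|O|\ge 3$, and $S$ a set of permutations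 of $O$ with $s^2=1$ for all $s\in S$ (the identity counts as an involution), such that for all $A_1,A_2,B_1,B_2\in O$ with $\{A_1,A_2\}\cap\{B_1,B_2\}=\varnothing$ there is exactly one $s\in S$ with $A_1^s=A_2$ and $B_1^s=B_2$. For $A,B\in O$, the line $\ell_{A,B}$ of $(O,S)$ is incident with $A$, $B$ and all $s\in S$ mapping $A$ to $B$; it is secant if $A\ne B$. A line is Pascalian if for every three elements $I,J,K\in S$ incident with it, the product $IJK$ lies in $S$ and is incident with that line.
   Formalization: Equality of rimpoints also asks for a line meeting a,b,c,d; in (A6) a line is parallel to rays it contains; an axial map needs some X,Y with XY^α, YX^α meeting; S≠R in (A11); σ_ℓ uses only α with A^α≠A^{α^-1}. Literally all rimpoints coincide and σ_ℓ depends on α. *)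

theory Defs
  imports Main "HOL-Combinatorics.Permutations"
begin

text \<open>
  Points and lines are the elements of two types, related by \<open>inc\<close>.  A rimpoint is an equivalence
  class of pairs of lines, so a (finite or rim) point is an element of the following type.
\<close>

type_synonym 'l rimpoint = "('l \<times> 'l) set"

datatype ('p, 'l) point = Fin 'p | Rim "'l rimpoint"

locale incidence =
  fixes inc :: "'p \<Rightarrow> 'l \<Rightarrow> bool"
begin

subsection \<open>Order and parallelism\<close>

definition collinear :: "'p set \<Rightarrow> bool" where
  "collinear A \<longleftrightarrow> (\<exists>l. \<forall>P\<in>A. inc P l)"

text \<open>Meeting is always meant for distinct lines, and in a finite point.\<close>

definition meets :: "'l \<Rightarrow> 'l \<Rightarrow> bool" where
  "meets l m \<longleftrightarrow> l \<noteq> m \<and> (\<exists>P. inc P l \<and> inc P m)"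

definition meets_set :: "'l \<Rightarrow> 'p set \<Rightarrow> bool" where
  "meets_set l A \<longleftrightarrow> (\<exists>P\<in>A. inc P l)"

definition separating :: "'p \<Rightarrow> 'p \<Rightarrow> 'p \<Rightarrow> bool" where
  "separating A B C \<longleftrightarrow>
     (\<forall>m a c. inc B m \<and> inc A a \<and> inc C c \<and> meets a c \<longrightarrow> meets m a \<or> meets m c)"

definition between :: "'p \<Rightarrow> 'p \<Rightarrow> 'p \<Rightarrow> bool" where
  "between A B C \<longleftrightarrow> distinct [A, B, C] \<and> collinear {A, B, C} \<and> separating A B C"

definition segment :: "'p \<Rightarrow> 'p \<Rightarrow> 'p set" where
  "segment R S = {R, S} \<union> {X. between R X S}"

text \<open>The ray with endpoint \<open>R\<close> through \<open>Q\<close>, used for \<open>Q \<noteq> R\<close>.\<close>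

definition ray :: "'p \<Rightarrow> 'p \<Rightarrow> 'p set" where
  "ray R Q = {R, Q} \<union> {X. between R X Q} \<union> {X. between R Q X}"

definition rays_parallel :: "'p \<Rightarrow> 'p \<Rightarrow> 'p \<Rightarrow> 'p \<Rightarrow> bool" where
  "rays_parallel R Q S U \<longleftrightarrow>
     R \<noteq> Q \<and> S \<noteq> U \<and> \<not> collinear (ray R Q \<union> ray S U) \<and>
     (\<forall>m. (meets_set m (ray R Q) \<longrightarrow> meets_set m (ray S U) \<or> meets_set m (segment R S)) \<and>
          (meets_set m (ray S U) \<longrightarrow> meets_set m (ray R Q) \<or> meets_set m (segment R S)))"

definition contains_ray :: "'l \<Rightarrow> 'p \<Rightarrow> 'p \<Rightarrow> bool" where
  "contains_ray l R Q \<longleftrightarrow> R \<noteq> Q \<and> (\<forall>X\<in>ray R Q. inc X l)"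

definition parallel :: "'l \<Rightarrow> 'l \<Rightarrow> bool" where
  "parallel l m \<longleftrightarrow>
     (\<exists>R Q S U. contains_ray l R Q \<and> contains_ray m S U \<and> rays_parallel R Q S U)"

text \<open>
  A line counts as parallel to the rays it contains.  Otherwise, of two rays of which one lies on
  the line joining their ends and the other does not, there would be no common parallel.
\<close>

definition parallel_to_ray :: "'l \<Rightarrow> 'p \<Rightarrow> 'p \<Rightarrow> bool" where
  "parallel_to_ray l R Q \<longleftrightarrow>
     contains_ray l R Q \<or> (\<exists>S U. contains_ray l S U \<and> rays_parallel S U R Q)"

subsection \<open>Rimpoints\<close>

definition concurrent_parallels :: "'l \<Rightarrow> 'l \<Rightarrow> 'l \<Rightarrow> bool" where
  "concurrent_parallels a b l \<longleftrightarrow>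
     parallel l a \<and> parallel l b \<and> (\<exists>t. meets t a \<and> meets t b \<and> meets t l)"

definition rim_pair :: "'l \<times> 'l \<Rightarrow> bool" where
  "rim_pair p \<longleftrightarrow> (case p of (a, b) \<Rightarrow> parallel a b \<and> (\<exists>l. concurrent_parallels a b l))"

definition rim_pair_inc :: "'l \<times> 'l \<Rightarrow> 'l \<Rightarrow> bool" where
  "rim_pair_inc p l \<longleftrightarrow> (case p of (a, b) \<Rightarrow> l \<in> {a, b} \<or> concurrent_parallels a b l)"

text \<open>
  The common transversal is needed for the same reason as in the two definitions above: the sides
  \<open>a, b, c\<close> of a triangle with three ideal vertices are pairwise parallel, but \<open>(a, b)\<close> and
  \<open>(a, c)\<close> are different vertices.
\<close>

definition rim_pair_eq :: "'l \<times> 'l \<Rightarrow> 'l \<times> 'l \<Rightarrow> bool" where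
  "rim_pair_eq p q \<longleftrightarrow> (case (p, q) of ((a, b), (c, d)) \<Rightarrow>
     (\<forall>x\<in>{a, b, c, d}. \<forall>y\<in>{a, b, c, d}. x = y \<or> parallel x y) \<and>
     (\<exists>t. \<forall>x\<in>{a, b, c, d}. meets t x))"

definition rim_class :: "'l \<times> 'l \<Rightarrow> 'l rimpoint" where
  "rim_class p = {q. rim_pair q \<and> rim_pair_eq p q}"

definition rim :: "'l rimpoint set" where
  "rim = rim_class ` {p. rim_pair p}"

fun on :: "('p, 'l) point \<Rightarrow> 'l \<Rightarrow> bool" where
  "on (Fin P) l = inc P l"
| "on (Rim X) l = (X \<in> rim \<and> (\<exists>p\<in>X. rim_pair_inc p l))"

definition join :: "('p, 'l) point \<Rightarrow> ('p, 'l) point \<Rightarrow> 'l" where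
  "join A B = (THE l. on A l \<and> on B l)"

abbreviation rjoin :: "'l rimpoint \<Rightarrow> 'l rimpoint \<Rightarrow> 'l" where
  "rjoin X Y \<equiv> join (Rim X) (Rim Y)"

definition half_turn :: "'p \<Rightarrow> 'l rimpoint \<Rightarrow> 'l rimpoint" where
  "half_turn A X =
     (if X \<in> rim then THE Y. Y \<noteq> X \<and> on (Rim Y) (join (Rim X) (Fin A)) else X)"

subsection \<open>The axioms\<close>

definition A1 :: bool where
  "A1 \<longleftrightarrow> (\<forall>P Q. P \<noteq> Q \<longrightarrow> (\<exists>!l. inc P l \<and> inc Q l))"

definition A2 :: bool where
  "A2 \<longleftrightarrow> (\<forall>l. \<exists>P. inc P l)"

definition A3 :: bool where
  "A3 \<longleftrightarrow> (\<exists>P Q R. distinct [P, Q, R] \<and> \<not> collinear {P, Q, R}) \<and>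
          (\<exists>P Q R. distinct [P, Q, R] \<and> collinear {P, Q, R})"

definition A4 :: bool where
  "A4 \<longleftrightarrow> (\<forall>P Q R. distinct [P, Q, R] \<and> collinear {P, Q, R} \<longrightarrow>
            separating Q P R \<or> separating P Q R \<or> separating P R Q)"

definition A5 :: bool where
  "A5 \<longleftrightarrow> (\<forall>P l. \<not> inc P l \<longrightarrow>
     (\<exists>a b. a \<noteq> b \<and> inc P a \<and> inc P b \<and> \<not> meets a l \<and> \<not> meets b l \<and>
            (\<forall>m. meets m l \<longrightarrow> meets m a \<or> meets m b)))"

definition A6 :: bool where
  "A6 \<longleftrightarrow> (\<forall>R Q S U. R \<noteq> Q \<and> S \<noteq> U \<and> \<not> collinear (ray R Q \<union> ray S U) \<longrightarrow>
     (\<exists>l. parallel_to_ray l R Q \<and> parallel_to_ray l S U))"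

definition meet_at :: "'l \<Rightarrow> 'l \<Rightarrow> 'p \<Rightarrow> bool" where
  "meet_at l m P \<longleftrightarrow> l \<noteq> m \<and> inc P l \<and> inc P m"

definition A7 :: bool where
  "A7 \<longleftrightarrow> (\<forall>A\<in>rim. \<forall>B\<in>rim. \<forall>C\<in>rim. \<forall>D\<in>rim. \<forall>E\<in>rim. \<forall>F\<in>rim. \<forall>P Q R.
     A \<noteq> B \<and> B \<noteq> C \<and> C \<noteq> D \<and> D \<noteq> E \<and> E \<noteq> F \<and> F \<noteq> A \<and>
     meet_at (rjoin A B) (rjoin D E) P \<and>
     meet_at (rjoin B C) (rjoin E F) Q \<and>
     meet_at (rjoin C D) (rjoin F A) R \<longrightarrow> collinear {P, Q, R})"

definition common_parallels_meet_on :: "'l \<Rightarrow> 'l \<Rightarrow> 'l \<Rightarrow> bool" where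
  "common_parallels_meet_on l m n \<longleftrightarrow>
     (\<exists>a b P. parallel a l \<and> parallel a m \<and> parallel b l \<and> parallel b m \<and>
              meet_at a b P \<and> inc P n)"

definition A10 :: bool where
  "A10 \<longleftrightarrow> (\<forall>P Q. P \<noteq> Q \<longrightarrow>
     (\<exists>l m. inc P l \<and> inc Q m \<and> common_parallels_meet_on l m (join (Fin P) (Fin Q))))"

text \<open>
  Products of permutations act from left to right, so the line \<open>X\<^sup>S\<^sup>R X\<^sup>R\<^sup>S\<close> joins
  \<open>half_turn R (half_turn S X)\<close> to \<open>half_turn S (half_turn R X)\<close>; for \<open>S = R\<close> there is no
  such line.
\<close>

definition A11 :: bool where
  "A11 \<longleftrightarrow> (\<forall>X\<in>rim. \<forall>l. \<not> on (Rim X) l \<longrightarrow>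
     (\<exists>!R. inc R l \<and> (\<forall>S. inc S l \<and> S \<noteq> R \<longrightarrow>
        common_parallels_meet_on l
          (rjoin (half_turn R (half_turn S X)) (half_turn S (half_turn R X)))
          (join (Rim X) (Fin R)))))"

subsection \<open>Axial maps and reflections\<close>

text \<open>\<open>crosses A B C D\<close> is the relation \<open>AB // CD\<close>.\<close>

definition crosses :: "'l rimpoint \<Rightarrow> 'l rimpoint \<Rightarrow> 'l rimpoint \<Rightarrow> 'l rimpoint \<Rightarrow> bool" where
  "crosses A B C D \<longleftrightarrow> A \<noteq> B \<and> C \<noteq> D \<and> meets (rjoin A B) (rjoin C D)"

definition rim_cyclic_order ::
    "('l rimpoint \<Rightarrow> 'l rimpoint \<Rightarrow> 'l rimpoint \<Rightarrow> bool) \<Rightarrow> bool" where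
  "rim_cyclic_order cyc \<longleftrightarrow>
     (\<forall>A\<in>rim. \<forall>B\<in>rim. \<forall>C\<in>rim. cyc A B C \<longrightarrow> cyc B C A \<and> \<not> cyc C B A) \<and>
     (\<forall>A\<in>rim. \<forall>B\<in>rim. \<forall>C\<in>rim. \<forall>D\<in>rim. cyc A B C \<and> cyc A C D \<longrightarrow> cyc A B D) \<and>
     (\<forall>A\<in>rim. \<forall>B\<in>rim. \<forall>C\<in>rim. distinct [A, B, C] \<longrightarrow> cyc A B C \<or> cyc C B A)"

definition compatible :: "('l rimpoint \<Rightarrow> 'l rimpoint \<Rightarrow> 'l rimpoint \<Rightarrow> bool) \<Rightarrow> bool" where
  "compatible cyc \<longleftrightarrow>
     (\<forall>A\<in>rim. \<forall>B\<in>rim. \<forall>C\<in>rim. \<forall>D\<in>rim.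
        crosses A C B D \<longleftrightarrow> cyc A B C \<and> cyc C D A \<or> cyc A D C \<and> cyc C B A)"

text \<open>
  The last conjunct excludes the maps, such as rotations about a finite point, for which the lines
  \<open>XY\<^sup>\<alpha>\<close> and \<open>YX\<^sup>\<alpha>\<close> never meet; every line would be an axis of these.
\<close>

definition order_preserving_axial :: "('l rimpoint \<Rightarrow> 'l rimpoint) \<Rightarrow> 'l \<Rightarrow> bool" where
  "order_preserving_axial \<alpha> l \<longleftrightarrow>
     \<alpha> permutes rim \<and> \<alpha> \<noteq> id \<and>
     (\<exists>cyc. rim_cyclic_order cyc \<and> compatible cyc \<and>
        (\<forall>A\<in>rim. \<forall>B\<in>rim. \<forall>C\<in>rim. cyc A B C \<longrightarrow> cyc (\<alpha> A) (\<alpha> B) (\<alpha> C))) \<and>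
     (\<forall>X\<in>rim. \<forall>Y\<in>rim. crosses X (\<alpha> Y) Y (\<alpha> X) \<longrightarrow>
        (\<exists>P. meet_at (rjoin X (\<alpha> Y)) (rjoin Y (\<alpha> X)) P \<and> inc P l)) \<and>
     (\<exists>X\<in>rim. \<exists>Y\<in>rim. crosses X (\<alpha> Y) Y (\<alpha> X))"

definition rims_of :: "'l \<Rightarrow> 'l rimpoint set" where
  "rims_of l = {X. on (Rim X) l}"

definition bowtie :: "'l \<Rightarrow> 'l \<Rightarrow> 'p" where
  "bowtie l m = (THE P. \<exists>L1 L2 M1 M2. l \<noteq> m \<and> \<not> parallel l m \<and>
     rims_of l = {L1, L2} \<and> rims_of m = {M1, M2} \<and>
     crosses L1 M2 L2 M1 \<and> meet_at (rjoin L1 M2) (rjoin L2 M1) P)"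

text \<open>
  The image of \<open>A\<close> is the value common to all \<open>\<alpha>\<close> for which the line joining the images of \<open>A\<close>
  under \<open>\<alpha>\<close> and its inverse exists; it need not exist when \<open>A\<close> is a fixed point of \<open>\<alpha>\<close>.
\<close>

definition reflection :: "'l \<Rightarrow> 'l rimpoint \<Rightarrow> 'l rimpoint" where
  "reflection l A =
     (if A \<notin> rim \<or> on (Rim A) l then A
      else THE B. \<exists>\<alpha>. order_preserving_axial \<alpha> l \<and> \<alpha> A \<noteq> inv \<alpha> A \<and>
                       B = half_turn (bowtie l (rjoin (\<alpha> A) (inv \<alpha> A))) A)"

end

subsection \<open>Abstract ovals\<close>

text \<open>Permutations of \<open>pts\<close> are functions on the whole type which are the identity off \<open>pts\<close>.\<close>

definition abstract_oval :: "'o set \<Rightarrow> ('o \<Rightarrow> 'o) set \<Rightarrow> bool" where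
  "abstract_oval pts S \<longleftrightarrow>
     (infinite pts \<or> 3 \<le> card pts) \<and>
     (\<forall>s\<in>S. s permutes pts \<and> s \<circ> s = id) \<and>
     (\<forall>A1\<in>pts. \<forall>A2\<in>pts. \<forall>B1\<in>pts. \<forall>B2\<in>pts. {A1, A2} \<inter> {B1, B2} = {} \<longrightarrow>
        (\<exists>!s. s \<in> S \<and> s A1 = A2 \<and> s B1 = B2))"

text \<open>A line of an oval is given by the set of the elements of \<open>pts\<close> and of \<open>S\<close> incident with it.\<close>

definition oval_line :: "('o \<Rightarrow> 'o) set \<Rightarrow> 'o \<Rightarrow> 'o \<Rightarrow> ('o + ('o \<Rightarrow> 'o)) set" where
  "oval_line S A B = Inl ` {A, B} \<union> Inr ` {s \<in> S. s A = B}"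

definition secant_lines :: "'o set \<Rightarrow> ('o \<Rightarrow> 'o) set \<Rightarrow> ('o + ('o \<Rightarrow> 'o)) set set" where
  "secant_lines pts S = {oval_line S A B | A B. A \<in> pts \<and> B \<in> pts \<and> A \<noteq> B}"

text \<open>The product \<open>IJK\<close>, acting from left to right, is \<open>K \<circ> J \<circ> I\<close>.\<close>

definition pascalian :: "('o \<Rightarrow> 'o) set \<Rightarrow> ('o + ('o \<Rightarrow> 'o)) set \<Rightarrow> bool" where
  "pascalian S l \<longleftrightarrow>
     (\<forall>I\<in>S. \<forall>J\<in>S. \<forall>K\<in>S. Inr I \<in> l \<and> Inr J \<in> l \<and> Inr K \<in> l \<longrightarrow>
        K \<circ> J \<circ> I \<in> S \<and> Inr (K \<circ> J \<circ> I) \<in> l)"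

end

theory Submission
  imports Defs
begin

text \<open>
  Axioms (A1)--(A6) give an ordered plane in which two asymptotic rays determine an end, and the
  rimpoints correspond to the ends.  The separation of pairs of ends by intersecting lines is a
  cyclic order, preserved by half-turns.
  
  Let \<open>l\<close> be a line.  For \<open>P, Q\<close> on \<open>l\<close> the translation \<open>\<alpha> = PQ\<close> moves all ends off \<open>l\<close> towards one
  end of \<open>l\<close>, so for \<open>X, Y\<close> on different sides of \<open>l\<close> the lines \<open>X Y\<^sup>\<alpha>\<close> and \<open>Y X\<^sup>\<alpha>\<close> meet, by Pascal's
  theorem (A7) on \<open>l\<close>.  Hence \<open>\<alpha>\<close> is determined by the image of one end off \<open>l\<close>, and a product of three
  half-turns about points of \<open>l\<close> is a half-turn.  An arbitrary order-preserving axial map with axis \<open>l\<close>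
  agrees with a translation at every end it moves, so the reflection in \<open>l\<close> sends \<open>X\<close> to \<open>X\<^sup>R\<close> with \<open>R\<close>
  as in (A11).  The line \<open>n = X X\<^sup>R\<close> is then perpendicular to \<open>l\<close>, a symmetric relation; Pascal's theorem
  shows that the reflection in \<open>l\<close> commutes with half-turns about points of \<open>l\<close>, and (A10) that there is
  a perpendicular at every point \<open>P\<close> of \<open>l\<close>, the reflection in it being \<open>P \<sigma>\<^sub>l\<close>.  Therefore the elements
  of \<open>T\<close> exchanging the ends of \<open>l\<close> are the maps \<open>P\<close> and \<open>P \<sigma>\<^sub>l\<close> with \<open>P\<close> on \<open>l\<close>, from which both claims
  can be read off.
\<close>

section \<open>Order on a line\<close>

context incidence
begin

text \<open>Betweenness is defined by meetings of lines alone, and (A4) says that some point of a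
  collinear triple separates the other two, not that only one does. The recurrent device is (A5): a
  line meeting \<open>l\<close> meets one of two lines through \<open>P\<close> that miss
  \<open>l\<close>, so a point \<open>P\<close> off \<open>l\<close> can be slid onto the first line
  without changing its side of \<open>l\<close>. Uniqueness of the middle point, Pasch's axiom and
  the extension of segments all rest on it; the hard case is a cyclic quadruple of collinear points,
  which no axiom excludes directly.

  Angles serve to give every end off a line a side of that line. With this, order means crossing of
  lines between ends, and geometry means products of half-turns. Half-turns about points of
  \<open>l\<close> that agree at one end off \<open>l\<close> are equal, so products are identified
  by testing one end. For lines without a common end, two common parallels meeting in
  \<open>P\<close> say that the half-turn about \<open>P\<close> carries the ends of one line to
  those of the other; this turns (A10) and (A11) into statements about permutations.\<close>

definition ln :: "'p \<Rightarrow> 'p \<Rightarrow> 'l" where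
  "ln P Q = (THE l. inc P l \<and> inc Q l)"

text \<open>
  The pair of lines of (A5).
\<close>

definition guard :: "'p \<Rightarrow> 'l \<Rightarrow> 'l \<Rightarrow> 'l \<Rightarrow> bool" where
  "guard P l a b \<longleftrightarrow> a \<noteq> b \<and> inc P a \<and> inc P b \<and> \<not> meets a l \<and> \<not> meets b l \<and>
     (\<forall>m. meets m l \<longrightarrow> meets m a \<or> meets m b)"

definition cross :: "'l \<Rightarrow> 'p \<Rightarrow> 'p \<Rightarrow> bool" where
  "cross m P Q \<longleftrightarrow> (\<exists>X. inc X m \<and> between P X Q)"

lemma meets_sym: "meets l m \<longleftrightarrow> meets m l"
  by (auto simp: meets_def)

lemma meets_irrefl [simp]: "\<not> meets l l"
  by (simp add: meets_def)

lemma meetsI: "inc P l \<Longrightarrow> inc P m \<Longrightarrow> l \<noteq> m \<Longrightarrow> meets l m"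
  by (auto simp: meets_def)

lemma meetsE: "meets l m \<Longrightarrow> (\<And>P. inc P l \<Longrightarrow> inc P m \<Longrightarrow> l \<noteq> m \<Longrightarrow> thesis) \<Longrightarrow> thesis"
  by (auto simp: meets_def)

lemma sepD: "separating A B C \<Longrightarrow> inc B m \<Longrightarrow> inc A a \<Longrightarrow> inc C c \<Longrightarrow> meets a c \<Longrightarrow>
    meets m a \<or> meets m c"
  by (auto simp: separating_def)

lemma sep_sym: "separating A B C \<longleftrightarrow> separating C B A"
  unfolding separating_def by (metis meets_sym)

lemma guard_sym: "guard P l a b \<longleftrightarrow> guard P l b a"
  unfolding guard_def by auto

lemma guardD:
  assumes "guard P l a b"
  shows "a \<noteq> b" "inc P a" "inc P b" "\<not> meets a l" "\<not> meets b l" "meets m l \<Longrightarrow> meets m a \<or> meets m b"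
  using assms unfolding guard_def by auto

lemma between_sym: "between A B C \<longleftrightarrow> between C B A"
  unfolding between_def collinear_def using sep_sym by auto

end

locale separated_plane = incidence inc for inc :: "'p \<Rightarrow> 'l \<Rightarrow> bool" +
  assumes ax1: A1 and ax2: A2 and ax3: A3 and ax4: A4 and ax5: A5
begin

lemma line_unique: "P \<noteq> Q \<Longrightarrow> inc P l \<Longrightarrow> inc Q l \<Longrightarrow> inc P m \<Longrightarrow> inc Q m \<Longrightarrow> l = m"
  using ax1 unfolding A1_def by blast

lemma meet_unique: "l \<noteq> m \<Longrightarrow> inc P l \<Longrightarrow> inc P m \<Longrightarrow> inc Q l \<Longrightarrow> inc Q m \<Longrightarrow> P = Q"
  using line_unique by blast

lemma ln_inc: assumes "P \<noteq> Q" shows "inc P (ln P Q)" "inc Q (ln P Q)"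
proof -
  have "\<exists>!l. inc P l \<and> inc Q l" using ax1 assms unfolding A1_def by blast
  then have "inc P (ln P Q) \<and> inc Q (ln P Q)" unfolding ln_def by (rule theI')
  then show "inc P (ln P Q)" "inc Q (ln P Q)" by auto
qed

lemma ln_eq: "P \<noteq> Q \<Longrightarrow> inc P l \<Longrightarrow> inc Q l \<Longrightarrow> ln P Q = l"
  using ln_inc line_unique by metis

lemma ln_sym: "ln P Q = ln Q P"
  unfolding ln_def by (metis (no_types, lifting))

lemma guard_ex: assumes "\<not> inc P l" obtains a b where "guard P l a b"
  using ax5 assms unfolding A5_def guard_def by blast

lemma guard_avoid: assumes "\<not> inc P l"
  obtains a where "inc P a" "a \<noteq> x" "\<not> meets a l"
  using guard_ex[OF assms] unfolding guard_def by metis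

lemma off_line: obtains P where "\<not> inc P l"
  using ax3 unfolding A3_def collinear_def by blast

lemma line_through: obtains m where "inc P m" "m \<noteq> l"
proof -
  obtain Q where "\<not> inc Q l" by (rule off_line)
  show thesis
  proof (cases "P = Q")
    case True
    obtain S where "inc S l" using ax2 unfolding A2_def by blast
    then show ?thesis using ln_inc[of P S] True \<open>\<not> inc Q l\<close> that by metis
  next
    case False then show ?thesis using ln_inc \<open>\<not> inc Q l\<close> that by metis
  qed
qed

lemma trich:
  assumes "inc A l" "inc B l" "inc C l" "A \<noteq> B" "B \<noteq> C" "A \<noteq> C"
  shows "separating A B C \<or> separating B A C \<or> separating A C B"
proof -
  have "distinct [A, B, C] \<and> collinear {A, B, C}"
    using assms unfolding collinear_def by auto
  then show ?thesis using ax4 unfolding A4_def by blast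
qed

text \<open>A line \<open>c\<close> on \<open>C\<close> cannot tell \<open>a\<close>,
  \<open>b\<close> and \<open>a'\<close> apart: \<open>b\<close> on \<open>B\<close> misses
  \<open>a\<close> and \<open>a'\<close>, so the two separations make \<open>c\<close> meet all
  three or none. The lines of (A5) through \<open>C\<close> that miss \<open>a\<close> would
  therefore miss \<open>a'\<close>; but \<open>a'\<close> meets \<open>a\<close> and so meets one of
  them.\<close>

lemma sep_unique:
  assumes l: "inc A l" "inc B l" "inc C l" "A \<noteq> B" "B \<noteq> C" "A \<noteq> C"
    and B: "separating A B C" and A: "separating B A C"
  shows False
proof -
  obtain a where a: "inc A a" "a \<noteq> l" by (rule line_through)
  have Ba: "\<not> inc B a" and Ca: "\<not> inc C a" using a l line_unique by blast+
  obtain b where b: "inc B b" "\<not> meets b a" using guard_avoid[OF Ba] by metis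
  have Ab: "\<not> inc A b" using b a l Ba meetsI by blast
  obtain a' where a': "inc A a'" "a' \<noteq> a" "\<not> meets a' b" using guard_avoid[OF Ab] by metis
  have key: "meets c x \<longleftrightarrow> meets c b" if "inc C c" "inc A x" "\<not> meets x b" for c x
    using sepD[OF B b(1) that(2,1)] sepD[OF A that(2) b(1) that(1)] that meets_sym[of x b] meets_sym[of x c]
      meets_sym[of b c]
    by blast
  obtain c1 c2 where c: "guard C a c1 c2" using guard_ex[OF Ca] by metis
  have "meets a' a" using a a' meetsI by blast
  then have "meets a' c1 \<or> meets a' c2" using guardD(6)[OF c] by blast
  moreover have "\<not> meets c1 a'" "\<not> meets c2 a'"
    using key[of c1 a] key[of c1 a'] key[of c2 a] key[of c2 a'] guardD[OF c] a a' b meets_sym by metis+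
  ultimately show False using meets_sym by blast
qed

lemma betweenI:
  assumes "inc A l" "inc B l" "inc C l" "A \<noteq> B" "B \<noteq> C" "A \<noteq> C" "separating A B C"
  shows "between A B C"
  using assms unfolding between_def collinear_def by auto

lemma betweenD:
  assumes "between A B C"
  shows "A \<noteq> B" "B \<noteq> C" "A \<noteq> C" "separating A B C" "inc A l \<Longrightarrow> inc B l \<Longrightarrow> inc C l"
    "inc A l \<Longrightarrow> inc C l \<Longrightarrow> inc B l" "inc C l \<Longrightarrow> inc B l \<Longrightarrow> inc A l"
proof -
  obtain k where k: "inc A k" "inc B k" "inc C k" and d: "A \<noteq> B" "B \<noteq> C" "A \<noteq> C" "separating A B C"
    using assms unfolding between_def collinear_def by auto
  show "A \<noteq> B" "B \<noteq> C" "A \<noteq> C" "separating A B C" by (rule d)+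
  show "inc A l \<Longrightarrow> inc B l \<Longrightarrow> inc C l" "inc A l \<Longrightarrow> inc C l \<Longrightarrow> inc B l" "inc C l \<Longrightarrow> inc B l \<Longrightarrow> inc A l"
    using k d line_unique by metis+
qed

lemma between_line: assumes "between A B C" obtains l where "inc A l" "inc B l" "inc C l"
  using assms unfolding between_def collinear_def by auto

lemma between_trich:
  assumes "inc A l" "inc B l" "inc C l" "A \<noteq> B" "B \<noteq> C" "A \<noteq> C"
  shows "between A B C \<or> between B A C \<or> between A C B"
  using trich[OF assms] assms betweenI[of _ l] by metis

lemma between_unique: "between A B C \<Longrightarrow> \<not> between B A C"
  by (metis sep_unique betweenD(1-4) between_line)

lemma between_unique': "between A B C \<Longrightarrow> \<not> between A C B"
  using between_unique between_sym by blast

text \<open>Suppose a line \<open>a\<close> on \<open>A\<close> misses \<open>b\<close> and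
  \<open>c\<close>. Since \<open>b\<close> meets \<open>c\<close>, (A5) at \<open>D\<close> gives a
  line \<open>dd\<close> on \<open>D\<close> that misses \<open>c\<close> and is met by
  \<open>b\<close>. Separation by \<open>A\<close> makes \<open>a\<close> meet \<open>dd\<close>,
  and then separation by \<open>C\<close> fails for \<open>a\<close> and \<open>dd\<close>.\<close>

lemma sep_inner:
  assumes l: "inc A l" "inc B l" "inc C l" "inc D l" and d: "A \<noteq> B" "A \<noteq> C" "A \<noteq> D" "B \<noteq> C" "B \<noteq> D" "C \<noteq> D"
    and A: "separating B A D" and C: "separating A C D"
  shows "separating B A C"
  unfolding separating_def
proof (intro allI impI, rule ccontr)
  fix a b c assume "inc A a \<and> inc B b \<and> inc C c \<and> meets b c" and n: "\<not> (meets a b \<or> meets a c)"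
  then have h: "inc A a" "inc B b" "inc C c" "meets b c" by auto
  have "c \<noteq> l" using n h l d meetsI by (metis meets_sym line_unique)
  then have "\<not> inc D c" using h l d line_unique by blast
  then obtain d1 d2 where d: "guard D c d1 d2" using guard_ex by metis
  then obtain dd where dd: "inc D dd" "\<not> meets dd c" "meets b dd" using guardD[OF d] h by metis
  have "meets a dd" using sepD[OF A h(1,2) dd(1,3)] n by blast
  then have "meets c a \<or> meets c dd" using sepD[OF C h(3,1) dd(1)] by blast
  then show False using n dd meets_sym by blast
qed

lemma between_inner:
  assumes A: "between B A D" and C: "between A C D"
  shows "between B A C" and "between B C D"
proof -
  obtain l where l: "inc B l" "inc A l" "inc D l" using between_line[OF A] by metis
  have "inc C l" using betweenD(6)[OF C] l by blast
  note l = this l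
  have d: "A \<noteq> B" "A \<noteq> C" "A \<noteq> D" "B \<noteq> D" "C \<noteq> D" using betweenD(1-3)[OF A] betweenD(1-3)[OF C] by blast+
  have BC: "B \<noteq> C" using A C between_unique by metis
  have s: "separating B A D" "separating A C D" using A C betweenD by metis+
  show 1: "between B A C" using sep_inner[of A l B C D] l d BC s betweenI[of _ l] by metis
  have "\<not> between C B D"
  proof
    assume "between C B D"
    then have "separating C B D" by (rule betweenD(4))
    then have "separating C B A" using sep_inner[of B l C A D] l d BC s by metis
    then show False using sep_unique[of B l A C] s l d BC betweenD(4)[OF 1] sep_sym by metis
  qed
  moreover have "\<not> between B D C"
  proof
    assume "between B D C"
    then have "separating C D B" using betweenD(4) sep_sym by metis
    then have "separating C D A" using sep_inner[of D l C A B] l d BC s sep_sym by metis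
    then show False using sep_unique[of D l C A] s l d BC sep_sym by metis
  qed
  ultimately show "between B C D" using between_trich[of B l C D] l d BC by metis
qed

lemma no_three_between:
  assumes "between X C Y" "between Y C Z" "between X C Z"
  shows False
proof -
  obtain l where l: "inc X l" "inc C l" "inc Y l" using between_line[OF assms(1)] by metis
  then have "inc Z l" using betweenD(5)[OF assms(3)] by blast
  note l = this l
  show False
  proof (cases "X = Y \<or> Y = Z \<or> X = Z")
    case True then show ?thesis using assms betweenD by metis
  next
    case False
    then consider "between X Y Z" | "between Y X Z" | "between X Z Y"
      using between_trich[of X l Y Z] l by metis
    then show ?thesis
      using assms between_inner between_unique between_sym by cases metis+
  qed
qed

section \<open>The number of points on a line\<close>

definition two_point :: "'l \<Rightarrow> bool" where
  "two_point l \<longleftrightarrow> (\<exists>P Q. \<forall>X. inc X l \<longrightarrow> X = P \<or> X = Q)"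

lemma second_point: assumes "inc P l" obtains Q where "inc Q l" "Q \<noteq> P"
proof -
  obtain p where p: "inc P p" "p \<noteq> l" by (rule line_through)
  obtain R where R: "\<not> inc R p" by (rule off_line)
  obtain q1 q2 where q: "guard R p q1 q2" using guard_ex[OF R] by metis
  have "meets l p" using p assms meetsI by blast
  then obtain q where "meets l q" "\<not> meets q p" "inc R q" using guardD[OF q] by metis
  then obtain Q where Q: "inc Q l" "inc Q q" by (auto elim: meetsE)
  have "Q \<noteq> P" using Q p meetsI \<open>\<not> meets q p\<close> R \<open>inc R q\<close> by blast
  then show thesis using Q that by blast
qed

text \<open>Let \<open>P\<close> and \<open>Q\<close> be second points of \<open>l\<close> and
  \<open>m\<close>, and \<open>X\<close> a third point of \<open>m\<close>. By (A5),
  \<open>l\<close> meets a line through \<open>Q\<close> that misses \<open>PX\<close>. It can only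
  do so in \<open>A\<close>, so that line is \<open>m\<close>, which contains
  \<open>X\<close>.\<close>

lemma two_point_through:
  assumes tp: "two_point l" and "inc A l" "inc A m"
  shows "two_point m"
proof (cases "m = l")
  case True then show ?thesis using tp by simp
next
  case False
  obtain P where P: "inc P l" "P \<noteq> A" using second_point[OF \<open>inc A l\<close>] by metis
  have lPA: "X = P \<or> X = A" if "inc X l" for X using tp that P assms unfolding two_point_def by metis
  obtain Q where Q: "inc Q m" "Q \<noteq> A" using second_point[OF \<open>inc A m\<close>] by metis
  have Ql: "\<not> inc Q l" using Q False assms line_unique by blast
  have "X = A \<or> X = Q" if X: "inc X m" for X
  proof (rule ccontr)
    assume n: "\<not> (X = A \<or> X = Q)"
    have Xl: "\<not> inc X l" using n X False assms line_unique by blast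
    then have "P \<noteq> X" using P by blast
    define p where "p = ln P X"
    have p: "inc P p" "inc X p" using ln_inc \<open>P \<noteq> X\<close> p_def by auto
    have Pm: "\<not> inc P m" using P False assms line_unique by blast
    have Qp: "\<not> inc Q p" using p Q X n Pm line_unique by metis
    obtain q1 q2 where q: "guard Q p q1 q2" using guard_ex[OF Qp] by metis
    have "meets l p" using p P Xl meetsI by blast
    then obtain q where q: "meets l q" "\<not> meets q p" "inc Q q" using guardD[OF q] by metis
    then obtain Y where Y: "inc Y l" "inc Y q" by (auto elim: meetsE)
    have "q \<noteq> p" using q Qp by blast
    have "Y \<noteq> P" using Y q p \<open>q \<noteq> p\<close> meetsI by blast
    then have "Y = A" using lPA Y by blast
    then have "q = m" using Y Q q assms line_unique by metis
    then show False using q p X \<open>q \<noteq> p\<close> meetsI by blast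
  qed
  then show ?thesis unfolding two_point_def by blast
qed

text \<open>Having only two points passes from a line to every line through one of them, so along
  joins it would reach the collinear triple of (A3).\<close>

lemma third_point: assumes "inc P l" "inc Q l" obtains X where "inc X l" "X \<noteq> P" "X \<noteq> Q"
proof -
  have "\<not> two_point l"
  proof
    assume tp: "two_point l"
    obtain A B C k where k: "inc A k" "inc B k" "inc C k" "A \<noteq> B" "B \<noteq> C" "A \<noteq> C"
      using ax3 unfolding A3_def collinear_def by auto
    have "two_point k"
    proof (cases "inc P k")
      case True then show ?thesis using two_point_through[OF tp] assms by blast
    next
      case False
      then have "P \<noteq> A" using k by blast
      then have "two_point (ln P A)" using two_point_through[OF tp assms(1)] ln_inc by blast
      then show ?thesis using two_point_through ln_inc k \<open>P \<noteq> A\<close> by blast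
    qed
    then show False using k unfolding two_point_def by metis
  qed
  then show thesis using that unfolding two_point_def by blast
qed

section \<open>Two lines across an angle, and quadruples of collinear points\<close>

lemma guard_hits:
  assumes T: "separating X A P" and "inc A a" "inc X m" "\<not> inc X a" "\<not> meets a m"
    and p: "guard P m p1 p2"
  shows "meets a p1 \<or> meets a p2"
proof -
  obtain x where x: "inc X x" "x \<noteq> m" "\<not> meets x a" using guard_avoid[OF \<open>\<not> inc X a\<close>] by metis
  have "meets x m" using x assms meetsI by blast
  then obtain q where q: "q = p1 \<or> q = p2" "meets x q" using guardD(6)[OF p] by blast
  then have "inc P q" using guardD[OF p] by blast
  then have "meets a x \<or> meets a q" using sepD[OF T \<open>inc A a\<close> x(1)] q by blast
  then show ?thesis using x q meets_sym by blast
qed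

text \<open>The lines \<open>m\<close> and \<open>n\<close> cut the sides of an angle at
  \<open>A\<close> in opposite order, \<open>B\<close> before \<open>C\<close> but \<open>X\<close>
  beyond \<open>P\<close>, so they ought to cross. If they do not, (A5) gives a line on
  \<open>A\<close> that meets \<open>m\<close> and misses \<open>n\<close>, against the separation
  by \<open>P\<close>.\<close>

lemma no_cut_far:
  assumes B: "separating A B C" and P: "separating A P X"
    and "inc B m" "inc X m" "inc C n" "inc P n" "\<not> meets m n" "m \<noteq> n" "\<not> inc A n"
  shows False
proof -
  obtain a1 a2 where a: "guard A n a1 a2" using guard_ex[OF \<open>\<not> inc A n\<close>] by metis
  have "\<not> inc C m" using assms meetsI by blast
  have "meets m a1 \<or> meets m a2"
    using guard_hits[of C B A m n a1 a2] B \<open>inc B m\<close> \<open>inc C n\<close> \<open>\<not> inc C m\<close> \<open>\<not> meets m n\<close> a sep_sym by blast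
  then obtain a0 where a0: "meets m a0" "inc A a0" "\<not> meets a0 n" using guardD[OF a] by blast
  then have "meets n a0 \<or> meets n m" using sepD[OF P \<open>inc P n\<close> a0(2) \<open>inc X m\<close>] meets_sym by blast
  then show False using a0 assms meets_sym by blast
qed

text \<open>If \<open>Q\<close> were between \<open>A\<close> and \<open>R\<close>, both lines of
  (A5) through \<open>Q\<close> missing \<open>CR\<close> would meet \<open>l\<close>, and neither
  in \<open>A\<close> nor in \<open>C\<close>. They would be \<open>QB\<close> and
  \<open>QD\<close>; these meet each other, so by separation at \<open>C\<close> the line
  \<open>CR\<close> would meet one of them.\<close>

lemma four_point_mid:
  assumes l: "inc A l" "inc B l" "inc C l" "inc D l" "distinct [A, B, C, D]"
    and all: "\<And>X. inc X l \<Longrightarrow> X \<in> {A, B, C, D}"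
    and C: "separating B C D" and g: "inc A g" "g \<noteq> l" "inc Q g" "inc R g" "Q \<noteq> A" "R \<noteq> A" "Q \<noteq> R"
  shows "between Q A R"
proof -
  have *: False if "inc Q g" "inc R g" "Q \<noteq> A" "R \<noteq> A" "Q \<noteq> R" and T: "separating A Q R" for Q R
  proof -
    note g = that(1-5) g(1,2)
    have Rl: "\<not> inc R l" "\<not> inc Q l" using g l line_unique by metis+
    then have CR: "C \<noteq> R" using l by blast
    define k where "k = ln C R"
    have k: "inc C k" "inc R k" using ln_inc CR k_def by auto
    have Qk: "\<not> inc Q k"
    proof
      assume "inc Q k"
      then have "k = g" using k g line_unique by metis
      then show False using k g l line_unique by auto
    qed
    obtain u v where uv: "guard Q k u v" using guard_ex[OF Qk] by metis
    have lk: "meets l k" using k l Rl meetsI by blast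
    have w: "inc B w \<or> inc D w" if "w = u \<or> w = v" for w
    proof -
      have w: "inc Q w" "\<not> meets w k" using that guardD[OF uv] by auto
      then have "meets w l" using sepD[OF T w(1) l(1) k(2) lk] by blast
      then obtain Y where Y: "inc Y w" "inc Y l" by (auto elim: meetsE)
      have "w \<noteq> k" using w Qk by blast
      have "Y \<noteq> A" using w Y g k \<open>w \<noteq> k\<close> meetsI line_unique by metis
      moreover have "Y \<noteq> C" using w Y k \<open>w \<noteq> k\<close> meetsI by metis
      ultimately show ?thesis using all[OF Y(2)] Y by auto
    qed
    have "(inc B u \<and> inc D v) \<or> (inc B v \<and> inc D u)"
      using w[of u] w[of v] guardD(1-3)[OF uv] Rl l line_unique by metis
    moreover have "meets u v" using guardD(1-3)[OF uv] meetsI by blast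
    ultimately have "meets k u \<or> meets k v" using sepD[OF C k(1)] meets_sym by metis
    then show False using guardD[OF uv] meets_sym by blast
  qed
  have "\<not> between A Q R" "\<not> between A R Q" using *[of Q R] *[of R Q] g betweenD by metis+
  then show ?thesis using between_trich[of Q g A R] g between_sym by metis
qed

text \<open>These are Menger's pseudolinear quadruples: each triple is consistent, but the four
  points have no linear order. A fifth point on the line leads to a contradiction by betweenness
  alone. On a line of exactly four points, \<open>A\<close> and \<open>C\<close> lie between any two
  other points of every other line through them, and this configuration is refuted by
  \<open>no_cut_far\<close>.\<close>

lemma no_pseudolinear:
  assumes "between A B C" "between B C D" "between C D A" "between D A B"
  shows False
proof -
  obtain l where l: "inc A l" "inc B l" "inc C l" using between_line[OF assms(1)] by metis
  then have "inc D l" using betweenD(5)[OF assms(2)] by blast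
  note l = l this
  have d: "distinct [A, B, C, D]" using assms betweenD by (metis distinct_length_2_or_more distinct_singleton)
  have fifth: "X \<in> {A, B, C, D}" if X: "inc X l" for X
  proof (rule ccontr)
    assume n: "X \<notin> {A, B, C, D}"
    have 1: "between A X C"
      using between_trich[of A l X C] no_three_between[of B C D] no_three_between[of B A D] between_inner assms l d X n between_sym
      by (metis distinct_length_2_or_more insertCI)
    have 2: "between B X D"
      using between_trich[of B l X D] no_three_between[of A B C] no_three_between[of A D C] between_inner assms l d X n between_sym
      by (metis distinct_length_2_or_more insertCI)
    have no: False if h: "between A B C" "between B C D" "between C D A" "between D A B"
      "inc A l" "inc B l" "inc C l" "inc D l" "distinct [A, B, C, D, X]" "between A X C" "between B X D"
      "between A X B" for A B C D
    proof -
      have b: "between C B X" using between_inner[of C B A X] h between_sym by blast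
      have a: "between D A X" using between_inner[of D A B X] h between_sym by blast
      consider "between D C X" | "between C D X" | "between C X D"
        using between_trich[of C l D X] h X between_sym by auto
      then show False
      proof cases
        case 1 then show ?thesis using between_inner[of D C X B] b h between_unique between_sym by metis
      next
        case 2 then show ?thesis using between_inner[of C D X A] a h between_unique between_sym by metis
      next
        case 3 then show ?thesis using between_inner[of D X C B] b h between_unique between_sym by metis
      qed
    qed
    have dX: "distinct [A, B, C, D, X]" "distinct [B, C, D, A, X]" "distinct [C, D, A, B, X]" "distinct [D, A, B, C, X]"
      using d n by auto
    have n1: "\<not> between A X B" using no[of A B C D] assms l dX 1 2 by blast
    have n2: "\<not> between B X C" using no[of B C D A] assms l dX 1 2 between_sym by blast
    have n3: "\<not> between C X D" using no[of C D A B] assms l dX 1 2 between_sym by blast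
    have n4: "\<not> between D X A" using no[of D A B C] assms l dX 1 2 between_sym by blast
    show False
    proof (cases "between A B X")
      case True
      then have "\<not> between C B X" using no_three_between[of A B C X] assms(1) between_sym no_three_between by metis
      then have "between B C X" using between_trich[of B l C X] l X d n n2 between_sym by auto
      then have "between A C X" using between_inner[of A B X C] True by blast
      then show False using 1 between_unique' by blast
    next
      case False
      then have a: "between B A X" using between_trich[of A l B X] l X d n n1 between_sym by auto
      then have "\<not> between D A X" using no_three_between assms(4) between_sym by metis
      then have "between A D X" using between_trich[of A l D X] l X d n n4 between_sym by auto
      then have "between B D X" using between_inner[of B A X D] a by blast
      then show False using 2 between_unique' by blast
    qed
  qed
  have fifth': "X \<in> {C, D, A, B}" if "inc X l" for X using fifth[OF that] by auto
  have midA: "between Q A R" if "inc A g" "g \<noteq> l" "inc Q g" "inc R g" "Q \<noteq> A" "R \<noteq> A" "Q \<noteq> R" for g Q R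
    using four_point_mid[OF l d fifth _ that] betweenD(4)[OF assms(2)] by blast
  have midC: "between Q C R" if "inc C g" "g \<noteq> l" "inc Q g" "inc R g" "Q \<noteq> C" "R \<noteq> C" "Q \<noteq> R" for g Q R
    using four_point_mid[OF l(3,4,1,2) _ fifth' _ that] d betweenD(4)[OF assms(4)] by auto
  obtain Q where Q: "\<not> inc Q l" by (rule off_line)
  define g where "g = ln A Q"
  have "A \<noteq> Q" using Q l by blast
  then have g: "inc A g" "inc Q g" using ln_inc g_def by auto
  then have gl: "g \<noteq> l" using Q by blast
  obtain R where R: "inc R g" "R \<noteq> A" "R \<noteq> Q" using third_point[OF g] by metis
  have QAR: "between Q A R" using midA[OF g(1) gl g(2) R(1)] R \<open>A \<noteq> Q\<close> by blast
  have Rl: "\<not> inc R l" using R g gl l line_unique by metis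
  have CR: "C \<noteq> R" "C \<noteq> Q" using Rl Q l by blast+
  define h where "h = ln C R"
  have h: "inc C h" "inc R h" using ln_inc CR h_def by auto
  obtain S where S: "inc S h" "S \<noteq> C" "S \<noteq> R" using third_point[OF h] by metis
  have RCS: "between R C S" using midC[OF h(1) _ h(2) S(1)] Rl h CR S by metis
  define m where "m = ln C Q"
  have m: "inc C m" "inc Q m" using ln_inc CR m_def by auto
  have Cg: "\<not> inc C g" using g gl l d line_unique by (metis distinct_length_2_or_more)
  have Rm: "\<not> inc R m" using m R g Cg line_unique by metis
  have Sm: "\<not> inc S m" using S h m Rm line_unique by metis
  obtain u v where uv: "guard S m u v" using guard_ex[OF Sm] by metis
  have "meets g m" using g m Cg meetsI by metis
  then obtain w where w: "inc S w" "\<not> meets w m" "meets g w" using guardD[OF uv] by metis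
  then obtain L where L: "inc L g" "inc L w" by (auto elim: meetsE)
  have wm: "w \<noteq> m" using w Sm by blast
  have LQ: "L \<noteq> Q" using L w m wm meetsI by blast
  have LR: "L \<noteq> R"
  proof
    assume "L = R"
    then have "w = h" using L w S h line_unique by metis
    then show False using w h m wm meetsI by blast
  qed
  \<comment> \<open>Any other point \<open>L\<close> of \<open>g\<close> would form with
    \<open>Q\<close> and \<open>R\<close> three points pairwise separated by
    \<open>A\<close>.\<close>
  have "L = A"
  proof (rule ccontr)
    assume "L \<noteq> A"
    then have "between Q A L" "between R A L" using midA[OF g(1) gl] g L R LQ LR \<open>A \<noteq> Q\<close> by metis+
    then show False using no_three_between QAR between_sym by metis
  qed
  then have "inc A w" using L by blast
  have "\<not> inc R w" using w L R S h Cg \<open>L = A\<close> g line_unique LR by metis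
  then show False
    using no_cut_far[of R C S A Q m w] betweenD(4)[OF RCS] betweenD(4)[OF QAR] sep_sym m w \<open>inc A w\<close> wm meets_sym
    by metis
qed

end

section \<open>Sides of a line\<close>

context separated_plane
begin

text \<open>Since \<open>B\<close> separates \<open>a1\<close> from \<open>g = CT\<close> and
  \<open>m\<close> misses \<open>a1\<close>, the line \<open>m\<close> cuts \<open>g\<close> in a
  point \<open>M\<close>. Whichever of \<open>C\<close>, \<open>M\<close>, \<open>T\<close> is in
  the middle of \<open>g\<close>, separation at that point ends in a meeting of two lines known to
  miss each other.\<close>

lemma path3_aux:
  assumes l: "inc A l" "inc B l" "inc C l" "A \<noteq> B" "C \<noteq> B" "A \<noteq> C" and B: "separating A B C"
    and m: "inc B m" "\<not> inc A m" and a: "guard A m a1 a2"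
    and p: "inc T a1" "inc U a2" "inc P p2" "inc T p2" "inc U p2" "\<not> meets p2 m" "\<not> inc A p2"
    and n: "inc P p1" "inc C p1" "\<not> meets p1 m" and U: "separating P U T"
  shows False
proof -
  note a' = guardD[OF a]
  have Cm: "\<not> inc C m" using l m line_unique by metis
  then have p1m: "p1 \<noteq> m" using n by blast
  have p2m: "p2 \<noteq> m" using p1m n p meetsI by blast
  have a1m: "a1 \<noteq> m" "a2 \<noteq> m" using a' m by blast+
  have am: "\<not> meets m a1" "\<not> meets m a2" "\<not> meets m p1" "\<not> meets m p2" using a' n p meets_sym by blast+
  have p1a: "\<not> meets p1 a1" "\<not> meets p1 a2"
    using sepD[OF B m(1) a'(2) n(2)] sepD[OF B m(1) a'(3) n(2)] am meets_sym by blast+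
  have "meets l m" using l m meetsI by blast
  then have al: "a1 \<noteq> l" "a2 \<noteq> l" using a' by blast+
  have Ca: "\<not> inc C a1" using al a' l line_unique by metis
  have CT: "C \<noteq> T" using Ca p by blast
  define g where "g = ln C T"
  have g: "inc C g" "inc T g" using ln_inc CT g_def by auto
  have "meets a1 g" using g p Ca meetsI by metis
  then have "meets m g" using sepD[OF B m(1) a'(2) g(1)] am by blast
  then obtain M where M: "inc M m" "inc M g" by (auto elim: meetsE)
  have MC: "M \<noteq> C" using M Cm by blast
  have MT: "M \<noteq> T" using M p a' a1m meetsI by metis
  have "p1 \<noteq> p2" using p1a p a' meetsI by metis
  then have pp: "meets p1 p2" using n p meetsI by metis
  have "meets a1 a2" using a' meetsI by blast
  consider "separating C M T" | "separating C T M" | "separating M C T"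
    using trich[of C g M T] g M MC MT CT by blast
  then show False
  proof cases
    case 1
    then show ?thesis using sepD[OF 1 M(1) n(2) p(4) pp] am by blast
  next
    case 2
    obtain c1 c2 where c: "guard C a1 c1 c2" using guard_ex[OF Ca] by metis
    then obtain c where c: "inc C c" "\<not> meets c a1" "meets a2 c"
      using guardD[OF c] \<open>meets a1 a2\<close> meets_sym by metis
    then have "meets m c" using sepD[OF B m(1) a'(3) c(1)] am by blast
    then show ?thesis using sepD[OF 2 p(1) c(1) M(1)] c am meets_sym by blast
  next
    case 3
    have "\<not> inc M p1" using M n p1m meetsI by blast
    then obtain mu where mu: "inc M mu" "mu \<noteq> m" "\<not> meets mu p1" using guard_avoid by metis
    have "meets mu m" using mu M meetsI by blast
    moreover have "\<not> meets mu a1" using sepD[OF 3 n(2) mu(1) p(1)] mu p1a meets_sym by blast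
    ultimately have mua: "meets mu a2" using a'(6) by blast
    have "\<not> inc T a2" using p a' meet_unique by metis
    then obtain t1 t2 where t: "guard T a2 t1 t2" using guard_ex by metis
    then obtain t where t: "inc T t" "\<not> meets t a2" "meets mu t" using guardD[OF t] mua by metis
    have "meets p1 t" using sepD[OF 3 n(2) mu(1) t(1)] t mu meets_sym by blast
    then show ?thesis using sepD[OF U p(2) n(1) t(1)] t p1a meets_sym by blast
  qed
qed

text \<open>In \<open>no_cut_near\<close> this prevents a line of (A5) at \<open>P\<close> from
  meeting both lines of (A5) at \<open>A\<close>. If \<open>P\<close> is between the points of
  \<open>p2\<close> on \<open>a1\<close> and \<open>a2\<close>, then \<open>p1\<close> meets one of
  these lines, which separation by \<open>B\<close> forbids; the two other positions are symmetric
  to each other.\<close>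

lemma path3:
  assumes l: "inc A l" "inc B l" "inc C l" "A \<noteq> B" "C \<noteq> B" "A \<noteq> C" and B: "separating A B C"
    and m: "inc B m" "\<not> inc A m" and a: "guard A m a1 a2"
    and p: "meets p2 a1" "meets p2 a2" "inc P p2" "\<not> meets p2 m" "\<not> inc A p2"
    and n: "inc P p1" "inc C p1" "\<not> meets p1 m"
  shows False
proof -
  note a' = guardD[OF a]
  have am: "\<not> meets m a1" "\<not> meets m a2" "\<not> meets m p1" "\<not> meets m p2" using a' n p meets_sym by blast+
  obtain T where T: "inc T a1" "inc T p2" using p by (auto elim: meetsE)
  obtain U where U: "inc U a2" "inc U p2" using p by (auto elim: meetsE)
  have p1a: "\<not> meets p1 a1" "\<not> meets p1 a2"
    using sepD[OF B m(1) a'(2) n(2)] sepD[OF B m(1) a'(3) n(2)] am meets_sym by blast+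
  have "meets l m" using l m meetsI by blast
  then have al: "a1 \<noteq> l" "a2 \<noteq> l" using a' by blast+
  have p1l: "a1 \<noteq> p1" "a2 \<noteq> p1" using al a' l n line_unique by metis+
  have TU: "T \<noteq> U" using T U a' p meet_unique by metis
  have PT: "P \<noteq> T" "P \<noteq> U" using T U p1a n p1l meetsI by metis+
  have aa: "meets a1 a2" using a' meetsI by blast
  consider "separating T P U" | "separating P T U" | "separating P U T"
    using trich[of P p2 T U] T U p TU PT sep_sym by metis
  then show False
  proof cases
    case 1 then show ?thesis using sepD[OF 1 n(1) T(1) U(1) aa] p1a by blast
  next
    case 2 then show ?thesis
      using path3_aux[OF l B m _ U(1) T(1) p(3) U(2) T(2) p(4,5) n 2] a guard_sym by blast
  next
    case 3 then show ?thesis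
      using path3_aux[OF l B m a T(1) U(1) p(3) T(2) U(2) p(4,5) n 3] by blast
  qed
qed

text \<open>Counterpart of \<open>no_cut_far\<close> with \<open>X\<close> and \<open>P\<close> on
  opposite sides of \<open>A\<close>. Each of \<open>a1\<close>, \<open>a2\<close> meets
  \<open>p1\<close> or \<open>p2\<close>, and by \<open>path3\<close> they do not meet the same one.
  So the line \<open>q\<close> among \<open>p1\<close>, \<open>p2\<close> that meets
  \<open>l\<close> also meets one of \<open>a1\<close>, \<open>a2\<close>, and its point
  \<open>D\<close> on \<open>l\<close> completes \<open>A\<close>, \<open>B\<close>,
  \<open>C\<close> to a pseudolinear quadruple.\<close>

lemma no_cut_near:
  assumes l: "inc A l" "inc B l" "inc C l" "A \<noteq> B" "B \<noteq> C" "A \<noteq> C"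
    and k: "inc A k" "inc X k" "inc P k" "A \<noteq> X" "X \<noteq> P" "A \<noteq> P" "k \<noteq> l"
    and m: "inc B m" "inc X m" "inc C n" "inc P n" "\<not> meets m n" "\<not> inc A m"
    and B: "separating A B C" and A: "separating X A P"
  shows False
proof -
  obtain a1 a2 where a: "guard A m a1 a2" using guard_ex m by metis
  note a' = guardD[OF a]
  have Pm: "\<not> inc P m" using k m line_unique by metis
  obtain p1 p2 where p: "guard P m p1 p2" using guard_ex[OF Pm] by metis
  note p' = guardD[OF p]
  have am: "\<not> meets m a1" "\<not> meets m a2" "\<not> meets m n" using a' m meets_sym by blast+
  have na: "\<not> meets n a1" "\<not> meets n a2"
    using sepD[OF B m(1) a'(2) m(3)] sepD[OF B m(1) a'(3) m(3)] am meets_sym by blast+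
  have a1m: "a1 \<noteq> m" "a2 \<noteq> m" using a' m by blast+
  have Xa: "\<not> inc X a1" "\<not> inc X a2" using m a' a1m meetsI by metis+
  have h1: "meets a1 p1 \<or> meets a1 p2" using guard_hits[OF A a'(2) m(2) Xa(1) a'(4) p] .
  have h2: "meets a2 p1 \<or> meets a2 p2" using guard_hits[OF A a'(3) m(2) Xa(2) a'(5) p] .
  have km: "meets k m" using k m meetsI by blast
  have Ap: "\<not> inc A p1" "\<not> inc A p2" using km p' k line_unique by metis+
  have nm: "\<not> meets n m" using m meets_sym by blast
  have both: "\<not> (meets a1 q \<and> meets a2 q)" if "q = p1 \<or> q = p2" for q
    using path3[OF l(1-4) _ l(6) B m(1,6) a _ _ _ _ _ m(4,3) nm, of q] that Ap p' l(5) meets_sym by metis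
  have lm: "meets l m" using l m meetsI by blast
  then obtain q where q: "q = p1 \<or> q = p2" "meets l q" using p'(6) by blast
  then obtain D where D: "inc D l" "inc D q" by (auto elim: meetsE)
  have Pq: "inc P q" "\<not> meets q m" "\<not> inc A q" using q p' Ap by blast+
  obtain aa where aa: "aa = a1 \<or> aa = a2" "meets aa q" using both h1 h2 q by blast
  have aa': "inc A aa" "\<not> meets m aa" using aa a' am by blast+
  have DA: "D \<noteq> A" using D Pq by blast
  have qm: "q \<noteq> m" using Pq Pm by blast
  have DB: "D \<noteq> B" using D Pq qm m meetsI by metis
  have nq: "n \<noteq> q" using aa na meets_sym by metis
  have PC: "P \<noteq> C" using k l line_unique by metis
  have DC: "D \<noteq> C" using D Pq nq m PC line_unique by metis
  have "meets n q" using nq Pq m meetsI by blast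
  have n1: "\<not> separating A B D" using sepD[OF _ m(1) aa'(1) D(2) aa(2)] aa' Pq meets_sym by blast
  have n2: "\<not> separating C B D" using sepD[OF _ m(1) m(3) D(2) \<open>meets n q\<close>] nm Pq meets_sym by blast
  have ABC: "between A B C" using betweenI[of A l B C] l B by blast
  have x1: "between A D C"
  proof -
    have "\<not> between D A C"
      using ABC between_inner[of D A C B] n1 n2 betweenD(4) between_sym sep_sym by metis
    moreover have "\<not> between A C D"
      using ABC between_inner[of D C A B] n1 n2 betweenD(4) between_sym sep_sym by metis
    ultimately show ?thesis using between_trich[of A l D C] l D DA DC between_sym by metis
  qed
  have x2: "between B C D"
  proof -
    have "\<not> between B D C"
      using ABC between_inner[of A B C D] n1 betweenD(4) between_sym sep_sym by metis
    then show ?thesis using between_trich[of B l C D] l D DB DC n2 betweenI[of C l B D] between_sym betweenD(4) by metis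
  qed
  have x3: "between D A B"
  proof -
    have "\<not> between A D B"
      using ABC between_inner[of C B A D] n2 betweenD(4) between_sym sep_sym by metis
    then show ?thesis using between_trich[of B l A D] l D DB DA n1 between_sym betweenD(4) by metis
  qed
  show False using no_pseudolinear[OF ABC x2 _ x3] x1 between_sym by blast
qed

text \<open>Removing \<open>X\<close> from a line leaves two classes, the one-dimensional form of
  Pasch's axiom. In \<open>mid\<close>, the one position not settled by trichotomy and
  \<open>between_inner\<close> is a pseudolinear quadruple.\<close>

lemma between_split:
  assumes "inc P l" "inc Q l" "inc R l" "inc X l" "P \<noteq> X" "Q \<noteq> X" "R \<noteq> X"
  shows "between P X R \<longleftrightarrow> (between P X Q \<noteq> between Q X R)"
proof (cases "P = Q \<or> Q = R \<or> P = R")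
  case True then show ?thesis using betweenD(3) between_sym by metis
next
  case False
  note a = assms
  have 1: "\<not> between P X R" if "between P X Q" "between Q X R" using no_three_between[of P X Q R] that by blast
  have mid: "between P X R" if h: "between P X Q" "\<not> between Q X R" "P \<noteq> Q" "P \<noteq> R" "Q \<noteq> R"
    "inc P l" "inc Q l" "inc R l" "P \<noteq> X" "Q \<noteq> X" "R \<noteq> X" for P Q R
  proof (rule ccontr)
    assume n: "\<not> between P X R"
    have QR: "between X Q R \<or> between Q R X" using between_trich[of Q l X R] h a n between_sym by metis
    have PR: "between X P R \<or> between P R X" using between_trich[of P l X R] h a n between_sym by metis
    have "\<not> between X R Q" using between_inner[of P X Q R] h n by blast
    then have xqr: "between X Q R" using QR between_sym by blast
    have "\<not> between X R P" using between_inner[of Q X P R] h n between_sym by metis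
    then have xpr: "between X P R" using PR between_sym by blast
    consider "between P Q R" | "between Q P R" | "between P R Q"
      using between_trich[of P l Q R] h by metis
    then show False
    proof cases
      case 1
      then show ?thesis using between_inner[of R Q P X] h n between_sym by metis
    next
      case 2
      then show ?thesis using between_inner[of R P Q X] h n between_sym by metis
    next
      case 3
      then show ?thesis using no_pseudolinear[of X P R Q] xpr xqr h n between_sym by metis
    qed
  qed
  have 2: "\<not> between P X R" if "\<not> between P X Q" "\<not> between Q X R"
    using mid[of P R Q] that a False between_sym by metis
  show ?thesis using 1 2 mid[of P Q R] mid[of R Q P] a False between_sym by metis
qed

section \<open>Pasch's axiom\<close>

lemma cross_sym: "cross m P Q \<longleftrightarrow> cross m Q P"
  unfolding cross_def using between_sym by blast

lemma cross_refl [simp]: "\<not> cross m P P"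
  unfolding cross_def using betweenD(3) by blast

lemma cross_on:
  assumes "inc P l" "inc Q l" "inc X l" "inc X m" "l \<noteq> m"
  shows "cross m P Q \<longleftrightarrow> between P X Q"
proof (cases "P = Q")
  case True then show ?thesis using betweenD(3) by auto
next
  case False
  show ?thesis
  proof
    assume "cross m P Q"
    then obtain Y where "inc Y m" "between P Y Q" unfolding cross_def by blast
    moreover from this have "inc Y l" using betweenD(6) assms by blast
    ultimately show "between P X Q" using assms meet_unique by metis
  qed (use assms cross_def in blast)
qed

lemma cross_meets: assumes "cross m P Q" "inc P l" "inc Q l" "\<not> inc P m" shows "meets l m"
  using assms betweenD(6) meetsI unfolding cross_def by metis

lemma no_cross: "\<not> meets l m \<Longrightarrow> inc P l \<Longrightarrow> inc Q l \<Longrightarrow> \<not> inc P m \<Longrightarrow> \<not> cross m P Q"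
  using cross_meets by blast

text \<open>Pasch's axiom for a triangle one of whose sides does not meet \<open>m\<close>.
  Separation at the crossing point of \<open>QR\<close> makes \<open>m\<close> meet the line
  \<open>PR\<close>; \<open>no_cut_near\<close> and \<open>no_cut_far\<close> exclude the two
  positions outside the segment.\<close>

lemma cross_one_miss:
  assumes n: "inc P n" "inc Q n" "\<not> meets n m" and off: "\<not> inc P m" "\<not> inc Q m" "\<not> inc R m" "\<not> inc R n"
    and c: "cross m Q R"
  shows "cross m P R"
proof (cases "P = Q")
  case True then show ?thesis using c by simp
next
  case False
  obtain X where X: "inc X m" "between Q X R" using c unfolding cross_def by blast
  obtain l where l: "inc Q l" "inc X l" "inc R l" using between_line[OF X(2)] by metis
  note d = betweenD(1-4)[OF X(2)]
  have RP: "R \<noteq> P" using off n by blast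
  define k where "k = ln R P"
  have k: "inc R k" "inc P k" using ln_inc RP k_def by auto
  have kl: "k \<noteq> l" using k l n off False line_unique by metis
  have "k \<noteq> n" using k off by blast
  then have "meets k n" using k n meetsI by blast
  have "meets m k"
  proof (rule ccontr)
    assume "\<not> meets m k"
    moreover have "\<not> meets m n" using n meets_sym by blast
    ultimately show False using sepD[OF d(4) X(1) n(2) k(1)] \<open>meets k n\<close> meets_sym by blast
  qed
  then obtain Y where Y: "inc Y m" "inc Y k" by (auto elim: meetsE)
  have YR: "Y \<noteq> R" "Y \<noteq> P" using Y off by blast+
  have mn: "\<not> meets m n" "m \<noteq> n" using n meets_sym off by blast+
  have "\<not> separating Y R P"
    using no_cut_near[of R l X Q k Y P m n] l k X n d YR RP kl Y mn off sep_sym by metis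
  moreover have "\<not> separating R P Y"
    using no_cut_far[of R X Q P Y m n] d X Y n mn off sep_sym by metis
  ultimately have "separating R Y P" using trich[of R k Y P] k Y YR RP sep_sym by metis
  then have "between R Y P" using betweenI[of R k Y P] k Y YR RP by blast
  then show ?thesis unfolding cross_def using Y between_sym by blast
qed

lemma cross_miss:
  assumes n: "inc P n" "inc Q n" "\<not> meets n m" and off: "\<not> inc P m" "\<not> inc Q m" "\<not> inc R m"
  shows "cross m P R \<longleftrightarrow> cross m Q R"
proof (cases "inc R n")
  case True
  then show ?thesis using no_cross[OF n(3)] n off by blast
next
  case False
  then show ?thesis using cross_one_miss[of P n Q m R] cross_one_miss[of Q n P m R] assms by blast
qed

text \<open>If \<open>QR\<close> meets \<open>m\<close>, then by (A5) it meets a line through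
  \<open>P\<close> that misses \<open>m\<close>, in \<open>Z\<close> say. Replacing \<open>P\<close>
  by \<open>Z\<close> changes no crossing and leaves three points on one line.\<close>

lemma cross_parity:
  assumes off: "\<not> inc P m" "\<not> inc Q m" "\<not> inc R m"
  shows "cross m P R \<longleftrightarrow> (cross m P Q \<noteq> cross m Q R)"
proof (cases "P = Q \<or> Q = R \<or> P = R")
  case True then show ?thesis using cross_sym by auto
next
  case False
  define k where "k = ln Q R"
  have k: "inc Q k" "inc R k" using ln_inc False k_def by auto
  show ?thesis
  proof (cases "meets k m")
    case False
    then show ?thesis using cross_miss[of Q k R m P] k off no_cross cross_sym by metis
  next
    case True
    then obtain X where X: "inc X k" "inc X m" and km: "k \<noteq> m" by (auto elim: meetsE)
    obtain a1 a2 where a: "guard P m a1 a2" using guard_ex off by metis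
    then obtain a where a: "inc P a" "\<not> meets a m" "meets k a" using guardD[OF a] True by metis
    then obtain Z where Z: "inc Z k" "inc Z a" by (auto elim: meetsE)
    have Zm: "\<not> inc Z m" using Z a off meetsI by metis
    have 1: "cross m P Q \<longleftrightarrow> cross m Z Q" "cross m P R \<longleftrightarrow> cross m Z R"
      using cross_miss[of P a Z m] a Z off Zm by blast+
    have "between Z X R \<longleftrightarrow> (between Z X Q \<noteq> between Q X R)"
      using between_split[of Z k Q R X] k X Z Zm off by blast
    then show ?thesis using 1 cross_on[of _ k _ X m] k X Z km by metis
  qed
qed

text \<open>Points on the two sides of \<open>c\<close> are slid onto \<open>n\<close> along lines
  that miss \<open>c\<close>.\<close>

lemma extension_aux:
  assumes c: "inc N c" "inc N n" "c \<noteq> n" and K: "cross c K K'" "\<not> inc K c" "\<not> inc K' c"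
  obtains L L' where "inc L n" "inc L' n" "between L N L'"
proof -
  have hit: "\<exists>L. inc L n \<and> \<not> inc L c \<and> (\<forall>R. \<not> inc R c \<longrightarrow> cross c K R = cross c L R)" if K: "\<not> inc K c" for K
  proof -
    obtain a1 a2 where a: "guard K c a1 a2" using guard_ex K by metis
    moreover have "meets n c" using c meetsI by metis
    ultimately obtain a where a: "inc K a" "\<not> meets a c" "meets n a" using guardD[OF a] by metis
    then obtain L where L: "inc L n" "inc L a" by (auto elim: meetsE)
    have "\<not> inc L c" using L a K meetsI by metis
    then show ?thesis using cross_miss[of K a L c] a L K by metis
  qed
  obtain L where L: "inc L n" "\<not> inc L c" "\<forall>R. \<not> inc R c \<longrightarrow> cross c K R = cross c L R" using hit K by blast
  obtain L' where L': "inc L' n" "\<not> inc L' c" "\<forall>R. \<not> inc R c \<longrightarrow> cross c K' R = cross c L' R" using hit K by blast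
  have "cross c L L'" using L L' K cross_sym by metis
  then show thesis using cross_on[of L n L' N c] L L' c that by metis
qed

text \<open>(A3) yields one point \<open>M\<close> between two others. The property spreads by
  \<open>extension_aux\<close>, which needs through the target point a line \<open>c\<close>
  different from both lines concerned; the detours below provide it.\<close>

lemma extension_point: assumes "inc N n" obtains L L' where "inc L n" "inc L' n" "between L N L'"
proof -
  obtain A M C l where M: "between A M C" "inc A l" "inc M l" "inc C l"
    using ax3 between_trich unfolding A3_def collinear_def by (metis distinct_length_2_or_more insertCI)
  have opp: "cross c K K'" "\<not> inc K c" "\<not> inc K' c" if "between K N K'" "inc K k" "inc K' k" "inc N c" "c \<noteq> k" for K K' N k c
    using that cross_on betweenD line_unique unfolding cross_def by metis+
  have atM: "\<exists>L L'. inc L k \<and> inc L' k \<and> between L M L'" if k: "inc M k" for k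
  proof (cases "k = l")
    case True then show ?thesis using M by blast
  next
    case False
    obtain Q where Q: "\<not> inc Q l" by (rule off_line)
    \<comment> \<open>\<open>c\<close> joins \<open>M\<close> to a third point of a line from
      \<open>A\<close> on \<open>l\<close> to \<open>Q\<close> on \<open>k\<close>, hence is neither
      \<open>k\<close> nor \<open>l\<close>.\<close>
    obtain c where c: "inc M c" "c \<noteq> k" "c \<noteq> l"
    proof -
      obtain Q where Q: "inc Q k" "Q \<noteq> M" using second_point[OF k] by metis
      then have "A \<noteq> Q" "\<not> inc Q l" using False k M line_unique by metis+
      then obtain R where R: "inc R (ln A Q)" "R \<noteq> A" "R \<noteq> Q" using third_point ln_inc by metis
      have AQ: "inc A (ln A Q)" "inc Q (ln A Q)" using ln_inc \<open>A \<noteq> Q\<close> by auto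
      have "\<not> inc R l" using R AQ M \<open>\<not> inc Q l\<close> line_unique by metis
      moreover have "\<not> inc R k" using R AQ Q k M False line_unique betweenD(1)[OF M(1)] by metis
      ultimately show thesis using that ln_inc M by metis
    qed
    then show ?thesis using extension_aux[OF c(1) k c(2)] opp[OF M(1,2,4) c(1,3)] by metis
  qed
  have off: "\<exists>L L'. inc L n \<and> inc L' n \<and> between L N L'"
    if at: "\<And>k. inc M k \<Longrightarrow> P k \<Longrightarrow> \<exists>L L'. inc L k \<and> inc L' k \<and> between L M L'" 
      and c: "inc M c" "inc N c" "c \<noteq> n" "inc N n" and k: "inc M k" "P k" "k \<noteq> c" for M N n c k P
    using at[OF k(1,2)] extension_aux[OF c(2,4,3)] opp[of _ M _ k c] c k by metis
  show thesis
  proof (cases "N = M")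
    case True then show ?thesis using atM assms that by blast
  next
    case False
    show ?thesis
    proof (cases "inc M n")
      case F: False
      obtain k where "inc M k" "k \<noteq> ln M N" by (rule line_through)
      then show ?thesis using off[of M "\<lambda>_. True" "ln M N" N n k] atM False F assms ln_inc[of M N] that by metis
    next
      case T: True
      \<comment> \<open>Here \<open>MN\<close> is \<open>n\<close> itself, so the property is
        carried to a point \<open>M'\<close> off \<open>n\<close> and from there along
        \<open>M'N\<close> to \<open>N\<close>.\<close>
      obtain M' where M': "\<not> inc M' n" by (rule off_line)
      have at': "\<exists>L L'. inc L k \<and> inc L' k \<and> between L M' L'" if k: "inc M' k" "k \<noteq> ln M M'" for k
      proof -
        have "M \<noteq> M'" using T M' by blast
        obtain k' where "inc M k'" "k' \<noteq> ln M M'" by (rule line_through)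
        then show ?thesis using off[of M "\<lambda>_. True" "ln M M'" M' k k'] atM ln_inc[of M M'] \<open>M \<noteq> M'\<close> k by metis
      qed
      have MM': "M \<noteq> M'" "N \<noteq> M'" using T M' assms by blast+
      obtain X where X: "inc X n" "X \<noteq> M" "X \<noteq> N" using third_point assms T by metis
      have XM': "X \<noteq> M'" using X M' by blast
      have kk: "ln M' X \<noteq> ln M M'" "ln M' X \<noteq> ln M' N"
        using ln_inc[of M' X] ln_inc[of M M'] ln_inc[of M' N] XM' MM' X M' T assms line_unique by metis+
      show ?thesis
        using off[of M' "\<lambda>k. k \<noteq> ln M M'" "ln M' N" N n "ln M' X"] at' ln_inc[of M' N] ln_inc[of M' X] MM' XM' kk assms M' that
        by metis
    qed
  qed
qed

lemma extend: assumes "A \<noteq> C" obtains D where "between A C D"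
proof -
  have l: "inc A (ln A C)" "inc C (ln A C)" using ln_inc assms by auto
  obtain L L' where L: "inc L (ln A C)" "inc L' (ln A C)" "between L C L'" using extension_point[OF l(2)] by metis
  show thesis
  proof (cases "between A C L \<or> between A C L'")
    case True then show ?thesis using that by blast
  next
    case False
    then have "\<not> between L C L'"
      using between_split[of L "ln A C" A L' C] L l assms betweenD(1,2)[OF L(3)] between_sym by metis
    then show ?thesis using L by blast
  qed
qed

end

section \<open>Asymptotic rays\<close>

context incidence
begin

text \<open>
  Being on the same side of a line, on opposite sides of it, and in the interior of the angle \<open>QRS\<close>.
  The ray \<open>RQ\<close> is asymptotic to \<open>SU\<close> if it misses the line \<open>SU\<close> while every ray from \<open>R\<close> inside the angle \<open>QRS\<close> meets it;
  this turns out to be parallelism of rays.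
\<close>

definition ss :: "'l \<Rightarrow> 'p \<Rightarrow> 'p \<Rightarrow> bool" where
  "ss m P Q \<longleftrightarrow> \<not> inc P m \<and> \<not> inc Q m \<and> \<not> cross m P Q"

definition opp :: "'l \<Rightarrow> 'p \<Rightarrow> 'p \<Rightarrow> bool" where
  "opp m P Q \<longleftrightarrow> \<not> inc P m \<and> \<not> inc Q m \<and> cross m P Q"

definition inside :: "'p \<Rightarrow> 'p \<Rightarrow> 'p \<Rightarrow> 'p \<Rightarrow> bool" where
  "inside S R Q X \<longleftrightarrow> ss (ln R Q) X S \<and> ss (ln R S) X Q"

definition asy :: "'p \<Rightarrow> 'p \<Rightarrow> 'p \<Rightarrow> 'p \<Rightarrow> bool" where
  "asy R Q S U \<longleftrightarrow> R \<noteq> Q \<and> S \<noteq> U \<and> \<not> inc S (ln R Q) \<and> \<not> meets (ln R Q) (ln S U) \<and>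
     ss (ln R S) Q U \<and> (\<forall>X. inside S R Q X \<longrightarrow> meets (ln R X) (ln S U))"

end

context separated_plane
begin

section \<open>Sides, angles and the crossbar property\<close>

lemma ss_sym: "ss m P Q \<Longrightarrow> ss m Q P"
  unfolding ss_def using cross_sym by blast

lemma opp_sym: "opp m P Q \<Longrightarrow> opp m Q P"
  unfolding opp_def using cross_sym by blast

lemma ss_trans: "ss m P Q \<Longrightarrow> ss m Q R \<Longrightarrow> ss m P R"
  unfolding ss_def using cross_parity by blast

lemma opp_opp: "opp m P Q \<Longrightarrow> opp m Q R \<Longrightarrow> ss m P R"
  unfolding ss_def opp_def using cross_parity by blast

lemma ss_opp: "ss m P Q \<Longrightarrow> opp m Q R \<Longrightarrow> opp m P R"
  unfolding ss_def opp_def using cross_parity by blast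

lemma opp_ss: "opp m P Q \<Longrightarrow> ss m Q R \<Longrightarrow> opp m P R"
  unfolding ss_def opp_def using cross_parity by blast

lemma ss_or_opp: "\<not> inc P m \<Longrightarrow> \<not> inc Q m \<Longrightarrow> ss m P Q \<or> opp m P Q"
  unfolding ss_def opp_def by blast

lemma ss_not_opp: "ss m P Q \<Longrightarrow> \<not> opp m P Q"
  unfolding ss_def opp_def by blast

lemma ss_off: "ss m P Q \<Longrightarrow> \<not> inc P m" "ss m P Q \<Longrightarrow> \<not> inc Q m"
  unfolding ss_def by blast+

lemma opp_off: "opp m P Q \<Longrightarrow> \<not> inc P m" "opp m P Q \<Longrightarrow> \<not> inc Q m"
  unfolding opp_def by blast+

lemma ss_refl: "\<not> inc P m \<Longrightarrow> ss m P P"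
  unfolding ss_def by simp

lemma ss_miss: "\<not> meets n m \<Longrightarrow> inc P n \<Longrightarrow> inc Q n \<Longrightarrow> \<not> inc P m \<Longrightarrow> ss m P Q"
  unfolding ss_def using no_cross[of n m P Q] meetsI[of Q n m] by blast

lemma opp_pt: assumes "opp m P Q" obtains X where "inc X m" "between P X Q"
  using assms unfolding opp_def cross_def by blast

lemma opp_meets: "opp m P Q \<Longrightarrow> inc P l \<Longrightarrow> inc Q l \<Longrightarrow> meets l m"
  unfolding opp_def using cross_meets by blast

lemma between_opp: assumes "between A Z B" "inc Z m" "\<not> inc A m" shows "opp m A B"
proof -
  have "\<not> inc B m" using assms betweenD(7) by metis
  then show ?thesis unfolding opp_def cross_def using assms by blast
qed

lemma ray_ss:
  assumes "inc A l" "inc B l" "inc Z l" "inc Z m" "l \<noteq> m" "A \<noteq> Z" "B \<noteq> Z"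
  shows "ss m A B \<longleftrightarrow> \<not> between A Z B" "opp m A B \<longleftrightarrow> between A Z B"
proof -
  have "\<not> inc A m" "\<not> inc B m" using assms meet_unique by metis+
  then show "ss m A B \<longleftrightarrow> \<not> between A Z B" "opp m A B \<longleftrightarrow> between A Z B"
    using cross_on[of A l B Z m] assms unfolding ss_def opp_def by auto
qed

lemma ray_change:
  assumes "inc A l" "inc B l" "inc Z l" "inc Z m" "l \<noteq> m" "inc Z m'" "l \<noteq> m'" "A \<noteq> Z" "B \<noteq> Z"
  shows "ss m A B \<longleftrightarrow> ss m' A B" "opp m A B \<longleftrightarrow> opp m' A B"
  using ray_ss[OF assms(1-5,8,9)] ray_ss[OF assms(1-3,6-9)] by simp_all

lemma seg_ss: assumes "between A Y B" "inc A m" "\<not> inc B m" shows "ss m Y B"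
proof -
  obtain l where l: "inc A l" "inc Y l" "inc B l" using between_line[OF assms(1)] by metis
  show ?thesis
    using ray_ss(1)[of Y l B A m] l assms betweenD(1,3)[OF assms(1)] between_unique between_sym by metis
qed

lemma between_of_rays:
  assumes "inc A l" "inc Y l" "inc B l" "inc A m" "l \<noteq> m" "inc B n" "l \<noteq> n" "ss m Y B" "ss n Y A" "A \<noteq> B"
  shows "between A Y B"
proof -
  have "Y \<noteq> A" "Y \<noteq> B" using assms ss_off by blast+
  moreover have "\<not> between Y A B" using ray_ss(1)[of Y l B A m] assms calculation by metis
  moreover have "\<not> between Y B A" using ray_ss(1)[of Y l A B n] assms calculation by metis
  ultimately show ?thesis using between_trich[of A l Y B] assms between_sym by metis
qed

lemma side_point:
  assumes "inc R h" "inc R l" "h \<noteq> l" "\<not> inc S l"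
  obtains X where "inc X h" "X \<noteq> R" "ss l X S"
proof -
  obtain A B where AB: "inc A h" "inc B h" "between A R B" using extension_point[OF assms(1)] by metis
  have d: "A \<noteq> R" "B \<noteq> R" using betweenD(1,2)[OF AB(3)] by metis+
  have o: "opp l A B" using ray_ss(2)[of A h B R l] AB assms d by metis
  show thesis
  proof (cases "ss l A S")
    case True then show ?thesis using that AB d by blast
  next
    case False
    then have "opp l S A" using ss_or_opp opp_off[OF o] assms opp_sym by metis
    then have "ss l S B" using opp_opp o by blast
    then show ?thesis using that AB d ss_sym by blast
  qed
qed

text \<open>If \<open>S\<close> and \<open>Q\<close> were on one side of \<open>RX\<close>, a point
  \<open>Y\<close> of \<open>RX\<close> would lie between \<open>Q\<close> and a point
  \<open>S'\<close> on the extension of \<open>SR\<close> beyond \<open>R\<close>. Then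
  \<open>Y\<close> is on the ray \<open>RX\<close>, but on the side of \<open>RQ\<close> away from
  \<open>S\<close>, where that ray is not.\<close>

lemma crossbar: assumes "inside S R Q X" "R \<noteq> S" "R \<noteq> Q" shows "opp (ln R X) S Q"
proof -
  have h: "ss (ln R Q) X S" "ss (ln R S) X Q" using assms unfolding inside_def by auto
  note lRQ = ln_inc[OF assms(3)] and lRS = ln_inc[OF assms(2)]
  have RX: "R \<noteq> X" using h lRQ ss_off by blast
  note lRX = ln_inc[OF RX]
  have S: "\<not> inc S (ln R X)" using lRX lRS h ss_off assms line_unique by metis
  have Q: "\<not> inc Q (ln R X)" using lRX lRQ h ss_off assms line_unique by metis
  show ?thesis
  proof (rule ccontr)
    assume "\<not> ?thesis"
    then have SQ: "ss (ln R X) S Q" using ss_or_opp S Q by blast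
    obtain S' where S': "between S R S'" using extend assms by metis
    have iS': "inc S' (ln R S)" using betweenD(5)[OF S'] lRS by blast
    have "opp (ln R X) S S'" using between_opp S' lRX S by blast
    then have "opp (ln R X) S' Q" using SQ opp_sym opp_ss by blast
    then obtain Y where Y: "inc Y (ln R X)" "between S' Y Q" by (rule opp_pt)
    have SnQ: "\<not> inc S (ln R Q)" using h ss_off by blast
    have o: "opp (ln R Q) S S'" using between_opp S' lRQ SnQ by blast
    have 1: "ss (ln R Q) Y S'" using seg_ss[of Q Y S' "ln R Q"] Y lRQ opp_off[OF o] between_sym by blast
    have 2: "ss (ln R S) Y Q" using seg_ss[of S' Y Q "ln R S"] Y iS' h ss_off by blast
    have YR: "Y \<noteq> R" using 2 lRS ss_off by blast
    have ne: "ln R X \<noteq> ln R S" "ln R X \<noteq> ln R Q" using S Q lRS lRQ by metis+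
    have "ss (ln R S) Y X" using 2 h ss_sym ss_trans by blast
    then have "ss (ln R Q) Y X" using ray_change(1)[of Y "ln R X" X R "ln R S" "ln R Q"] Y lRX lRS lRQ ne YR RX by metis
    then have "ss (ln R Q) S' S" using 1 h ss_sym ss_trans by blast
    then show False using o opp_sym ss_not_opp by blast
  qed
qed

lemma inside_cases:
  assumes AB: "ss (ln R S) A B" and B: "\<not> inc B (ln R A)" and "R \<noteq> S"
  shows "inside S R B A \<or> inside S R A B"
proof -
  note lRS = ln_inc[OF assms(3)]
  have off: "\<not> inc A (ln R S)" "\<not> inc B (ln R S)" using AB ss_off by blast+
  then have RA: "R \<noteq> A" "R \<noteq> B" using lRS by blast+
  note lRA = ln_inc[OF RA(1)] and lRB = ln_inc[OF RA(2)]
  have SA: "\<not> inc S (ln R A)" "\<not> inc S (ln R B)" "\<not> inc A (ln R B)"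
    using off lRS lRA lRB assms B RA line_unique by metis+
  show ?thesis
  proof (rule ccontr)
    assume n: "\<not> ?thesis"
    have 1: "opp (ln R B) A S" using n AB SA ss_or_opp unfolding inside_def by blast
    have 2: "opp (ln R A) B S" using n AB B SA ss_or_opp ss_sym unfolding inside_def by blast
    then obtain Y where Y: "inc Y (ln R A)" "between B Y S" by (rule opp_pt)
    have a: "ss (ln R S) Y B" using seg_ss[of S Y B "ln R S"] Y lRS off between_sym by blast
    have b: "ss (ln R B) Y S" using seg_ss[of B Y S "ln R B"] Y lRB SA by blast
    have YR: "Y \<noteq> R" using a lRS ss_off by blast
    have ne: "ln R A \<noteq> ln R S" "ln R A \<noteq> ln R B" using SA lRS lRA by metis+
    have "ss (ln R S) Y A" using a AB ss_sym ss_trans by blast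
    then have "ss (ln R B) Y A" using ray_change(1)[of Y "ln R A" A R "ln R S" "ln R B"] Y lRA lRS lRB ne YR RA by metis
    then show False using 1 b ss_sym ss_trans ss_not_opp by blast
  qed
qed

section \<open>Existence, uniqueness and symmetry of asymptotic rays\<close>

lemma asyD:
  assumes "asy R Q S U"
  shows "R \<noteq> Q" "S \<noteq> U" "\<not> inc S (ln R Q)" "\<not> meets (ln R Q) (ln S U)" "ss (ln R S) Q U"
    "inside S R Q X \<Longrightarrow> meets (ln R X) (ln S U)" "\<not> inc R (ln S U)" "R \<noteq> S" "\<not> meets (ln S U) (ln R Q)"
proof -
  show *: "R \<noteq> Q" "S \<noteq> U" "\<not> inc S (ln R Q)" "\<not> meets (ln R Q) (ln S U)" "ss (ln R S) Q U"
    "inside S R Q X \<Longrightarrow> meets (ln R X) (ln S U)" using assms unfolding asy_def by auto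
  show "\<not> meets (ln S U) (ln R Q)" using * meets_sym by blast
  have "ln R Q \<noteq> ln S U" using * ln_inc by metis
  then show "\<not> inc R (ln S U)" using * ln_inc meetsI by metis
  then show "R \<noteq> S" using * ln_inc by metis
qed

lemma asy_ray:
  assumes a: "asy R Q S U" and Q': "inc Q' (ln R Q)" "ss (ln R S) Q Q'" and U': "inc U' (ln S U)" "ss (ln R S) U U'"
  shows "asy R Q' S U'"
proof -
  note d = asyD[OF a]
  have t: "inc R (ln R S)" "inc S (ln R S)" using ln_inc d by auto
  have n: "R \<noteq> Q'" "S \<noteq> U'" using assms t ss_off by blast+
  have l: "ln R Q' = ln R Q" using ln_eq[OF n(1)] ln_inc d Q' by metis
  have k: "ln S U' = ln S U" using ln_eq[OF n(2)] ln_inc d U' by metis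
  have s: "ss (ln R S) Q' U'"
    using ss_trans[OF ss_sym[OF Q'(2)] ss_trans[OF d(5) U'(2)]] .
  have "inside S R Q X" if "inside S R Q' X" for X
    using that Q' l ss_sym ss_trans unfolding inside_def by metis
  then show ?thesis using d n s unfolding asy_def l k by blast
qed

lemma asy_unique:
  assumes a: "asy P Q S U" and b: "asy P Q' S U'" and U: "inc U' (ln S U)" "ss (ln P S) U U'"
  shows "inc Q' (ln P Q)"
proof (rule ccontr)
  assume n: "\<not> inc Q' (ln P Q)"
  note d = asyD[OF a] and d' = asyD[OF b]
  have k: "ln S U' = ln S U" using ln_eq[OF d'(2)] ln_inc d U by metis
  have "ss (ln P S) Q Q'" using ss_trans[OF d(5) ss_trans[OF U(2) ss_sym[OF d'(5)]]] .
  then consider "inside S P Q' Q" | "inside S P Q Q'" using inside_cases n d(8) by blast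
  then show False
  proof cases
    case 1 then show ?thesis using d'(6)[OF 1] d k by simp
  next
    case 2 then show ?thesis using d(6)[OF 2] d' k by simp
  qed
qed

text \<open>The asymptote comes from the two lines of (A5) at \<open>P\<close>: of their rays on the
  side of \<open>U\<close> the one nearer to \<open>S\<close> is the limit of the rays meeting
  \<open>SU\<close>.\<close>

lemma asy_ex:
  assumes P: "\<not> inc P (ln S U)" and SU: "S \<noteq> U"
  obtains Q where "asy P Q S U" "asy S U P Q"
proof -
  define k where "k = ln S U"
  have k: "inc S k" "inc U k" "\<not> inc P k" using ln_inc SU P k_def by auto
  have PS: "P \<noteq> S" using k by blast
  define t where "t = ln P S"
  have t: "inc P t" "inc S t" using ln_inc PS t_def by auto
  have tk: "t \<noteq> k" using t k by blast
  have Ut: "\<not> inc U t" using t k SU tk line_unique by metis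
  have main: "\<exists>Q. asy P Q S U \<and> asy S U P Q"
    if g: "guard P k p q" and Q: "inc Q p" "inc Q2 q" "ss t Q U" "ss t Q2 U" and i: "inside S P Q2 Q" for p q Q Q2
  proof -
    note g' = guardD[OF g]
    have pk: "\<not> meets k p" "\<not> meets k q" using g' meets_sym by blast+
    have pk': "p \<noteq> k" "q \<noteq> k" using g' k by blast+
    have pt: "p \<noteq> t" "q \<noteq> t" using Q ss_off by blast+
    have PQ: "P \<noteq> Q" "P \<noteq> Q2" using Q t ss_off by blast+
    have lp: "ln P Q = p" "ln P Q2 = q" using ln_eq PQ g' Q by auto
    have Sp: "\<not> inc S p" "\<not> inc S q" using k g' pk' meetsI by metis+
    have SO: "opp p S Q2" using crossbar[OF i PS PQ(2)] lp by simp
    have SY: "opp p S Y" if Y: "inc Y q" "ss t Y U" for Y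
    proof -
      have "Y \<noteq> P" using Y t ss_off by blast
      moreover have "ss t Y Q2" using Y Q ss_sym ss_trans by blast
      ultimately have "ss p Q2 Y" using ray_change(1)[of Y q Q2 P t p] Y g' t pt Q PQ ss_sym by metis
      then show ?thesis using SO opp_ss by blast
    qed
    \<comment> \<open>By (A5), the line \<open>SX\<close>, which meets \<open>k\<close>, meets
      \<open>p\<close> or \<open>q\<close>. If it meets \<open>q\<close>, it does so beyond
      \<open>p\<close> as seen from \<open>S\<close>, and so crosses \<open>p\<close> as
      well.\<close>
    have A: "meets (ln S X) p" if X: "inside P S U X" for X
    proof (rule ccontr)
      assume n: "\<not> meets (ln S X) p"
      have x: "ss k X P" "ss t X U" using X ln_sym unfolding inside_def k_def t_def by metis+
      have SX: "S \<noteq> X" using x k ss_off by blast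
      note m = ln_inc[OF SX]
      have mk: "ln S X \<noteq> k" "ln S X \<noteq> t" using m x ss_off by metis+
      then have "meets (ln S X) k" using m k meetsI by blast
      then have "meets (ln S X) q" using g'(6) n by blast
      then obtain Y where Y: "inc Y (ln S X)" "inc Y q" by (auto elim: meetsE)
      have Yk: "ss k Y P" using ss_miss[of q k P Y] g' k Y ss_sym by blast
      then have YS: "Y \<noteq> S" using k ss_off by blast
      have "ss k Y X" using Yk x ss_sym ss_trans by blast
      then have "ss t Y X" using ray_change(1)[of Y "ln S X" X S k t] Y m k t mk YS SX by metis
      then have "opp p S Y" using SY Y x ss_trans by blast
      then show False using opp_meets m Y n by blast
    qed
    \<comment> \<open>If \<open>g = PX\<close> missed \<open>k\<close>, a line \<open>xi\<close>
      through \<open>U\<close> missing \<open>p\<close> would meet \<open>g\<close> in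
      \<open>W\<close> and \<open>t\<close> in \<open>T\<close>, with \<open>T\<close> between
      \<open>P\<close> and \<open>S\<close> and \<open>W\<close> between \<open>U\<close> and
      \<open>T\<close>. So \<open>g\<close> separates \<open>T\<close> from \<open>U\<close> and
      hence from \<open>S\<close>, and cuts \<open>t\<close> between \<open>S\<close> and
      \<open>T\<close>, although it cuts \<open>t\<close> only in \<open>P\<close>.\<close>
    have B: "meets (ln P X) k" if X: "inside S P Q X" for X
    proof (rule ccontr)
      assume n: "\<not> meets (ln P X) k"
      have x: "ss p X S" "ss t X Q" using X lp unfolding inside_def t_def by auto
      have PX: "P \<noteq> X" using x t ss_off by blast
      define g where "g = ln P X"
      have g: "inc P g" "inc X g" using ln_inc PX g_def by auto
      have gp: "g \<noteq> p" "g \<noteq> t" "g \<noteq> k" using g x ss_off k by blast+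
      have gk: "\<not> meets g k" "\<not> meets k g" using n meets_sym g_def by blast+
      have Up: "\<not> inc U p" using k g' pk' meetsI by metis
      obtain x1 x2 where xx: "guard U p x1 x2" using guard_ex[OF Up] by metis
      have "meets g p" using g g' gp meetsI by metis
      then obtain xi where xi: "inc U xi" "\<not> meets xi p" "meets g xi" using guardD[OF xx] by metis
      then obtain W where W: "inc W g" "inc W xi" by (auto elim: meetsE)
      have xik: "xi \<noteq> k" using xi gk by blast
      then have "meets xi k" using xi k meetsI by blast
      then have "meets xi q" using g'(6) xi by blast
      then obtain Y where Y: "inc Y xi" "inc Y q" by (auto elim: meetsE)
      have US: "ss p U S" using ss_miss[of k p U S] pk k Up by blast
      have xip: "ss p U Z" if "inc Z xi" for Z using ss_miss[of xi p U Z] xi that Up by blast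
      have YU: "\<not> ss t Y U" using SY[of Y] Y xip[OF Y(1)] US opp_sym opp_ss ss_opp ss_sym ss_not_opp by metis
      have xipp: "xi \<noteq> p" using xi Up by blast
      have YP: "Y \<noteq> P" using Y xi xipp g' meetsI by metis
      then have "\<not> inc Y t" using Y t g' pt meet_unique by metis
      then have "opp t U Y" using YU Ut ss_or_opp opp_sym by blast
      then obtain T where T: "inc T t" "between U T Y" by (rule opp_pt)
      have Tx: "inc T xi" using betweenD(6)[OF T(2)] xi Y by blast
      have Yk: "ss k P Y" using ss_miss[of q k P Y] g' k Y by blast
      have Tk: "ss k T P" using seg_ss[of U T Y k] T k ss_off[OF Yk] Yk ss_sym ss_trans by blast
      have Tp: "ss p T S" using xip[OF Tx] US ss_sym ss_trans by blast
      have PTS: "between P T S" using between_of_rays[of P t T S p k] t T g' k pt tk Tp Tk PS by metis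
      have xit: "xi \<noteq> t" using xi Ut by blast
      have TU: "T \<noteq> U" using T Ut by blast
      have Wk: "ss k W P" using ss_miss[of g k P W] gk g k W ss_sym by blast
      have Wp: "ss p W X"
      proof -
        have "ss p W S" using xip[OF W(2)] US ss_sym ss_trans by blast
        then show ?thesis using x ss_sym ss_trans by blast
      qed
      have "W \<noteq> P" using Wp g' ss_off by blast
      then have "ss t W X" using ray_change(1)[of W g X P p t] W g g' t gp PX Wp by metis
      then have Wt: "ss t W U" using x Q ss_trans by blast
      have "ss k W T" using Wk Tk ss_sym ss_trans by blast
      then have UWT: "between U W T" using between_of_rays[of U xi W T k t] xi k t T Tx W xik xit Wt TU ss_sym by metis
      have Ug: "\<not> inc U g" using gk k g gp meetsI by metis
      have "opp g U T" using between_opp[OF UWT W(1) Ug] .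
      moreover have "ss g S U" using ss_miss[of k g S U] gk k gp meetsI by metis
      ultimately have "opp g S T" using ss_opp by blast
      then obtain V where V: "inc V g" "between S V T" by (rule opp_pt)
      have "inc V t" using betweenD(6)[OF V(2)] t T by blast
      then have "V = P" using V g t gp meet_unique by metis
      then show False using V PTS between_unique between_sym by metis
    qed
    have QU: "ss (ln P S) Q U" "ss (ln S P) U Q" using Q ss_sym ln_sym t_def by metis+
    have "asy P Q S U" unfolding asy_def lp k_def[symmetric] using PQ SU Sp g' QU B lp by auto
    moreover have "asy S U P Q" unfolding asy_def lp k_def[symmetric] using PQ SU k pk QU A lp by auto
    ultimately show ?thesis by blast
  qed
  obtain p q where g: "guard P k p q" using guard_ex[OF k(3)] by metis
  note g' = guardD[OF g]
  have "meets t k" using t k tk meetsI by metis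
  then have pt: "p \<noteq> t" "q \<noteq> t" using g' by blast+
  obtain Q where Q: "inc Q p" "Q \<noteq> P" "ss t Q U" using side_point[of P p t U] g' t pt Ut by metis
  obtain Q2 where Q2: "inc Q2 q" "Q2 \<noteq> P" "ss t Q2 U" using side_point[of P q t U] g' t pt Ut by metis
  have lp: "ln P Q = p" using ln_eq Q g' by metis
  have "\<not> inc Q2 (ln P Q)" using lp Q2 g' meet_unique by metis
  moreover have "ss (ln P S) Q Q2" using Q Q2 ss_sym ss_trans t_def by blast
  ultimately have "inside S P Q2 Q \<or> inside S P Q Q2" using inside_cases PS by blast
  then show thesis
    using main[OF g Q(1) Q2(1) Q(3) Q2(3)] main[of q p Q2 Q] g guard_sym Q Q2 that by blast
qed

lemma asy_sym: assumes "asy P Q S U" shows "asy S U P Q"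
proof -
  note d = asyD[OF assms]
  obtain Q0 where Q0: "asy P Q0 S U" "asy S U P Q0" using asy_ex[OF d(7) d(2)] by metis
  note d0 = asyD[OF Q0(1)]
  have "ss (ln P S) U U" using ss_refl ss_off(2)[OF d(5)] .
  then have "inc Q (ln P Q0)" using asy_unique[OF Q0(1) assms] ln_inc d by metis
  moreover have "ss (ln S P) Q0 Q" using d d0 ss_sym ss_trans ln_sym by metis
  moreover have "ss (ln S P) U U" using \<open>ss (ln P S) U U\<close> ln_sym by metis
  ultimately show ?thesis using asy_ray[OF Q0(2)] ln_inc d by metis
qed

text \<open>(A5) gives a second line through \<open>P\<close> missing \<open>SU\<close>. Its ray on
  the side of \<open>S\<close> lies in one of the two angles at \<open>P\<close>, and every ray
  inside these meets \<open>SU\<close>.\<close>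

lemma asy_one_end:
  assumes a: "asy P Q S U" and b: "asy P Q' S U'" and Q: "between Q P Q'"
    and U: "inc U' (ln S U)"
  shows False
proof -
  note d = asyD[OF a] and d' = asyD[OF b]
  define l where "l = ln P Q"
  have l: "inc P l" "inc Q l" using ln_inc d l_def by auto
  have l': "inc Q' l" using betweenD(5)[OF Q] l by blast
  then have lQ': "ln P Q' = l" using ln_eq d' l by metis
  have k: "ln S U' = ln S U" using ln_eq[OF d'(2)] ln_inc d U by metis
  obtain h where h: "inc P h" "h \<noteq> l" "\<not> meets h (ln S U)" using guard_avoid[OF d(7)] by metis
  obtain X where X: "inc X h" "X \<noteq> P" "ss l X S" using side_point[of P h l S] h l d l_def by metis
  have hX: "ln P X = h" using ln_eq X h by metis
  have t: "inc P (ln P S)" "inc S (ln P S)" using ln_inc d by auto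
  have "h \<noteq> ln P S" using h t ln_inc d d(7) meetsI by metis
  then have Xt: "\<not> inc X (ln P S)" using X h t line_unique by metis
  have "opp (ln P S) Q Q'" using between_opp[OF Q t(1)] ss_off[OF d(5)] by blast
  then consider "ss (ln P S) X Q" | "ss (ln P S) X Q'" using ss_or_opp[OF Xt] opp_off opp_opp by metis
  then show False
  proof cases
    case 1
    then have "inside S P Q X" using X l_def unfolding inside_def by blast
    then show ?thesis using asyD(6)[OF a] hX h by metis
  next
    case 2
    then have "inside S P Q' X" using X lQ' unfolding inside_def by metis
    then show ?thesis using asyD(6)[OF b] hX h k by metis
  qed
qed

text \<open>Transmissibility of asymptoticity: the origin slides along its line as long as the
  direction towards \<open>Q\<close> is kept. Moving forward and moving back need different
  arguments.\<close>

lemma asy_move: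
  assumes a: "asy R Q S U" and R': "inc R' (ln R Q)" "R' \<noteq> Q" "\<not> between R Q R'"
  shows "asy R' Q S U"
proof (cases "R' = R")
  case True then show ?thesis using a by simp
next
  case ne: False
  note d = asyD[OF a]
  define l where "l = ln R Q"
  define k where "k = ln S U"
  define t where "t = ln R S"
  have l: "inc R l" "inc Q l" "inc R' l" using ln_inc d R' l_def by auto
  have k: "inc S k" "inc U k" using ln_inc d k_def by auto
  have t: "inc R t" "inc S t" using ln_inc d t_def by auto
  have lk: "\<not> meets l k" "\<not> meets k l" using d l_def k_def by auto
  have Sl: "\<not> inc S l" using d l_def by blast
  then have lnk: "l \<noteq> k" using k by blast
  have Rk: "\<not> inc R k" "\<not> inc R' k" using lk l lnk meetsI by metis+
  have R'S: "R' \<noteq> S" using l Sl by blast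
  define t' where "t' = ln R' S"
  have t': "inc R' t'" "inc S t'" using ln_inc R'S t'_def by auto
  have lQ: "ln R' Q = l" using ln_eq R' l by metis
  have tl: "t \<noteq> l" "t' \<noteq> l" "t \<noteq> k" "t' \<noteq> k" using t t' Sl k Rk by blast+
  have tt: "t \<noteq> t'" using t t' l Sl ne line_unique tl by metis
  have Rt': "\<not> inc R t'" "\<not> inc R' t" using t t' tt tl l ne line_unique by metis+
  have QU: "ss t Q U" using d t_def by blast
  have Qt': "\<not> inc Q t'" using t' l tl R' line_unique by metis
  have Qt: "\<not> inc Q t" using QU ss_off by blast
  have SU: "S \<noteq> U" using d by blast
  have Ut': "\<not> inc U t'" using t' k tl SU line_unique by metis
  have k1: "ss k R R'" using ss_miss[of l k R R'] lk l Rk by blast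
  consider "between R R' Q" | "between R' R Q" using between_trich[of R l R' Q] l ne R' d between_sym by metis
  then show ?thesis
  proof cases
    case 1
    have RQt': "opp t' R Q" using between_opp[OF 1 t'(1) Rt'(1)] .
    have R'Q: "ss t R' Q" using seg_ss[OF 1 t(1) Qt] .
    have "inside R S U R'" unfolding inside_def
      using k1 R'Q QU ss_sym ss_trans ln_sym k_def t_def by metis
    then have "opp t' R U" using crossbar SU d(8) ln_sym t'_def by metis
    then have QU': "ss t' Q U" using RQt' opp_sym opp_opp by blast
    \<comment> \<open>If \<open>g = R'X\<close> missed \<open>k\<close>, it would separate
      \<open>R\<close> from the point where \<open>RX\<close> meets \<open>k\<close>, hence from
      \<open>S\<close>, and so cut the segment \<open>RS\<close>. By \<open>noV\<close> the cut
      would lie beyond \<open>S\<close>, across \<open>k\<close>, where \<open>g\<close> does not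
      go.\<close>
    have "meets (ln R' X) k" if X: "inside S R' Q X" for X
    proof (rule ccontr)
      assume n: "\<not> meets (ln R' X) k"
      have x: "ss l X S" "ss t' X Q" using X lQ unfolding inside_def t'_def by auto
      have XR': "R' \<noteq> X" using x t' ss_off by blast
      define g where "g = ln R' X"
      have g: "inc R' g" "inc X g" using ln_inc XR' g_def by auto
      have gk: "\<not> meets g k" "\<not> meets k g" "g \<noteq> k" using n g Rk meets_sym g_def by blast+
      have gl: "g \<noteq> l" "g \<noteq> t'" using g x ss_off by blast+
      have kg: "ss k R' W" if "inc W g" for W using ss_miss[of g k R' W] gk g Rk that by blast
      have ray: "ss t' W Q" if "inc W g" "ss l W S" for W
      proof -
        have "ss l W X" using that x ss_sym ss_trans by blast
        moreover have "W \<noteq> R'" using that l ss_off by blast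
        ultimately have "ss t' W X" using ray_change(1)[of W g X R' l t'] that g l t' gl XR' by metis
        then show ?thesis using x ss_trans by blast
      qed
      have noV: False if V: "inc V t" "inc V g" "ss l V S" for V
      proof -
        have "opp t' V R" using ray[OF V(2,3)] RQt' opp_sym ss_opp by blast
        then have "between V S R" using ray_ss(2)[of V t R S t'] V t t' tt d(8) opp_off by metis
        then have "opp k V R" using between_opp k kg[OF V(2)] ss_off by blast
        then show False using kg[OF V(2)] k1 ss_trans opp_sym ss_not_opp by blast
      qed
      have "ss t X Q"
      proof (rule ccontr)
        assume c: "\<not> ss t X Q"
        have "\<not> inc X t" using noV x g by blast
        then have "opp t R' X" using c ss_or_opp Qt R'Q opp_sym ss_opp by metis
        then obtain V where V: "inc V t" "between R' V X" by (rule opp_pt)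
        have "inc V g" using betweenD(6)[OF V(2)] g by blast
        moreover have "ss l V S" using seg_ss[OF V(2) l(3)] x ss_off ss_trans by blast
        ultimately show False using noV V by blast
      qed
      then have "inside S R Q X" using x l_def t_def unfolding inside_def by blast
      then have "meets (ln R X) k" using d(6) k_def by blast
      then obtain Y where Y: "inc Y (ln R X)" "inc Y k" by (auto elim: meetsE)
      have RX: "R \<noteq> X" using x l ss_off by blast
      note rx = ln_inc[OF RX]
      have Yl: "ss l Y S" using ss_miss[of k l S Y] lk k Y Sl ss_sym by blast
      have rl: "ln R X \<noteq> l" "ln R X \<noteq> k" using rx x Rk ss_off by metis+
      have YX: "Y \<noteq> X" using Y kg[OF g(2)] ss_off by blast
      have RY: "R \<noteq> Y" using Y Rk by blast
      have RXY: "between R X Y"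
      proof (rule between_of_rays[of R "ln R X" X Y l k])
        show "ss l X Y" using x Yl ss_sym ss_trans by blast
        show "ss k X R" using kg[OF g(2)] k1 ss_sym ss_trans by blast
      qed (use rx Y l rl RY in auto)
      have Rg: "\<not> inc R g" using g l gl ne line_unique by metis
      have 3: "opp g R Y" using between_opp[OF RXY g(2) Rg] .
      have Sg: "\<not> inc S g" using gk k meetsI by metis
      have "ss g S Y" using ss_miss[of k g S Y] gk k Y Sg by blast
      then have "opp g R S" using 3 opp_ss ss_sym by blast
      then obtain V where V: "inc V g" "between R V S" by (rule opp_pt)
      have "inc V t" using betweenD(6)[OF V(2)] t by blast
      moreover have "ss l V S" using seg_ss[OF V(2) l(1) Sl] .
      ultimately show False using noV V by blast
    qed
    then show ?thesis unfolding asy_def lQ using R' SU Sl lk QU' k_def t'_def by auto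
  next
    case 2
    have R'Q: "opp t R' Q" using between_opp[OF 2 t(1) Rt'(2)] .
    then have "opp t R' U" using QU opp_ss by blast
    then obtain V where V: "inc V t" "between R' V U" by (rule opp_pt)
    have VU: "ss t' V U" using seg_ss[OF V(2) t'(1) Ut'] .
    have Vk: "ss k V R" using seg_ss[of U V R' k] V k Rk k1 between_sym ss_sym ss_trans by metis
    have "V \<noteq> S" using Vk k ss_off by blast
    then have "ss t' V R" using ray_change(1)[of V t R S k t'] V t k t' tl tt Vk d(8) by metis
    moreover have RQ: "ss t' R Q" using seg_ss[OF 2 t'(1) Qt'] .
    ultimately have QU': "ss t' Q U" using VU ss_sym ss_trans by blast
    \<comment> \<open>If \<open>g = R'X\<close> missed \<open>k\<close>, it would cut
      \<open>RS\<close> in a point \<open>V\<close>. The ray from \<open>R\<close> asymptotic to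
      \<open>g\<close> is compared with \<open>RQ\<close>: it can neither lie on the line
      \<open>l\<close>, nor inside the angle \<open>SRQ\<close>, nor outside it.\<close>
    have "meets (ln R' X) k" if X: "inside S R' Q X" for X
    proof (rule ccontr)
      assume n: "\<not> meets (ln R' X) k"
      have x: "ss l X S" "ss t' X Q" using X lQ unfolding inside_def t'_def by auto
      have XR': "R' \<noteq> X" using x t' ss_off by blast
      define g where "g = ln R' X"
      have g: "inc R' g" "inc X g" using ln_inc XR' g_def by auto
      have gk: "\<not> meets g k" "\<not> meets k g" "g \<noteq> k" using n g Rk meets_sym g_def by blast+
      have gl: "g \<noteq> l" "g \<noteq> t'" using g x ss_off by blast+
      have "opp g S Q" using crossbar[OF X R'S R'(2)] g_def by blast
      moreover have Qg: "\<not> inc Q g" using g l gl R' line_unique by metis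
      moreover have "ss g R Q" using seg_ss[OF 2 g(1) Qg] .
      ultimately have SR: "opp g S R" using opp_ss ss_sym by blast
      then obtain V where V: "inc V g" "between S V R" by (rule opp_pt)
      have Vt: "inc V t" using betweenD(6)[OF V(2)] t by blast
      have R'V: "R' \<noteq> V" using Vt Rt' by blast
      obtain W where W: "between R' V W" using extend[OF R'V] by metis
      have Wg: "inc W g" using betweenD(5)[OF W] g V by blast
      have VW: "ln V W = g" using ln_eq betweenD(2)[OF W] V Wg by metis
      have Rg: "\<not> inc R g" using SR opp_off by blast
      obtain Q0 where Q0: "asy R Q0 V W" using asy_ex[of R V W] Rg VW betweenD(2)[OF W] by metis
      note e = asyD[OF Q0]
      have RV: "ln R V = t" using ln_eq e(8) Vt t by metis
      have "opp t R' W" using between_opp[OF W Vt Rt'(2)] .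
      then have "ss t W Q" using R'Q opp_sym opp_opp by blast
      then have Q0Q: "ss t Q0 Q" using e(5) RV ss_trans by simp
      define r where "r = ln R Q0"
      have r: "inc R r" "inc Q0 r" using ln_inc e r_def by auto
      have rg: "\<not> meets r g" "\<not> meets g r" using e VW r_def meets_sym by auto
      show False
      proof (cases "inc Q0 l")
        case True
        then have "r = l" using r l e line_unique by metis
        then show False using rg l g gl meetsI by metis
      next
        case False
        then consider "inside S R Q Q0" | "inside S R Q0 Q"
          using inside_cases[of R S Q Q0] Q0Q l_def t_def d(8) ss_sym by blast
        then show False
        proof cases
          case 1
          then have "meets r k" using d(6) r_def k_def by blast
          then obtain Y where Y: "inc Y r" "inc Y k" by (auto elim: meetsE)
          have "ss g R Y" using ss_miss[of r g R Y] rg r Y Rg by blast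
          moreover have "ss g S Y" using ss_miss[of k g S Y] gk k Y SR opp_off by blast
          ultimately show False using SR ss_sym ss_trans opp_sym ss_not_opp by blast
        next
          case c2: 2
          then have "ss r Q S" unfolding inside_def r_def by blast
          moreover have Vr: "\<not> inc V r" using e r_def by blast
          moreover have Sr: "\<not> inc S r" using calculation ss_off by blast
          moreover have "ss r V S" using seg_ss[of R V S r] V r Sr between_sym by blast
          moreover have "ss r V R'" using ss_miss[of g r V R'] rg V g Vr by blast
          ultimately have QR': "ss r Q R'" using ss_sym ss_trans by blast
          then have "opp r R' Q" using between_opp[OF 2 r(1)] ss_off by blast
          then show False using QR' opp_sym ss_not_opp by blast
        qed
      qed
    qed
    then show ?thesis unfolding asy_def lQ using R' SU Sl lk QU' k_def t'_def by auto
  qed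
qed

end

section \<open>Parallel rays are the asymptotic rays\<close>

context separated_plane
begin

lemma ray_iff: assumes "R \<noteq> Q" shows "X \<in> ray R Q \<longleftrightarrow> inc X (ln R Q) \<and> \<not> between X R Q"
proof -
  note l = ln_inc[OF assms]
  have "inc X (ln R Q)" "\<not> between X R Q" if "X \<in> ray R Q"
    using that l betweenD(6)[of R X Q] betweenD(5)[of R Q X] betweenD(1)[of R R Q] betweenD(2)[of Q R Q] betweenD(3)[of Q R Q]
      between_unique[of R X Q] between_unique'[of X R Q] between_unique[of R Q X] between_unique'[of R Q X] between_sym
    unfolding ray_def by blast+
  moreover have "X \<in> ray R Q" if "inc X (ln R Q)" "\<not> between X R Q"
    using that l between_trich[of X "ln R Q" R Q] between_sym assms unfolding ray_def by blast
  ultimately show ?thesis by blast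
qed

lemma contains_ray_iff: "contains_ray l R Q \<longleftrightarrow> R \<noteq> Q \<and> l = ln R Q"
proof
  assume "contains_ray l R Q"
  then have "R \<noteq> Q" "inc R l" "inc Q l" unfolding contains_ray_def ray_def by auto
  then show "R \<noteq> Q \<and> l = ln R Q" using ln_eq by metis
next
  assume "R \<noteq> Q \<and> l = ln R Q"
  then show "contains_ray l R Q" unfolding contains_ray_def using ray_iff by metis
qed

lemma segment_sym: "segment R S = segment S R"
  unfolding segment_def using between_sym by auto

lemma segment_line: "inc R l \<Longrightarrow> inc S l \<Longrightarrow> X \<in> segment R S \<Longrightarrow> inc X l"
  unfolding segment_def using betweenD(6) by blast

lemma miss_segment: "\<not> meets_set m (segment R S) \<Longrightarrow> ss m R S"
  unfolding meets_set_def segment_def ss_def cross_def by blast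

text \<open>The origin is moved to the point \<open>Y\<close> where \<open>m\<close> meets the ray.
  There \<open>m\<close> enters either the angle between \<open>YS\<close> and the end, and so meets
  \<open>SU\<close>, or the angle \<open>SYR\<close>, and so meets the segment by the crossbar
  property.\<close>

lemma asy_hits:
  assumes a: "asy R Q S U" and m: "meets_set m (ray R Q)"
  shows "meets_set m (ray S U) \<or> meets_set m (segment R S)"
proof (rule ccontr)
  assume n: "\<not> ?thesis"
  note d = asyD[OF a]
  define l where "l = ln R Q"
  define k where "k = ln S U"
  have l: "inc R l" "inc Q l" using ln_inc d l_def by auto
  have k: "inc S k" "inc U k" using ln_inc d k_def by auto
  have mRS: "ss m R S" using n miss_segment by blast
  obtain Y where Y: "Y \<in> ray R Q" "inc Y m" using m unfolding meets_set_def by blast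
  have Yl: "inc Y l" "\<not> between Y R Q" using Y ray_iff d l_def by blast+
  have Rm: "\<not> inc R m" "\<not> inc S m" using mRS ss_off by blast+
  have RY: "R \<noteq> Y" using Rm Y by blast
  then obtain V where V: "between R Y V" using extend by metis
  have Vl: "inc V l" using betweenD(5)[OF V] l Yl by blast
  have t: "inc R (ln R S)" "inc S (ln R S)" using ln_inc d by auto
  have tl: "l \<noteq> ln R S" using t d(3) l_def by metis
  have VY: "V \<noteq> Y" "V \<noteq> R" using betweenD[OF V] by blast+
  have "ss (ln R S) Y Q" using ray_ss(1)[of Y l Q R "ln R S"] Yl l t tl RY d(1) by blast
  moreover have "ss (ln R S) Y V"
    using ray_ss(1)[of Y l V R "ln R S"] Yl l t tl RY Vl VY between_unique[OF V] by blast
  ultimately have "ss (ln R S) Q V" using ss_sym ss_trans by blast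
  moreover have "ss (ln R S) U U" using ss_refl ss_off(2)[OF d(5)] .
  ultimately have "asy R V S U" using asy_ray[OF a] Vl k l_def k_def by blast
  moreover have lRV: "ln R V = l" using ln_eq[of R V l] VY l Vl by metis
  ultimately have b: "asy Y V S U" using asy_move Yl VY between_unique'[OF V] by metis
  note e = asyD[OF b]
  have lYV: "ln Y V = l" using ln_eq[of Y V l] VY Yl Vl by metis
  have ml: "m \<noteq> l" using Rm l by blast
  have Sl: "\<not> inc S l" using d(3) l_def by blast
  obtain X where X: "inc X m" "X \<noteq> Y" "ss l X S" using side_point[of Y m l S] Y Yl ml Sl by metis
  define u where "u = ln Y S"
  have u: "inc Y u" "inc S u" using ln_inc e(8) u_def by auto
  have mu: "m \<noteq> u" using u Rm by blast
  have Xu: "\<not> inc X u" using mu X Y u meet_unique by metis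
  have mYX: "ln Y X = m" using ln_eq[of Y X m] X Y by metis
  have lYR: "ln Y R = l" using ln_eq[of Y R l] RY Yl l by metis
  have ul: "l \<noteq> u" using u Sl by blast
  have "\<not> inc R u" using meet_unique[OF ul l(1) _ Yl(1) u(1)] RY by blast
  then have oRV: "opp u R V" using between_opp[OF V u(1)] by blast
  have kl: "\<not> meets k l" using d l_def k_def by blast
  show False
  proof (cases "ss u X V")
    case True
    then have "inside S Y V X" using X lYV u_def unfolding inside_def by metis
    then have "meets m k" using e(6) mYX k_def by metis
    then obtain Z where Z: "inc Z m" "inc Z k" by (auto elim: meetsE)
    have Zl: "ss l Z S" using ss_miss[of k l S Z] kl k Z Sl ss_sym by blast
    have "ss l Z X" using ss_trans[OF Zl ss_sym[OF X(3)]] .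
    moreover have ZY: "Z \<noteq> Y" using Zl ss_off Yl by blast
    ultimately have "ss u Z X" using ray_change(1)[of Z m X Y l u] Z X Y Yl ml mu u by blast
    then have ZU: "ss u Z U" using ss_trans[OF _ ss_trans[OF True]] e(5) u_def by metis
    have ku: "k \<noteq> u" using ZU Z ss_off k by blast
    have ZS: "Z \<noteq> S" using ZU u ss_off by blast
    have "\<not> between Z S U" using ray_ss(1)[of Z k U S u] Z k u ku ZS d(2) ZU by metis
    then have "Z \<in> ray S U" using ray_iff[OF d(2)] Z k_def by blast
    then show False using n Z unfolding meets_set_def by blast
  next
    case False
    then have "opp u X V" using ss_or_opp Xu oRV opp_off by blast
    then have "ss u X R" using opp_opp oRV opp_sym by blast
    then have "inside S Y R X" using X lYR u_def unfolding inside_def by metis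
    then have "opp m S R" using crossbar[of S Y R X] e(8) RY mYX by metis
    then show False using mRS ss_sym ss_not_opp by blast
  qed
qed

lemma asy_rays_parallel: assumes a: "asy R Q S U" shows "rays_parallel R Q S U"
proof -
  note d = asyD[OF a]
  have "\<not> collinear (ray R Q \<union> ray S U)"
  proof
    assume "collinear (ray R Q \<union> ray S U)"
    then obtain l where "inc R l" "inc Q l" "inc S l" unfolding collinear_def ray_def by auto
    then show False using d ln_eq by metis
  qed
  then show ?thesis unfolding rays_parallel_def
    using d asy_hits[OF a] asy_hits[OF asy_sym[OF a]] segment_sym[of R S] by metis
qed

lemma rays_parallel_sym: "rays_parallel R Q S U \<Longrightarrow> rays_parallel S U R Q"
  unfolding rays_parallel_def using segment_sym[of R S] by (auto simp: Un_commute)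

text \<open>Otherwise \<open>U\<close> is off \<open>RQ\<close>, and a line through \<open>U\<close>
  missing \<open>RQ\<close> meets the second ray but neither the first one nor the segment.\<close>

lemma rays_parallel_off: assumes p: "rays_parallel R Q S U" shows "\<not> inc S (ln R Q)"
proof
  assume S: "inc S (ln R Q)"
  have d: "R \<noteq> Q" "S \<noteq> U" using p unfolding rays_parallel_def by auto
  note l = ln_inc[OF d(1)]
  have U: "\<not> inc U (ln R Q)"
  proof
    assume "inc U (ln R Q)"
    then have "ln S U = ln R Q" using ln_eq d S by metis
    then have "\<forall>X\<in>ray R Q \<union> ray S U. inc X (ln R Q)" using ray_iff d by auto
    then show False using p unfolding rays_parallel_def collinear_def by blast
  qed
  obtain m where m: "inc U m" "\<not> meets m (ln R Q)" using guard_avoid[OF U] by metis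
  have mm: "\<not> inc X m" if "inc X (ln R Q)" for X using m that U meetsI by metis
  have "meets_set m (ray S U)" using m unfolding meets_set_def ray_def by auto
  then have "meets_set m (ray R Q) \<or> meets_set m (segment R S)" using p unfolding rays_parallel_def by blast
  then show False using mm ray_iff[OF d(1)] segment_line l S unfolding meets_set_def by blast
qed

text \<open>\<open>RQ\<close> is compared with the asymptote \<open>RQ0\<close> of
  \<open>SU\<close>. If \<open>RQ\<close> lies outside the angle \<open>SRQ0\<close>, the test line
  goes through \<open>Q\<close> and misses \<open>RQ0\<close>; if inside, it goes through a point of
  \<open>RQ\<close> beyond \<open>SU\<close> and misses \<open>SU\<close>. Either test line meets
  the ray \<open>RQ\<close>, but neither the ray \<open>SU\<close> nor the segment
  \<open>RS\<close>.\<close>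

lemma rays_parallel_asy: assumes p: "rays_parallel R Q S U" shows "asy R Q S U"
proof -
  have d: "R \<noteq> Q" "S \<noteq> U" using p unfolding rays_parallel_def by auto
  define l where "l = ln R Q"
  define k where "k = ln S U"
  have l: "inc R l" "inc Q l" using ln_inc d l_def by auto
  have k: "inc S k" "inc U k" using ln_inc d k_def by auto
  have Sl: "\<not> inc S l" using rays_parallel_off[OF p] l_def by simp
  have Rk: "\<not> inc R k" using rays_parallel_off[OF rays_parallel_sym[OF p]] k_def by simp
  have RS: "R \<noteq> S" using Rk k by blast
  have hitl: "\<And>m. inc Y m \<Longrightarrow> Y \<in> ray R Q \<Longrightarrow> meets_set m (ray S U) \<or> meets_set m (segment R S)" for Y
    using p unfolding rays_parallel_def meets_set_def by blast
  define t where "t = ln R S"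
  have t: "inc R t" "inc S t" using ln_inc RS t_def by auto
  have tl: "l \<noteq> t" "t \<noteq> l" "k \<noteq> t" using t Sl Rk by blast+
  have Qt: "\<not> inc Q t" using meet_unique[OF tl(1) l(1) t(1) l(2)] d by blast
  have Ut: "\<not> inc U t" using meet_unique[OF tl(3) k(1) t(2) k(2)] d by blast
  have rQ: "Q \<in> ray R Q" unfolding ray_def by simp
  have seg: "inc X t" if "X \<in> segment R S" for X using segment_line t that by blast
  have QU: "ss t Q U"
  proof -
    obtain h where h: "inc Q h" "\<not> meets h t" using guard_avoid[OF Qt] by metis
    have "\<not> meets_set h (segment R S)" unfolding meets_set_def using seg h meetsI Qt by metis
    then obtain Z where Z: "Z \<in> ray S U" "inc Z h" using hitl[OF h(1) rQ] unfolding meets_set_def by blast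
    have QZ: "ss t Q Z" using ss_miss[OF h(2,1) Z(2) Qt] .
    have Zk: "inc Z k" "\<not> between Z S U" using Z ray_iff[OF d(2)] k_def by blast+
    have "Z \<noteq> S" using QZ t ss_off by blast
    then have "ss t Z U" using ray_ss(1)[of Z k U S t] Zk k t tl d(2) by metis
    then show ?thesis using QZ ss_trans by blast
  qed
  obtain Q0 where Q0: "asy R Q0 S U" using asy_ex[of R S U] Rk k_def d by metis
  note e = asyD[OF Q0]
  define r where "r = ln R Q0"
  have r: "inc R r" "inc Q0 r" using ln_inc e r_def by auto
  have Q0Q: "ss t Q0 Q" using ss_trans[OF e(5)[folded t_def] ss_sym[OF QU]] .
  have kr: "\<not> meets k r" "\<not> meets r k" using e r_def k_def by blast+
  have Sr: "\<not> inc S r" using e r_def by blast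
  show ?thesis
  proof (cases "inc Q r")
    case True
    moreover have "ss (ln R S) U U" using ss_refl Ut t_def by metis
    ultimately show ?thesis using asy_ray[OF Q0] Q0Q k r_def t_def k_def by metis
  next
    case False
    then have rl: "r \<noteq> l" using l by blast
    consider "inside S R Q Q0" | "inside S R Q0 Q"
      using inside_cases[of R S Q0 Q] False r_def Q0Q RS t_def by blast
    then show ?thesis
    proof cases
      case 1
      then have o: "opp r S Q" using crossbar RS d r_def by metis
      obtain h where h: "inc Q h" "\<not> meets h r" using guard_avoid[OF False] by metis
      have hs: "ss r Q Z" if "inc Z h" for Z using ss_miss[OF h(2,1) that False] .
      have far: "\<not> ss r S Z" if "inc Z h" for Z using hs[OF that] o ss_trans ss_sym ss_not_opp by blast
      have "ss r S Z" if "Z \<in> ray S U" for Z using ss_miss[of k r S Z] kr k Sr that ray_iff[OF d(2)] k_def by blast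
      moreover have "ss r S Z" if "between R Z S" for Z using seg_ss[OF that r(1) Sr] ss_sym by blast
      moreover have "\<not> inc R h" using hs r ss_off by blast
      ultimately have "\<not> meets_set h (ray S U)" "\<not> meets_set h (segment R S)"
        using far far[OF _ ] ss_refl[OF Sr] unfolding meets_set_def segment_def by blast+
      then show ?thesis using hitl[OF h(1) rQ] by blast
    next
      case 2
      then have x: "ss r Q S" unfolding inside_def r_def by blast
      have "meets l k" using e(6)[OF 2] l_def k_def by simp
      then obtain Y where Y: "inc Y l" "inc Y k" by (auto elim: meetsE)
      have "ss r Y S" using ss_miss[of k r S Y] kr k Y Sr ss_sym by blast
      then have YQ: "ss r Y Q" using x ss_sym ss_trans by blast
      have YR: "R \<noteq> Y" using YQ r ss_off by blast
      obtain V where V: "between R Y V" using extend YR by metis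
      have Vl: "inc V l" using betweenD(5)[OF V] l Y by blast
      have VY: "V \<noteq> Y" "V \<noteq> R" using betweenD[OF V] by blast+
      have "ss r Y V" using ray_ss(1)[of Y l V R r] Y l r rl YR Vl VY between_unique[OF V] by blast
      then have "ss r V Q" using YQ ss_sym ss_trans by blast
      then have "\<not> between V R Q" using ray_ss(1)[of V l Q R r] Vl l r rl VY d by metis
      then have Vr: "V \<in> ray R Q" using ray_iff[OF d(1)] Vl l_def by blast
      have lk: "l \<noteq> k" using l Rk by blast
      have Vk: "\<not> inc V k" using meet_unique[OF lk Vl _ Y] VY by blast
      obtain h where h: "inc V h" "\<not> meets h k" using guard_avoid[OF Vk] by metis
      have hk: "ss k V Z" if "inc Z h" for Z using ss_miss[OF h(2,1) that Vk] .
      have "\<not> meets_set h (ray S U)" unfolding meets_set_def using hk ss_off ray_iff[OF d(2)] k_def by blast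
      then obtain Z where Z: "inc Z h" "Z \<in> segment R S" using hitl[OF h(1) Vr] unfolding meets_set_def by blast
      have "Z \<noteq> S" using hk Z k ss_off by blast
      then have "ss k Z R" using Z seg_ss[of S Z R k] k Rk ss_refl between_sym unfolding segment_def by blast
      then have "ss k V R" using hk Z ss_trans by blast
      then have False using between_opp[OF V Y(2) Rk] ss_sym ss_not_opp by blast
      then show ?thesis ..
    qed
  qed
qed

lemma rays_parallel_iff: "rays_parallel R Q S U \<longleftrightarrow> asy R Q S U"
  using rays_parallel_asy asy_rays_parallel by blast

lemma parallel_iff: "parallel l m \<longleftrightarrow> (\<exists>R Q S U. asy R Q S U \<and> l = ln R Q \<and> m = ln S U)"
  unfolding parallel_def rays_parallel_iff contains_ray_iff using asyD(1,2) by blast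

section \<open>Change of origin and transitivity\<close>

lemma same_ray:
  assumes l: "inc P l" "inc Q l" "inc V l" "inc P t" "l \<noteq> t" "P \<noteq> Q" "P \<noteq> V" and n: "\<not> between V P Q"
  shows "ss t Q V"
  using ray_ss(1)[of Q l V P t] assms between_sym by metis

lemma asy_extend:
  assumes "inc V (ln P Q)" "P \<noteq> Q" "P \<noteq> V" "\<not> between V P Q" and a: "asy P Q S U"
  shows "asy P V S U"
proof -
  note d = asyD[OF a]
  have t: "inc P (ln P S)" "inc S (ln P S)" using ln_inc d by auto
  have "ss (ln P S) Q V" using same_ray[of P "ln P Q" Q V "ln P S"] assms d t ln_inc by metis
  moreover have "ss (ln P S) U U" using ss_refl ss_off(2)[OF d(5)] .
  ultimately show ?thesis using asy_ray[OF a] assms ln_inc d by metis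
qed

lemma asy_shift:
  assumes PQ: "P \<noteq> Q" and Y: "inc Y (ln P Q)"
  obtains V where "inc V (ln P Q)" "V \<noteq> Y" "\<And>S U. asy P Q S U \<longleftrightarrow> asy Y V S U"
proof -
  note l = ln_inc[OF PQ]
  consider "Y = P" | "Y \<noteq> P" "between Y P Q" | "Y \<noteq> P" "\<not> between Y P Q" by blast
  then show thesis
  proof cases
    case 1 then show ?thesis using that l PQ by metis
  next
    case 2
    have YQ: "ln Y Q = ln P Q" "Y \<noteq> Q" using ln_eq betweenD[OF 2(2)] Y l by metis+
    have "\<not> between P Q Y" "\<not> between Y Q P" using 2 between_unique' between_sym by metis+
    then have "asy P Q S U \<longleftrightarrow> asy Y Q S U" for S U
      using asy_move[of P Q S U Y] asy_move[of Y Q S U P] Y l YQ PQ by metis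
    then show ?thesis using that l YQ by metis
  next
    case 3
    obtain V where V: "between P Y V" using extend 3 by metis
    have Vl: "inc V (ln P Q)" using betweenD(5)[OF V] Y l by blast
    have VY: "V \<noteq> Y" "V \<noteq> P" using betweenD[OF V] by blast+
    have lv: "ln P V = ln P Q" "ln Y V = ln P Q" using ln_eq VY l Y Vl by metis+
    obtain t where t: "inc P t" "t \<noteq> ln P Q" by (rule line_through)
    have a: "ss t Q Y" using same_ray[of P "ln P Q" Q Y t] l Y t PQ 3 by metis
    have b: "ss t Y V" using same_ray[of P "ln P Q" Y V t] l Y Vl t VY 3 between_unique[OF V] between_sym by metis
    have c: "ss t Q V" using ss_trans[OF a b] .
    have nb: "\<not> between V P Q" "\<not> between Q P V"
      using ray_ss(1)[of Q "ln P Q" V P t] c l Vl t PQ VY between_sym by metis+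
    have "asy P Q S U \<longleftrightarrow> asy P V S U" for S U
      using asy_extend[of V P Q S U] asy_extend[of Q P V S U] Vl PQ VY nb lv l by metis
    moreover have "asy P V S U \<longleftrightarrow> asy Y V S U" for S U
      using asy_move[of P V S U Y] asy_move[of Y V S U P] lv Y l VY between_unique'[OF V] between_unique[OF V] between_sym by metis
    ultimately show ?thesis using that Vl VY by metis
  qed
qed

lemma asy_line_unique:
  assumes a: "asy A Q S U" and b: "asy B W S U" and Y: "inc Y (ln A Q)" "inc Y (ln B W)"
  shows "ln A Q = ln B W"
proof -
  note d = asyD[OF a] and e = asyD[OF b]
  obtain V where V: "inc V (ln A Q)" "V \<noteq> Y" "asy Y V S U" using asy_shift[OF d(1) Y(1)] a by metis
  obtain V' where V': "inc V' (ln B W)" "V' \<noteq> Y" "asy Y V' S U" using asy_shift[OF e(1) Y(2)] b by metis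
  have "ss (ln Y S) U U" using ss_refl asyD(5)[OF V(3)] ss_off by blast
  then have "inc V' (ln Y V)" using asy_unique[OF V(3) V'(3)] ln_inc d by metis
  moreover have "ln Y V = ln A Q" using ln_eq V Y by metis
  ultimately show ?thesis using line_unique[OF V'(2)] V' Y by metis
qed

text \<open>
  The ray from \<open>T\<close> asymptotic to \<open>P'U\<close> lies neither inside nor outside the angle of \<open>TW\<close>,
  as it would meet \<open>PQ\<close>.
\<close>

lemma asy_between:
  assumes T: "between P T P'" and a: "asy P Q P' U" and b: "asy T W P Q"
  shows "asy T W P' U"
proof -
  note d = asyD[OF a] and e = asyD[OF b]
  define k where "k = ln P P'"
  have k: "inc P k" "inc P' k" using ln_inc d k_def by auto
  have Tk: "inc T k" using betweenD(6)[OF T] k by blast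
  have TP: "T \<noteq> P" "T \<noteq> P'" using betweenD[OF T] by blast+
  have kT: "ln T P = k" "ln P T = k" "ln T P' = k" using ln_eq[of T P k] ln_eq[of P T k] ln_eq[of T P' k] Tk k TP by metis+
  have "\<not> inc T (ln P' U)" using d(7) k_def Tk k TP ln_inc[OF d(2)] line_unique by metis
  then obtain W0 where W0: "asy T W0 P' U" using asy_ex d(2) by metis
  note f = asyD[OF W0]
  have WQ: "ss k W Q" using e(5) kT by simp
  have QU: "ss k Q U" using d(5) k_def by simp
  have "ss k W0 U" using f(5) kT by simp
  then have WW: "ss k W0 W" using WQ QU ss_sym ss_trans by blast
  have nm: "\<not> meets (ln P Q) (ln T W0)" "\<not> meets (ln T W0) (ln P Q)" using asy_line_unique[OF a W0] unfolding meets_def by metis+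
  show ?thesis
  proof (cases "inc W (ln T W0)")
    case True
    moreover have "ss k U U" using ss_refl QU ss_off by blast
    ultimately show ?thesis using asy_ray[OF W0, of W U] WW kT ln_inc[OF d(2)] by metis
  next
    case False
    consider "inside P T W W0" | "inside P T W0 W" using inside_cases[of T P W0 W] WW kT TP False by metis
    then show ?thesis
    proof cases
      case 1
      then show ?thesis using e(6) nm by blast
    next
      case 2
      have "\<not> inc P (ln T W0)" using 2 f e unfolding inside_def
        using nm by (meson ss_off)
      then obtain Z where Z: "asy P Z T W0" "asy T W0 P Z" using asy_ex f(1) by metis
      note g = asyD[OF Z(1)]
      have ZQ: "ss k Z Q" using g(5) kT WW WQ ss_trans by metis
      show ?thesis
      proof (cases "inc Z (ln P Q)")
        case True
        have "ss k W0 W0" using WW ss_refl ss_off by blast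
        then have "asy P Q T W0" using asy_ray[OF Z(1), of Q W0] ZQ kT True ln_inc[OF f(1)] ln_eq d(1) g(1) ln_inc by metis
        then have "asy T W0 P Q" by (rule asy_sym)
        then have "inc W (ln T W0)" using asy_line_unique[OF b, of T W0] ln_inc e(1) f(1) by metis
        then show ?thesis using False by blast
      next
        case f2: False
        consider "inside T P Q Z" | "inside T P Z Q"
          using inside_cases[of P T Q Z] ZQ kT TP f2 ss_sym by metis
        then show ?thesis
        proof cases
          case 1
          then have i: "ss (ln P Q) Z T" "ss k Z Q" unfolding inside_def using kT by auto
          have "ss (ln P Q) T P'" using seg_ss[OF T] ln_inc[OF d(1)] d(3) by blast
          then have "inside P' P Q Z" unfolding inside_def using i ss_trans k_def by blast
          then have "meets (ln P Z) (ln P' U)" using d(6) by blast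
          then obtain Y where Y: "inc Y (ln P Z)" "inc Y (ln P' U)" by (auto elim: meetsE)
          have Pg: "\<not> inc P (ln T W0)" "\<not> inc P' (ln T W0)" using g f by blast+
          have "ss (ln T W0) P Y" using ss_miss[OF g(4) ln_inc(1)[OF g(1)] Y(1) Pg(1)] .
          moreover have "ss (ln T W0) P' Y" using ss_miss[OF f(9) ln_inc(1)[OF d(2)] Y(2) Pg(2)] .
          moreover have "opp (ln T W0) P P'" using between_opp[OF T ln_inc(1)[OF f(1)] Pg(1)] .
          ultimately show ?thesis using ss_sym ss_trans ss_not_opp by blast
        next
          case 2
          then show ?thesis using g(6) nm by blast
        qed
      qed
    qed
  qed
qed

text \<open>With the middle ray restarted at the point \<open>Y\<close> where its line cuts
  \<open>PP'\<close>, the segments \<open>PY\<close> and \<open>YP'\<close> are parts of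
  \<open>PP'\<close>, so the conditions defining parallel rays compose.\<close>

lemma asy_trans_mid:
  assumes a: "asy P Q S U" and b: "asy P' Q' S U" and o: "opp (ln S U) P P'"
  shows "asy P Q P' Q'"
proof -
  note d = asyD[OF a] and e = asyD[OF b]
  obtain Y where Y: "inc Y (ln S U)" "between P Y P'" using o by (rule opp_pt)
  obtain V where V: "inc V (ln S U)" "V \<noteq> Y" and V1: "\<And>A B. asy S U A B \<longleftrightarrow> asy Y V A B"
    using asy_shift[OF d(2) Y(1)] by metis
  have 1: "rays_parallel P Q Y V" "rays_parallel Y V P' Q'"
    using V1 asy_sym a b asy_rays_parallel by blast+
  have sub: "segment P Y \<subseteq> segment P P'" "segment Y P' \<subseteq> segment P P'"
    using Y(2) between_inner[of P' Y P] between_inner[of P Y P'] between_sym unfolding segment_def by blast+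
  have "\<not> collinear (ray P Q \<union> ray P' Q')"
  proof
    assume "collinear (ray P Q \<union> ray P' Q')"
    then obtain l where l: "inc P l" "inc Q l" "inc P' l" "inc Q' l" unfolding collinear_def ray_def by auto
    then have "inc Y l" using betweenD(6)[OF Y(2)] by blast
    then show False using 1(1) rays_parallel_off l ln_eq d by metis
  qed
  then have "rays_parallel P Q P' Q'"
    using 1 d(1) e(1) sub unfolding rays_parallel_def meets_set_def by (meson subsetD)
  then show ?thesis by (rule rays_parallel_asy)
qed

text \<open>Unless \<open>S\<close>, \<open>P\<close>, \<open>P'\<close> are collinear, one of the
  rays \<open>SP\<close>, \<open>SP'\<close> lies in the angle between the other and
  \<open>SU\<close>, say \<open>SP\<close>. It meets \<open>P'Q'\<close> in a point \<open>Z\<close>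
  beyond \<open>P\<close>, and so \<open>PQ\<close> separates \<open>S\<close> from
  \<open>P'\<close> after all.\<close>

lemma asy_three:
  assumes a: "asy P Q S U" and b: "asy P' Q' S U" and n: "ln P Q \<noteq> ln P' Q'"
  shows "opp (ln S U) P P' \<or> opp (ln P Q) P' S \<or> opp (ln P' Q') P S"
proof (rule ccontr)
  assume c: "\<not> ?thesis"
  have *: False if a: "asy P Q S U" and b: "asy P' Q' S U" and n: "ln P Q \<noteq> ln P' Q'"
    and k: "ss (ln S U) P P'" and l: "ss (ln P Q) P' S" and l': "ss (ln P' Q') P S"
    and i: "inside P' S U P" for P Q P' Q'
  proof -
    note d = asyD[OF a] and e = asyD[OF b]
    have "meets (ln S P) (ln P' Q')" using asyD(6)[OF asy_sym[OF b] i] .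
    then obtain Z where Z: "inc Z (ln S P)" "inc Z (ln P' Q')" by (auto elim: meetsE)
    have p: "inc S (ln S P)" "inc P (ln S P)" using ln_inc[of S P] d(8) by blast+
    have ZP: "ss (ln S U) Z P'" using ss_miss[OF e(4) ln_inc(1)[OF e(1)] Z(2) e(7)] ss_sym by blast
    then have "ss (ln S U) Z P" using k ss_sym ss_trans by blast
    moreover have "Z \<noteq> S" using ZP ln_inc d(2) ss_off by blast
    moreover have "ln S P \<noteq> ln S U" using p d(7) by metis
    ultimately have "\<not> between Z S P" using ray_ss(1)[of Z "ln S P" P S "ln S U"] Z p ln_inc[OF d(2)] d(8) by metis
    moreover have "\<not> between S Z P" using ray_ss(2)[of S "ln S P" P Z "ln P' Q'"] Z p l' ss_off ss_not_opp ss_sym by metis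
    moreover have "Z \<noteq> P" using l' Z ss_off by blast
    ultimately have "between S P Z" using between_trich[of Z "ln S P" S P] Z p \<open>Z \<noteq> S\<close> d(8) between_sym by metis
    then have "opp (ln P Q) S Z" using between_opp ln_inc[OF d(1)] d(3) by blast
    moreover have "\<not> inc P' (ln P Q)" using l ss_off by blast
    moreover have "\<not> meets (ln P' Q') (ln P Q)" using asy_line_unique[OF a b] unfolding meets_def by metis
    ultimately show False
      using ss_miss[of "ln P' Q'" "ln P Q" P' Z] ln_inc[OF e(1)] Z l ss_sym ss_trans ss_not_opp by metis
  qed
  note d = asyD[OF a] and e = asyD[OF b]
  have nm: "\<not> meets (ln P' Q') (ln P Q)" using asy_line_unique[OF a b] unfolding meets_def by metis
  have off: "\<not> inc P' (ln P Q)" "\<not> inc P (ln P' Q')" using nm n ln_inc[OF d(1)] ln_inc[OF e(1)] meetsI by metis+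
  have k: "ss (ln S U) P P'" and l: "ss (ln P Q) P' S" and l': "ss (ln P' Q') P S"
    using c ss_or_opp off d e by blast+
  have SP: "S \<noteq> P" "S \<noteq> P'" using d e by blast+
  show False
  proof (cases "inc P' (ln S P)")
    case True
    note p = ln_inc[OF SP(1)]
    have "\<not> between P S P'" using k ray_ss(1)[of P "ln S P" P' S "ln S U"] p True ln_inc[OF d(2)] d(7) SP by metis
    moreover have "\<not> between P' P S" using l between_opp ln_inc[OF d(1)] off ss_not_opp by blast
    moreover have "\<not> between P P' S" using l' between_opp ln_inc[OF e(1)] off ss_not_opp by blast
    moreover have "P \<noteq> P'" using off ln_inc d by blast
    ultimately show False using between_trich[of P "ln S P" P' S] p True SP between_sym by metis
  next
    case False
    have "\<not> inc U (ln S P)" "\<not> inc U (ln S P')"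
      using d e SP ln_inc[OF SP(1)] ln_inc[OF SP(2)] ln_inc[OF d(2)] line_unique by metis+
    have "inside U S P' P \<or> inside U S P P'" using inside_cases[of S U P P'] k False d(2) by blast
    then have "inside P' S U P \<or> inside P S U P'" unfolding inside_def using k ss_sym by blast
    then show False using *[OF a b n k l l'] *[OF b a _ ss_sym[OF k] l' l] n by metis
  qed
qed

lemma asy_trans_out:
  assumes a: "asy P Q S U" and b: "asy P' Q' S U" and o: "opp (ln P Q) P' S"
  shows "asy P Q P' Q'"
proof -
  note d = asyD[OF a]
  obtain Y where Y: "inc Y (ln P Q)" "between P' Y S" using o by (rule opp_pt)
  obtain V where V1: "\<And>A B. asy P Q A B \<longleftrightarrow> asy Y V A B" using asy_shift[OF d(1) Y(1)] by metis
  have "asy Y V P' Q'" using asy_between[of S Y P' U Q' V] Y asy_sym[OF b] a V1 between_sym by blast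
  then show ?thesis using V1 by blast
qed

lemma asy_trans:
  assumes a: "asy P Q S U" and b: "asy P' Q' S U" and n: "ln P Q \<noteq> ln P' Q'"
  shows "asy P Q P' Q'"
  using asy_three[OF assms] asy_trans_mid[OF a b] asy_trans_out[OF a b] asy_trans_out[OF b a] asy_sym by blast

end

section \<open>Ends\<close>

context incidence
begin

text \<open>
  The end of the ray \<open>PQ\<close>, as the pencil of all lines with this end.
\<close>

definition pen :: "'p \<Rightarrow> 'p \<Rightarrow> 'l set" where
  "pen P Q = {l. l = ln P Q \<or> (\<exists>S U. l = ln S U \<and> asy S U P Q)}"

definition pencil :: "'l set \<Rightarrow> bool" where
  "pencil e \<longleftrightarrow> (\<exists>P Q. P \<noteq> Q \<and> e = pen P Q)"

definition rim_of :: "'l set \<Rightarrow> 'l rimpoint" where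
  "rim_of e = {(a, b). a \<noteq> b \<and> a \<in> e \<and> b \<in> e}"

definition mid :: "'l \<Rightarrow> 'l \<Rightarrow> 'l \<Rightarrow> bool" where
  "mid b a c \<longleftrightarrow> (\<forall>P R. inc P a \<and> inc R c \<longrightarrow> opp b P R)"

end

locale ordered_plane = separated_plane +
  assumes ax6: A6
begin

section \<open>Ends as pencils of lines\<close>

lemma point_on: obtains P where "inc P l"
  using ax2 unfolding A2_def by blast

lemma pen_self: "ln P Q \<in> pen P Q"
  unfolding pen_def by simp

lemma pen_asy: assumes a: "asy P Q S U" shows "pen P Q = pen S U"
proof -
  have "pen P Q \<subseteq> pen S U" if a: "asy P Q S U" for P Q S U
  proof
    fix l assume "l \<in> pen P Q"
    then consider "l = ln P Q" | A B where "l = ln A B" "asy A B P Q" unfolding pen_def by blast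
    then show "l \<in> pen S U"
    proof cases
      case 1 then show ?thesis using a unfolding pen_def by blast
    next
      case 2 then show ?thesis using asy_trans[OF 2(2) asy_sym[OF a]] unfolding pen_def by blast
    qed
  qed
  then show ?thesis using a asy_sym by blast
qed

lemma pen_shift:
  assumes PQ: "P \<noteq> Q" and Y: "inc Y (ln P Q)"
  obtains V where "inc V (ln P Q)" "V \<noteq> Y" "pen P Q = pen Y V"
proof -
  obtain V where V: "inc V (ln P Q)" "V \<noteq> Y" "\<And>S U. asy P Q S U \<longleftrightarrow> asy Y V S U"
    using asy_shift[OF assms] by metis
  have l: "ln Y V = ln P Q" using ln_eq V Y by metis
  have "asy S U P Q \<longleftrightarrow> asy S U Y V" for S U using V(3) asy_sym by blast
  then have "pen P Q = pen Y V" unfolding pen_def l by simp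
  then show thesis using that V by blast
qed

lemma pen_at: assumes "pencil e" obtains V where "V \<noteq> Y" "e = pen Y V"
proof -
  obtain P Q where e: "P \<noteq> Q" "e = pen P Q" using assms unfolding pencil_def by blast
  show thesis
  proof (cases "inc Y (ln P Q)")
    case True then show ?thesis using pen_shift e that by metis
  next
    case False
    then obtain V where "asy Y V P Q" using asy_ex e by metis
    then show ?thesis using that e pen_asy asyD(1) by metis
  qed
qed

lemma pencil_pen: "P \<noteq> Q \<Longrightarrow> pencil (pen P Q)"
  unfolding pencil_def by blast

lemma pen_line: assumes "l \<in> pen P Q" "inc P l" shows "l = ln P Q"
  using assms asyD(3) asy_sym unfolding pen_def by blast

lemma pencil_disjoint: assumes "pencil e" "l \<in> e" "m \<in> e" "inc Y l" "inc Y m" shows "l = m"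
  using pen_at[OF assms(1)] pen_line assms by metis

lemma pencil_at: assumes "pencil e" "l \<in> e" "inc P l" obtains Q where "P \<noteq> Q" "inc Q l" "e = pen P Q" "l = ln P Q"
  using pen_at[OF assms(1)] pen_line assms ln_inc by metis

lemma pencil_point: assumes "pencil e" shows "\<exists>!l. inc P l \<and> l \<in> e"
proof -
  obtain V where V: "V \<noteq> P" "e = pen P V" using pen_at[OF assms] by metis
  then show ?thesis using pen_self ln_inc pencil_disjoint[OF assms] by metis
qed

lemma pen_same:
  assumes "P \<noteq> Q" "P \<noteq> V" "inc V (ln P Q)" "\<not> between V P Q"
  shows "pen P V = pen P Q"
proof -
  have l: "ln P V = ln P Q" using ln_eq assms ln_inc by metis
  have "asy P Q S U \<longleftrightarrow> asy P V S U" for S U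
    using asy_extend[of V P Q S U] asy_extend[of Q P V S U] assms l ln_inc between_sym by metis
  then have "asy S U P Q \<longleftrightarrow> asy S U P V" for S U using asy_sym by blast
  then show ?thesis unfolding pen_def l by simp
qed

lemma pen_eq_asy:
  assumes e: "pen P W = pen S U" and n: "ln P W \<noteq> ln S U" "P \<noteq> W" "S \<noteq> U"
  shows "\<exists>V. inc V (ln P W) \<and> asy P V S U"
proof -
  have "ln P W \<in> pen S U" using e pen_self by metis
  then obtain A B where AB: "ln P W = ln A B" "asy A B S U" using n unfolding pen_def by blast
  have "inc P (ln A B)" using AB ln_inc n by metis
  then show ?thesis using asy_shift[OF asyD(1)[OF AB(2)]] AB by metis
qed

lemma pen_opp: assumes "between Q P V" shows "pen P Q \<noteq> pen P V"
proof
  assume e: "pen P Q = pen P V"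
  have d: "P \<noteq> Q" "P \<noteq> V" using betweenD assms by metis+
  obtain S where S: "\<not> inc S (ln P Q)" by (rule off_line)
  obtain U where U: "asy P Q S U" using asy_ex[of S P Q] S d asy_sym by metis
  note D = asyD[OF U]
  have V: "ln P V = ln P Q" using ln_eq[of P V "ln P Q"] d ln_inc[OF d(1)] betweenD(5)[OF assms] by blast
  have "pen S U = pen P V" using pen_asy[OF U] e by simp
  moreover have "ln S U \<noteq> ln P V" using V D(2) S ln_inc by metis
  ultimately obtain U' where U': "inc U' (ln S U)" "asy S U' P V" using pen_eq_asy D d by metis
  then show False using asy_one_end[OF U asy_sym[OF U'(2)] assms] by blast
qed

lemma pen_eq_iff: assumes "P \<noteq> Q" "P \<noteq> V"
  shows "pen P V = pen P Q \<longleftrightarrow> inc V (ln P Q) \<and> \<not> between V P Q"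
proof
  assume e: "pen P V = pen P Q"
  then have "ln P V \<in> pen P Q" using pen_self by metis
  then have "ln P V = ln P Q" using pen_line ln_inc assms by metis
  then show "inc V (ln P Q) \<and> \<not> between V P Q" using pen_opp e ln_inc assms by metis
qed (use pen_same assms in blast)

lemma pen_asy_iff:
  assumes n: "ln P W \<noteq> ln S U" "P \<noteq> W" "S \<noteq> U"
  shows "pen P W = pen S U \<longleftrightarrow> asy P W S U"
proof
  assume e: "pen P W = pen S U"
  then obtain V where V: "inc V (ln P W)" "asy P V S U" using pen_eq_asy n by metis
  have "pen P V = pen P W" using pen_asy[OF V(2)] e by simp
  then have "\<not> between V P W" using pen_opp by blast
  then have "\<not> between W P V" using between_sym by blast
  moreover have "ln P V = ln P W" using ln_eq[of P V "ln P W"] asyD(1)[OF V(2)] V n ln_inc by metis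
  ultimately show "asy P W S U" using asy_extend[of W P V S U] V n asyD(1)[OF V(2)] ln_inc by metis
qed (rule pen_asy)

lemma pen_side:
  assumes e: "pen P W = pen S U" and "P \<noteq> W" "S \<noteq> U" "P \<noteq> S" "inc P t" "inc S t" "\<not> inc W t"
  shows "ss t W U"
proof -
  have "ln P W \<noteq> ln S U" using ln_inc line_unique assms by metis
  then have "asy P W S U" using pen_asy_iff assms by metis
  then have "ss (ln P S) W U" by (rule asyD(5))
  then show ?thesis using ln_eq assms by metis
qed

lemma line_ends_at:
  assumes "inc P l"
  obtains Q V where "between Q P V" "inc Q l" "inc V l" "{e. pencil e \<and> l \<in> e} = {pen P Q, pen P V}"
proof -
  obtain Q V where QV: "inc Q l" "inc V l" "between Q P V" using extension_point[OF assms] by metis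
  have d: "P \<noteq> Q" "P \<noteq> V" using betweenD(1,2)[OF QV(3)] by auto
  have l: "ln P Q = l" "ln P V = l" using ln_eq d assms QV by metis+
  have "e = pen P Q \<or> e = pen P V" if e: "pencil e" "l \<in> e" for e
  proof -
    obtain W where W: "P \<noteq> W" "inc W l" "e = pen P W" using pencil_at[OF e assms] by metis
    have "\<not> between W P Q \<or> \<not> between W P V" using no_three_between[of Q P W V] QV(3) between_sym by blast
    then show ?thesis using pen_same W l d by metis
  qed
  moreover have "pencil (pen P Q)" "pencil (pen P V)" "l \<in> pen P Q" "l \<in> pen P V"
    using pencil_pen d pen_self l by metis+
  ultimately have "{e. pencil e \<and> l \<in> e} = {pen P Q, pen P V}" by blast
  then show thesis using that QV by blast
qed

lemma line_ends: "\<exists>e f. e \<noteq> f \<and> {e. pencil e \<and> l \<in> e} = {e, f}"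
proof -
  obtain P where "inc P l" by (rule point_on)
  then show ?thesis using line_ends_at pen_opp by metis
qed

text \<open>Existence is (A6) for two rays with a common origin. If two lines shared both ends,
  opposite rays of one would both be asymptotic to the other, against
  \<open>asy_one_end\<close>.\<close>

lemma pencil_join: assumes "pencil e" "pencil f" "e \<noteq> f" shows "\<exists>!l. l \<in> e \<and> l \<in> f"
proof -
  obtain P :: 'a where True by blast
  obtain W where W: "W \<noteq> P" "e = pen P W" using pen_at assms by metis
  obtain V where V: "V \<noteq> P" "f = pen P V" using pen_at assms by metis
  have ex: "\<exists>l. l \<in> e \<and> l \<in> f"
  proof (cases "ln P W = ln P V")
    case True then show ?thesis using W V pen_self by metis
  next
    case False
    have "\<not> collinear (ray P W \<union> ray P V)"
    proof
      assume "collinear (ray P W \<union> ray P V)"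
      then obtain l where "inc P l" "inc W l" "inc V l" unfolding collinear_def ray_def by auto
      then show False using False ln_eq W V by metis
    qed
    then obtain l where l: "parallel_to_ray l P W" "parallel_to_ray l P V"
      using ax6 W V unfolding A6_def by metis
    have "l \<in> pen P X" if "parallel_to_ray l P X" for X
      using that unfolding parallel_to_ray_def contains_ray_iff rays_parallel_iff pen_def by blast
    then show ?thesis using l W V by blast
  qed
  have "l = m" if lm: "l \<in> e" "l \<in> f" "m \<in> e" "m \<in> f" for l m
  proof (rule ccontr)
    assume n: "l \<noteq> m"
    obtain P where P: "inc P l" by (rule point_on)
    obtain W where W: "P \<noteq> W" "inc W l" "e = pen P W" "l = ln P W" using pencil_at[OF assms(1) lm(1) P] by metis
    obtain V where V: "P \<noteq> V" "inc V l" "f = pen P V" "l = ln P V" using pencil_at[OF assms(2) lm(2) P] by metis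
    have b: "between W P V" using pen_same[of P V W] W V assms(3) by metis
    obtain S where S: "inc S m" by (rule point_on)
    obtain U where U: "S \<noteq> U" "inc U m" "e = pen S U" "m = ln S U" using pencil_at[OF assms(1) lm(3) S] by metis
    obtain U' where U': "S \<noteq> U'" "inc U' m" "f = pen S U'" "m = ln S U'" using pencil_at[OF assms(2) lm(4) S] by metis
    have "asy P W S U" "asy P V S U'" using pen_asy_iff n W V U U' by metis+
    then show False using asy_one_end b U U' by metis
  qed
  then show ?thesis using ex by blast
qed

lemma parallel_pen: "parallel l m \<longleftrightarrow> l \<noteq> m \<and> (\<exists>e. pencil e \<and> l \<in> e \<and> m \<in> e)"
proof
  assume "parallel l m"
  then obtain R Q S U where a: "asy R Q S U" "l = ln R Q" "m = ln S U" unfolding parallel_iff by blast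
  note d = asyD[OF a(1)]
  have "l \<noteq> m" using a d ln_inc by metis
  moreover have "pencil (pen R Q)" "l \<in> pen R Q" "m \<in> pen R Q"
    using pencil_pen d(1) pen_self a pen_asy[OF a(1)] by metis+
  ultimately show "l \<noteq> m \<and> (\<exists>e. pencil e \<and> l \<in> e \<and> m \<in> e)" by blast
next
  assume "l \<noteq> m \<and> (\<exists>e. pencil e \<and> l \<in> e \<and> m \<in> e)"
  then obtain e where e: "l \<noteq> m" "pencil e" "l \<in> e" "m \<in> e" by blast
  obtain P S where P: "inc P l" "inc S m" using point_on by metis
  obtain W where W: "P \<noteq> W" "e = pen P W" "l = ln P W" using pencil_at e P by metis
  obtain U where U: "S \<noteq> U" "e = pen S U" "m = ln S U" using pencil_at e P by metis
  have "asy P W S U" using pen_asy_iff W U e by metis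
  then show "parallel l m" unfolding parallel_iff using W U by blast
qed

text \<open>The two ends of each line are on opposite sides of the transversal \<open>t\<close>,
  while rays from \<open>t\<close> to a common end are on the same side of it. With three different
  ends this would be a proper colouring of a triangle with two colours.\<close>

lemma share_end:
  assumes t: "meets t a" "meets t b" "meets t c" and d: "a \<noteq> b" "b \<noteq> c" "a \<noteq> c"
    and e: "pencil e" "a \<in> e" "b \<in> e" and f: "pencil f" "b \<in> f" "c \<in> f" and g: "pencil g" "a \<in> g" "c \<in> g"
  shows "e = f"
proof (rule ccontr)
  assume ef: "e \<noteq> f"
  obtain A where A: "inc A t" "inc A a" using t(1) by (auto elim: meetsE)
  obtain B where B: "inc B t" "inc B b" using t(2) by (auto elim: meetsE)
  obtain C where C: "inc C t" "inc C c" using t(3) by (auto elim: meetsE)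
  have AB: "A \<noteq> B" "B \<noteq> C" "A \<noteq> C"
    using A B C pencil_disjoint[OF e] pencil_disjoint[OF f] pencil_disjoint[OF g] d by metis+
  have tn: "t \<noteq> a" "t \<noteq> b" "t \<noteq> c" using t unfolding meets_def by auto
  have eg: "e \<noteq> g" using pencil_join[OF e(1) f(1) ef] e f g d by metis
  have fg: "f \<noteq> g" using pencil_join[OF e(1) f(1) ef] e f g d by metis
  obtain Ae where Ae: "A \<noteq> Ae" "inc Ae a" "e = pen A Ae" "a = ln A Ae" using pencil_at e A by metis
  obtain Ag where Ag: "A \<noteq> Ag" "inc Ag a" "g = pen A Ag" "a = ln A Ag" using pencil_at g A by metis
  obtain Be where Be: "B \<noteq> Be" "inc Be b" "e = pen B Be" "b = ln B Be" using pencil_at e B by metis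
  obtain Bf where Bf: "B \<noteq> Bf" "inc Bf b" "f = pen B Bf" "b = ln B Bf" using pencil_at f B by metis
  obtain Cf where Cf: "C \<noteq> Cf" "inc Cf c" "f = pen C Cf" "c = ln C Cf" using pencil_at f C by metis
  obtain Cg where Cg: "C \<noteq> Cg" "inc Cg c" "g = pen C Cg" "c = ln C Cg" using pencil_at g C by metis
  have bt: "between Ae A Ag" "between Be B Bf" "between Cf C Cg"
    using pen_same Ae Ag Be Bf Cf Cg ef eg fg by metis+
  have off: "\<not> inc Ae t" "\<not> inc Bf t" "\<not> inc Cg t" "\<not> inc Ag t" "\<not> inc Be t" "\<not> inc Cf t"
    using A B C Ae Ag Be Bf Cf Cg tn line_unique by metis+
  have o: "opp t Ae Ag" "opp t Be Bf" "opp t Cf Cg" using bt between_opp A B C off by metis+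
  have s: "ss t Ae Be" "ss t Bf Cf" "ss t Cg Ag"
    using pen_side[of A Ae B Be t] pen_side[of B Bf C Cf t] pen_side[of C Cg A Ag t] Ae Ag Be Bf Cf Cg AB off A B C by metis+
  have 1: "opp t Ae Bf" using ss_opp s o by blast
  have "opp t Bf Cg" using ss_opp s o by blast
  then have "ss t Ae Cg" using opp_opp 1 by blast
  then have "ss t Ae Ag" using s ss_trans by blast
  then show False using o ss_not_opp by blast
qed

section \<open>Order of the lines of a pencil\<close>

lemma midI:
  assumes "opp b P R" "inc P a" "inc R c" "\<not> meets a b" "\<not> meets c b"
  shows "mid b a c"
  unfolding mid_def
proof (intro allI impI)
  fix P' R' assume h: "inc P' a \<and> inc R' c"
  have o: "\<not> inc P b" "\<not> inc R b" using assms opp_off by blast+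
  have "ss b P' P" using ss_miss[OF assms(4,2) _ o(1)] h ss_sym by blast
  moreover have "ss b R R'" using ss_miss[OF assms(5,3) _ o(2)] h by blast
  ultimately show "opp b P' R'" using assms(1) ss_opp opp_ss by blast
qed

lemma pencil_miss: "pencil e \<Longrightarrow> l \<in> e \<Longrightarrow> m \<in> e \<Longrightarrow> \<not> meets l m"
  using pencil_disjoint unfolding meets_def by metis

lemma mid_ex:
  assumes e: "pencil e" "a \<in> e" "b \<in> e" "c \<in> e" and d: "a \<noteq> b" "b \<noteq> c" "a \<noteq> c"
  shows "mid a b c \<or> mid b a c \<or> mid c a b"
proof -
  obtain A B C where P: "inc A a" "inc B b" "inc C c" using point_on by metis
  obtain A' where A: "A \<noteq> A'" "e = pen A A'" "a = ln A A'" using pencil_at e(1,2) P by metis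
  obtain B' where B: "B \<noteq> B'" "e = pen B B'" "b = ln B B'" using pencil_at e(1,3) P by metis
  obtain C' where C: "C \<noteq> C'" "e = pen C C'" "c = ln C C'" using pencil_at e(1,4) P by metis
  have "asy A A' C C'" "asy B B' C C'" using pen_asy_iff A B C d by metis+
  then have "opp c A B \<or> opp a B C \<or> opp b A C" using asy_three[of A A' C C' B B'] A B C d by metis
  then show ?thesis using midI[of c A B a b] midI[of a B C b c] midI[of b A C a c] P pencil_miss e by metis
qed

lemma mid_sym: "mid b a c \<Longrightarrow> mid b c a"
  unfolding mid_def using opp_sym by blast

lemma mid_trans:
  assumes e: "pencil e" "w \<in> e" "x \<in> e" "y \<in> e" "z \<in> e" and m: "mid x z y" "mid w x y"
  shows "mid w z y"
proof -
  obtain P R where P: "inc P z" "inc R y" using point_on by metis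
  have "opp x P R" using m P unfolding mid_def by blast
  then obtain X where X: "inc X x" "between P X R" by (rule opp_pt)
  have o: "opp w X R" using m X P unfolding mid_def by blast
  then obtain V where V: "inc V w" "between X V R" by (rule opp_pt)
  have PV: "between P V R" using between_inner(2)[of P X R V] X V by blast
  have "\<not> inc P w"
  proof
    assume "inc P w"
    then have "inc X w" using V betweenD(1)[OF PV] betweenD(6)[OF X(2)] betweenD(5)[OF PV] by metis
    then show False using o opp_off by blast
  qed
  then have "opp w P R" using between_opp PV V by blast
  then show ?thesis using midI P pencil_miss e by metis
qed

text \<open>\<open>x\<close> and \<open>y\<close> are the outermost lines of \<open>F\<close>.
  Keeping such a pair is the invariant that yields a common transversal, because a line joining a
  point of \<open>x\<close> to a point of \<open>y\<close> crosses all lines in the middle.\<close>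

lemma transversal_insert:
  assumes e: "pencil e" "F \<subseteq> e" "x \<in> e" "y \<in> e" "z \<in> e" "x \<noteq> y"
    and h: "\<forall>w\<in>F. w = x \<or> w = y \<or> mid w x y"
  obtains x' y' where "x' \<in> e" "y' \<in> e" "x' \<noteq> y'" "\<forall>w\<in>insert z F. w = x' \<or> w = y' \<or> mid w x' y'"
proof -
  consider "z = x \<or> z = y \<or> mid z x y" | "z \<noteq> x" "z \<noteq> y" "mid x z y" | "z \<noteq> x" "z \<noteq> y" "mid y x z"
    using mid_ex[of e x y z] e mid_sym by metis
  then show thesis
  proof cases
    case 1 then show ?thesis using that[of x y] e h by blast
  next
    case 2
    have "w = z \<or> w = y \<or> mid w z y" if w: "w \<in> insert z F" for w
    proof -
      consider "w = z" | "w = x" | "w = y" | "w \<in> F" "mid w x y" using w h by blast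
      then show ?thesis using mid_trans[OF e(1) _ e(3,4,5) 2(3), of w] 2 e(2) by cases auto
    qed
    then show ?thesis using that[of z y] e 2 by blast
  next
    case 3
    have "w = x \<or> w = z \<or> mid w x z" if w: "w \<in> insert z F" for w
    proof -
      consider "w = z" | "w = x" | "w = y" | "w \<in> F" "mid w y x" using w h mid_sym by blast
      then show ?thesis using mid_trans[OF e(1) _ e(4,3,5) mid_sym[OF 3(3)], of w] 3 e(2) mid_sym by cases auto
    qed
    then show ?thesis using that[of x z] e 3 by blast
  qed
qed

text \<open>Four lines, since \<open>rim_pair_eq\<close> asks for a transversal common to two pairs.
  It joins points of the two outermost lines.\<close>

lemma transversal:
  assumes e: "pencil e" "a \<in> e" "b \<in> e" "c \<in> e" "d \<in> e" and "a \<noteq> b"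
  obtains t where "\<forall>x\<in>{a, b, c, d}. meets t x"
proof -
  obtain x y where x: "x \<in> e" "y \<in> e" "x \<noteq> y" "\<forall>w\<in>{c, a, b}. w = x \<or> w = y \<or> mid w x y"
    using transversal_insert[of e "{a, b}" a b c] assms by auto
  obtain x' y' where y: "x' \<in> e" "y' \<in> e" "x' \<noteq> y'" "\<forall>w\<in>{d, c, a, b}. w = x' \<or> w = y' \<or> mid w x' y'"
    using transversal_insert[of e "{c, a, b}" x y d] assms x by auto
  obtain P R where P: "inc P x'" "inc R y'" using point_on by metis
  have n: "\<not> inc P y'" "\<not> inc R x'" using P pencil_disjoint[OF e(1)] y by metis+
  then have PR: "P \<noteq> R" using P by blast
  note t = ln_inc[OF PR]
  have "meets (ln P R) w" if "w = x' \<or> w = y' \<or> mid w x' y'" for w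
    using that opp_meets[of w P R] meetsI[OF t(1) P(1)] meetsI[OF t(2) P(2)] t n P unfolding mid_def by metis
  then show thesis using that y by blast
qed

lemma third_line:
  assumes e: "pencil e" "a \<in> e" "b \<in> e" and "a \<noteq> b"
  obtains c where "c \<in> e" "c \<noteq> a" "c \<noteq> b"
proof -
  obtain A where A: "inc A a" by (rule point_on)
  obtain B where B: "inc B b" by (rule point_on)
  have AB: "A \<noteq> B" using A B e assms pencil_disjoint by metis
  obtain X where X: "inc X (ln A B)" "X \<noteq> A" "X \<noteq> B" using third_point ln_inc AB by metis
  obtain c where c: "inc X c" "c \<in> e" using pencil_point[OF e(1)] by metis
  have "a \<noteq> ln A B" "b \<noteq> ln A B" using ln_inc AB A B pencil_disjoint[OF e(1)] e assms by metis+
  then have "c \<noteq> a" "c \<noteq> b" using c X A B ln_inc AB line_unique by metis+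
  then show thesis using that c by blast
qed

section \<open>Rimpoints and ends\<close>

lemma rim_pair_iff: "rim_pair (a, b) \<longleftrightarrow> a \<noteq> b \<and> (\<exists>e. pencil e \<and> a \<in> e \<and> b \<in> e)"
proof
  assume "rim_pair (a, b)"
  then show "a \<noteq> b \<and> (\<exists>e. pencil e \<and> a \<in> e \<and> b \<in> e)" unfolding rim_pair_def using parallel_pen by auto
next
  assume "a \<noteq> b \<and> (\<exists>e. pencil e \<and> a \<in> e \<and> b \<in> e)"
  then obtain e where e: "a \<noteq> b" "pencil e" "a \<in> e" "b \<in> e" by blast
  obtain c where c: "c \<in> e" "c \<noteq> a" "c \<noteq> b" using third_line e by metis
  obtain t where "\<forall>x\<in>{a, b, c, c}. meets t x" using transversal[OF e(2-4) c(1) c(1) e(1)] by metis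
  then show "rim_pair (a, b)" unfolding rim_pair_def concurrent_parallels_def
    using parallel_pen e c by auto
qed

text \<open>Being parallel to \<open>a\<close> and to \<open>b\<close> does not put \<open>l\<close>
  into their pencil, as \<open>l\<close> may complete an ideal triangle; the common transversal
  excludes this by \<open>share_end\<close>.\<close>

lemma concurrent_iff:
  assumes e: "pencil e" "a \<in> e" "b \<in> e" "a \<noteq> b"
  shows "l = a \<or> l = b \<or> concurrent_parallels a b l \<longleftrightarrow> l \<in> e"
proof
  assume "l \<in> e"
  obtain t where "\<forall>x\<in>{a, b, l, l}. meets t x" using transversal[OF e(1-3) \<open>l \<in> e\<close> \<open>l \<in> e\<close> e(4)] by metis
  then show "l = a \<or> l = b \<or> concurrent_parallels a b l"
    unfolding concurrent_parallels_def parallel_pen using e \<open>l \<in> e\<close> by auto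
next
  assume l: "l = a \<or> l = b \<or> concurrent_parallels a b l"
  show "l \<in> e"
  proof (cases "l = a \<or> l = b")
    case True then show ?thesis using e by blast
  next
    case False
    then obtain t f g where t: "meets t a" "meets t b" "meets t l" "pencil f" "l \<in> f" "b \<in> f" "pencil g" "l \<in> g" "a \<in> g"
      using l unfolding concurrent_parallels_def parallel_pen by blast
    then show ?thesis using share_end[OF t(1-3), of e f g] e False by blast
  qed
qed

lemma rim_class_eq: assumes e: "pencil e" "a \<in> e" "b \<in> e" "a \<noteq> b" shows "rim_class (a, b) = rim_of e"
proof -
  have "(c, d) \<in> rim_class (a, b) \<longleftrightarrow> (c, d) \<in> rim_of e" for c d
  proof
    assume "(c, d) \<in> rim_class (a, b)"
    then have h: "c \<noteq> d" "\<And>x. x \<in> {c, d} \<Longrightarrow> x = a \<or> x = b \<or> concurrent_parallels a b x"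
      unfolding rim_class_def rim_pair_eq_def concurrent_parallels_def by (auto simp: rim_pair_iff)
    then show "(c, d) \<in> rim_of e" unfolding rim_of_def using concurrent_iff[OF e] by simp
  next
    assume "(c, d) \<in> rim_of e"
    then have c: "c \<in> e" "d \<in> e" "c \<noteq> d" unfolding rim_of_def by auto
    obtain t where "\<forall>x\<in>{a, b, c, d}. meets t x" using transversal[OF e(1-3) c(1,2) e(4)] by metis
    moreover have "x = y \<or> parallel x y" if "x \<in> {a, b, c, d}" "y \<in> {a, b, c, d}" for x y
      using that e c parallel_pen by blast
    moreover have "rim_pair (c, d)" using rim_pair_iff e c by blast
    ultimately show "(c, d) \<in> rim_class (a, b)" unfolding rim_class_def rim_pair_eq_def by blast
  qed
  then show ?thesis by auto
qed

lemma two_lines: assumes "pencil e" "a \<in> e" obtains b where "b \<in> e" "b \<noteq> a"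
proof -
  obtain P where "\<not> inc P a" by (rule off_line)
  then show thesis using that pencil_point[OF assms(1)] by metis
qed

lemma pencil_nonempty: assumes "pencil e" obtains a where "a \<in> e"
  using assms pen_self unfolding pencil_def by blast

lemma rim_iff: "X \<in> rim \<longleftrightarrow> (\<exists>e. pencil e \<and> X = rim_of e)"
proof
  assume "X \<in> rim"
  then obtain a b where "rim_pair (a, b)" "X = rim_class (a, b)" unfolding rim_def by auto
  then show "\<exists>e. pencil e \<and> X = rim_of e" using rim_pair_iff rim_class_eq by metis
next
  assume "\<exists>e. pencil e \<and> X = rim_of e"
  then obtain e where e: "pencil e" "X = rim_of e" by blast
  obtain a where a: "a \<in> e" using pencil_nonempty e by metis
  obtain b where b: "b \<in> e" "b \<noteq> a" using two_lines e a by metis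
  have "rim_pair (a, b)" using rim_pair_iff e a b by metis
  moreover have "X = rim_class (a, b)" using rim_class_eq[of e a b] e a b by simp
  ultimately show "X \<in> rim" unfolding rim_def by blast
qed

lemma on_iff: assumes e: "pencil e" shows "on (Rim (rim_of e)) l \<longleftrightarrow> l \<in> e"
proof
  assume "on (Rim (rim_of e)) l"
  then obtain a b where "(a, b) \<in> rim_of e" "rim_pair_inc (a, b) l" by auto
  then have "a \<in> e" "b \<in> e" "a \<noteq> b" "l = a \<or> l = b \<or> concurrent_parallels a b l"
    unfolding rim_of_def rim_pair_inc_def by auto
  then show "l \<in> e" using concurrent_iff e by blast
next
  assume l: "l \<in> e"
  then obtain b where b: "b \<in> e" "b \<noteq> l" using two_lines e by metis
  have "rim_of e \<in> rim" using rim_iff e by blast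
  moreover have "(l, b) \<in> rim_of e" using l b unfolding rim_of_def by simp
  ultimately show "on (Rim (rim_of e)) l" by (auto simp: rim_pair_inc_def)
qed

lemma rim_of_inj: assumes "pencil e" "pencil f" "rim_of e = rim_of f" shows "e = f"
  using assms on_iff by (metis set_eqI)

end

section \<open>Separation of ends\<close>

context incidence
begin

definition ron :: "'l rimpoint \<Rightarrow> 'l \<Rightarrow> bool" where
  "ron X l \<longleftrightarrow> on (Rim X) l"

definition rp :: "'p \<Rightarrow> 'p \<Rightarrow> 'l rimpoint" where
  "rp P Q = rim_of (pen P Q)"

text \<open>
  The ray from \<open>P\<close> with end \<open>X\<close> meets \<open>m\<close>.
\<close>

definition tow :: "'l \<Rightarrow> 'p \<Rightarrow> 'l rimpoint \<Rightarrow> bool" where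
  "tow m P X \<longleftrightarrow> (\<exists>Z. inc Z m \<and> P \<noteq> Z \<and> X = rp P Z)"

end

context ordered_plane
begin

lemma ron_iff: "pencil e \<Longrightarrow> ron (rim_of e) l \<longleftrightarrow> l \<in> e"
  unfolding ron_def by (rule on_iff)

lemma ron_rim: "ron X l \<Longrightarrow> X \<in> rim"
  unfolding ron_def by simp

lemma rp_rim: "P \<noteq> Q \<Longrightarrow> rp P Q \<in> rim"
  unfolding rim_iff rp_def using pencil_pen by blast

lemma rp_on: "P \<noteq> Q \<Longrightarrow> ron (rp P Q) (ln P Q)"
  unfolding rp_def using ron_iff[OF pencil_pen] pen_self by blast

lemma rp_eq_iff: "P \<noteq> Q \<Longrightarrow> S \<noteq> U \<Longrightarrow> rp P Q = rp S U \<longleftrightarrow> pen P Q = pen S U"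
  unfolding rp_def using rim_of_inj[OF pencil_pen pencil_pen] by metis

lemma rp_at: assumes "ron X l" "inc P l" obtains V where "P \<noteq> V" "inc V l" "X = rp P V" "l = ln P V"
proof -
  obtain e where e: "pencil e" "X = rim_of e" using ron_rim[OF assms(1)] rim_iff by blast
  then have "l \<in> e" using ron_iff assms by blast
  then show thesis using pencil_at[OF e(1) _ assms(2)] that e(2) unfolding rp_def by metis
qed

lemma ron_point: assumes "X \<in> rim" shows "\<exists>!l. inc P l \<and> ron X l"
proof -
  obtain e where e: "pencil e" "X = rim_of e" using assms rim_iff by blast
  then show ?thesis using pencil_point[OF e(1)] ron_iff by simp
qed

lemma ron_join: assumes "X \<in> rim" "Y \<in> rim" "X \<noteq> Y" shows "\<exists>!l. ron X l \<and> ron Y l"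
proof -
  obtain e where e: "pencil e" "X = rim_of e" using assms rim_iff by blast
  obtain f where f: "pencil f" "Y = rim_of f" using assms rim_iff by blast
  show ?thesis using pencil_join[OF e(1) f(1)] ron_iff[OF e(1)] ron_iff[OF f(1)] e(2) f(2) assms(3) by auto
qed

lemma ron_disjoint: assumes "ron X l" "ron X m" shows "\<not> meets l m"
  using ron_point[OF ron_rim[OF assms(1)]] assms unfolding meets_def by blast

lemma rims_of_iff: "X \<in> rims_of l \<longleftrightarrow> ron X l"
  unfolding rims_of_def ron_def by simp

lemma rims_of_two: obtains X Y where "X \<noteq> Y" "rims_of l = {X, Y}" "X \<in> rim" "Y \<in> rim"
proof -
  obtain e f where ef: "e \<noteq> f" "{e. pencil e \<and> l \<in> e} = {e, f}" using line_ends by metis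
  have p: "pencil e" "pencil f" using ef(2) by blast+
  have "rims_of l = rim_of ` {e. pencil e \<and> l \<in> e}"
    using ron_iff ron_rim rim_iff rims_of_iff by (auto simp: image_iff) metis+
  then have "rims_of l = {rim_of e, rim_of f}" using ef by simp
  moreover have "rim_of e \<noteq> rim_of f" using rim_of_inj p ef by blast
  moreover have "rim_of e \<in> rim" "rim_of f \<in> rim" unfolding rim_iff using p by blast+
  ultimately show thesis using that by blast
qed

lemma parallel_ron: "parallel l m \<longleftrightarrow> l \<noteq> m \<and> (\<exists>X. ron X l \<and> ron X m)"
  unfolding parallel_pen using ron_iff rim_iff ron_rim by metis

section \<open>The side of a line on which an end lies\<close>

lemma pen_move:
  assumes "R \<noteq> Q" "inc R' (ln R Q)" "R' \<noteq> Q" "\<not> between R Q R'"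
  shows "pen R' Q = pen R Q"
proof -
  have l: "ln R' Q = ln R Q" using ln_eq assms ln_inc by metis
  have "asy R Q S U \<longleftrightarrow> asy R' Q S U" for S U
    using asy_move[of R Q S U R'] asy_move[of R' Q S U R] assms l ln_inc between_sym by metis
  then have "asy S U R Q \<longleftrightarrow> asy S U R' Q" for S U using asy_sym by blast
  then show ?thesis unfolding pen_def l by simp
qed

lemma pen_beyond: assumes "between P M V" shows "pen P M = pen M V"
proof -
  note d = betweenD(1-3)[OF assms]
  have l: "inc M (ln P V)" using betweenD(6)[OF assms] ln_inc d by blast
  have "pen P M = pen P V" using pen_same[of P V M] l d between_unique[OF assms] by metis
  also have "\<dots> = pen M V" using pen_move[of P V M] l d between_unique'[OF assms] by metis
  finally show ?thesis .
qed

lemma pen_swap: assumes "P \<noteq> M" shows "pen P M \<noteq> pen M P"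
proof -
  obtain E where "between P M E" using extend assms by metis
  then show ?thesis using pen_beyond pen_opp by metis
qed

lemma tow_meet:
  assumes "inc M m" "M \<noteq> V" "ln M V \<noteq> m" "inc P (ln M V)" "P \<noteq> M"
  shows "tow m P (rp M V) \<longleftrightarrow> opp m P V"
proof -
  note l = ln_inc[OF assms(2)]
  have "tow m P (rp M V) \<longleftrightarrow> pen P M = pen M V"
  proof
    assume "tow m P (rp M V)"
    then obtain Z where Z: "inc Z m" "P \<noteq> Z" "rp M V = rp P Z" unfolding tow_def by blast
    then have e: "pen M V = pen P Z" using rp_eq_iff assms by blast
    then have "ln M V \<in> pen P Z" using pen_self by metis
    then have "ln M V = ln P Z" using pen_line assms by blast
    then have "Z = M" using Z ln_inc assms l meet_unique by metis
    then show "pen P M = pen M V" using e by simp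
  next
    assume "pen P M = pen M V"
    then show "tow m P (rp M V)" unfolding tow_def using assms rp_eq_iff by metis
  qed
  also have "\<dots> \<longleftrightarrow> between P M V"
  proof
    assume e: "pen P M = pen M V"
    show "between P M V"
    proof (rule ccontr)
      assume "\<not> between P M V"
      then have "pen M P = pen M V" using pen_same[of M V P] assms by metis
      then show False using e pen_swap assms by metis
    qed
  qed (rule pen_beyond)
  also have "\<dots> \<longleftrightarrow> opp m P V" using ray_ss(2)[of P "ln M V" V M m] assms l by blast
  finally show ?thesis .
qed

lemma tow_miss: assumes "ron X l" "inc P l" "\<not> meets l m" "\<not> inc P m" shows "\<not> tow m P X"
proof
  assume "tow m P X"
  then obtain Z where Z: "inc Z m" "P \<noteq> Z" "X = rp P Z" unfolding tow_def by blast
  then have "l = ln P Z" using ron_point[OF ron_rim[OF assms(1)]] rp_on ln_inc assms by metis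
  then show False using assms Z ln_inc meetsI by metis
qed

text \<open>Since \<open>m\<close> misses \<open>b\<close>, its ray from \<open>M\<close> on the
  side of \<open>P\<close> cannot enter the angle \<open>PMV\<close>. It therefore lies in the angle
  between \<open>MP\<close> and the ray opposite to \<open>MV\<close>, so \<open>m\<close> separates
  \<open>P\<close> from that opposite ray, and not from \<open>V\<close>.\<close>

lemma tow_mixed:
  assumes M: "inc M m" "M \<noteq> V" "\<not> inc V m" and b: "ron (rp M V) b" "\<not> meets b m" "inc P b" "\<not> inc P m"
  shows "ss m P V"
proof -
  note l = ln_inc[OF M(2)]
  obtain W where W: "P \<noteq> W" "inc W b" "rp M V = rp P W" "b = ln P W" using rp_at[OF b(1,3)] by metis
  have "b \<noteq> ln M V" using l b M meetsI by metis
  then have a: "asy M V P W" using pen_asy_iff[of M V P W] W M rp_eq_iff by metis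
  note d = asyD[OF a]
  have lm: "m \<noteq> ln M V" using l M by metis
  obtain X where X: "inc X m" "X \<noteq> M" "ss (ln M V) X P" using side_point[OF M(1) l(1) lm d(3)] by metis
  have mX: "ln M X = m" using ln_eq X M by metis
  define t where "t = ln M P"
  have t: "inc M t" "inc P t" using ln_inc d t_def by auto
  have mt: "m \<noteq> t" using t b by blast
  have Xt: "\<not> inc X t" using mt X t M meet_unique by metis
  have Vt: "\<not> inc V t" using d(5) ss_off t_def by blast
  have "\<not> ss t X V"
  proof
    assume "ss t X V"
    then have "inside P M V X" unfolding inside_def using X t_def by blast
    then show False using d(6) mX b W meets_sym by metis
  qed
  then have XV: "opp t X V" using ss_or_opp Xt Vt by blast
  obtain V' where V': "between V M V'" using extend M by metis
  have oV: "opp t V V'" using between_opp[OF V' t(1) Vt] .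
  then have XV': "ss t X V'" using opp_opp XV by blast
  have lV': "ln M V' = ln M V" using ln_eq[of M V' "ln M V"] betweenD(2)[OF V'] betweenD(5)[OF V'] l by blast
  have "inside P M V' X" unfolding inside_def using X XV' lV' t_def by simp
  then have "opp m P V'" using crossbar d(8) betweenD(2)[OF V'] mX by metis
  moreover have "opp m V V'" using between_opp[OF V' M(1,3)] .
  ultimately show ?thesis using opp_opp opp_sym by blast
qed

text \<open>This gives an end off \<open>m\<close> a side of \<open>m\<close>: the points whose ray
  to \<open>X\<close> meets \<open>m\<close> are exactly the points on one side. The cases depend on
  whether the lines from \<open>P\<close> and \<open>P'\<close> to \<open>X\<close> meet
  \<open>m\<close>.\<close>

lemma tow_side:
  assumes X: "X \<in> rim" "\<not> ron X m" and P: "\<not> inc P m" "\<not> inc P' m"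
  shows "(tow m P X \<longleftrightarrow> tow m P' X) \<longleftrightarrow> ss m P P'"
proof -
  obtain b where b: "inc P b" "ron X b" using ron_point[OF X(1)] by metis
  obtain b' where b': "inc P' b'" "ron X b'" using ron_point[OF X(1)] by metis
  have hit: "\<exists>M V. inc M m \<and> M \<noteq> V \<and> \<not> inc V m \<and> X = rp M V \<and> inc M b \<and> b = ln M V \<and>
      (\<forall>P. inc P b \<and> \<not> inc P m \<longrightarrow> tow m P X = opp m P V)" if b: "meets b m" "ron X b" for b
  proof -
    obtain M where M: "inc M b" "inc M m" using b(1) by (auto elim: meetsE)
    obtain V where V: "M \<noteq> V" "inc V b" "X = rp M V" "b = ln M V" using rp_at[OF b(2) M(1)] by metis
    have bm: "b \<noteq> m" using b X by blast
    have "\<not> inc V m" using V M bm line_unique by metis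
    moreover have "\<forall>P. inc P b \<and> \<not> inc P m \<longrightarrow> tow m P X = opp m P V"
      using tow_meet[of M m V] M V bm by metis
    ultimately show ?thesis using M V by blast
  qed
  have mixed: "(tow m P X \<longleftrightarrow> tow m P' X) \<longleftrightarrow> ss m P P'"
    if b: "inc P b" "ron X b" "meets b m" "\<not> inc P m" and b': "inc P' b'" "ron X b'" "\<not> meets b' m" "\<not> inc P' m" for P P' b b'
  proof -
    obtain M V where M: "inc M m" "M \<noteq> V" "\<not> inc V m" "X = rp M V" "tow m P X = opp m P V"
      using hit[OF b(3,2)] b by metis
    have "ss m P' V" using tow_mixed[of M m V b' P'] M b' by blast
    moreover have "\<not> tow m P' X" using tow_miss b' by blast
    ultimately show ?thesis using M(3,5) b(4) ss_sym ss_trans ss_or_opp ss_not_opp by blast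
  qed
  show ?thesis
  proof (cases "meets b m"; cases "meets b' m")
    assume h: "meets b m" "meets b' m"
    obtain M V where M: "inc M m" "M \<noteq> V" "\<not> inc V m" "X = rp M V" "inc M b" "b = ln M V" "tow m P X = opp m P V"
      using hit[OF h(1) b(2)] b P by metis
    obtain N W where N: "inc N m" "N \<noteq> W" "\<not> inc W m" "X = rp N W" "inc N b'" "b' = ln N W" "tow m P' X = opp m P' W"
      using hit[OF h(2) b'(2)] b' P by metis
    have e: "pen M V = pen N W" using M N rp_eq_iff by metis
    have "ss m V W"
    proof (cases "M = N")
      case True
      then have "inc W (ln M V) \<and> \<not> between W M V" using pen_eq_iff e M N by metis
      then show ?thesis using same_ray[of M "ln M V" V W m] M N True ln_inc[OF M(2)] by metis
    next
      case False then show ?thesis using pen_side e M N by metis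
    qed
    then have "opp m P V \<longleftrightarrow> opp m P W" using opp_ss ss_sym by blast
    then show ?thesis using M(7) N(7) P N(3) ss_sym ss_trans ss_or_opp ss_not_opp opp_opp opp_sym opp_ss by metis
  next
    assume h: "meets b m" "\<not> meets b' m"
    then show ?thesis using mixed b b' P by blast
  next
    assume h: "\<not> meets b m" "meets b' m"
    then show ?thesis using mixed[of P' b' P b] b b' P ss_sym by blast
  next
    assume h: "\<not> meets b m" "\<not> meets b' m"
    \<comment> \<open>Otherwise let \<open>T\<close> be the point of \<open>m\<close> between
      \<open>P\<close> and \<open>P'\<close>, and \<open>g\<close> the line from \<open>T\<close> to
      the end \<open>X\<close>. One ray of \<open>m\<close> from \<open>T\<close> lies inside the
      angle between \<open>g\<close> and \<open>TP\<close> or inside that between \<open>g\<close>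
      and \<open>TP'\<close>, so \<open>m\<close> meets \<open>b\<close> or
      \<open>b'\<close>.\<close>
    have "ss m P P'"
    proof (rule ccontr)
      assume "\<not> ss m P P'"
      then have o: "opp m P P'" using ss_or_opp P by blast
      then obtain T where T: "inc T m" "between P T P'" by (rule opp_pt)
      have bb: "b \<noteq> b'" using o ss_miss[OF h(1) b(1) _ P(1), of P'] b' ss_not_opp by metis
      have TP: "T \<noteq> P" "T \<noteq> P'" using T P by blast+
      obtain W where W: "P \<noteq> W" "inc W b" "X = rp P W" "b = ln P W" using rp_at[OF b(2,1)] by metis
      obtain W' where W': "P' \<noteq> W'" "inc W' b'" "X = rp P' W'" "b' = ln P' W'" using rp_at[OF b'(2,1)] by metis
      obtain g where g: "inc T g" "ron X g" using ron_point[OF X(1)] by metis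
      obtain V where V: "T \<noteq> V" "inc V g" "X = rp T V" "g = ln T V" using rp_at[OF g(2,1)] by metis
      have gm: "g \<noteq> m" using g X by blast
      have Tb: "\<not> inc T b" "\<not> inc T b'" using h T P b b' meetsI by metis+
      then have gb: "g \<noteq> b" "g \<noteq> b'" using g by blast+
      have a: "asy T V P W" "asy T V P' W'"
        using pen_asy_iff[of T V P W] pen_asy_iff[of T V P' W'] V W W' gb rp_eq_iff by metis+
      define k where "k = ln P P'"
      have k: "inc P k" "inc P' k" using ln_inc betweenD(3)[OF T(2)] k_def by auto
      have Tk: "inc T k" using betweenD(6)[OF T(2)] k by blast
      have kT: "ln T P = k" "ln T P' = k" using ln_eq[of T P k] ln_eq[of T P' k] TP Tk k by blast+
      have km: "k \<noteq> m" using k P by blast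
      have Vk: "\<not> inc V k" using asyD(5)[OF a(1)] kT ss_off by metis
      obtain Z where Z: "inc Z m" "Z \<noteq> T" "ss k Z V" using side_point[OF T(1) Tk km[symmetric] Vk] by metis
      have mZ: "ln T Z = m" using ln_eq Z T by metis
      have Pg: "\<not> inc P g" "\<not> inc P' g" using ron_disjoint[OF g(2) b(2)] ron_disjoint[OF g(2) b'(2)] gb b(1) b'(1) meetsI by metis+
      have "opp g P P'" using between_opp[OF T(2) g(1) Pg(1)] .
      moreover have "\<not> inc Z g" using Z gm g T meet_unique by metis
      ultimately have "ss g Z P \<or> ss g Z P'" using ss_or_opp[of Z g P] ss_or_opp[of Z g P'] Pg opp_opp opp_sym by metis
      then have "inside P T V Z \<or> inside P' T V Z" unfolding inside_def using Z V(4) kT by metis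
      then show False using asyD(6)[OF a(1)] asyD(6)[OF a(2)] h mZ W W' meets_sym by metis
    qed
    then show ?thesis using tow_miss[OF b(2,1) h(1) P(1)] tow_miss[OF b'(2,1) h(2) P(2)] by blast
  qed
qed

section \<open>Pairs of ends on crossing lines\<close>

lemma rjoin_on: assumes "X \<in> rim" "Y \<in> rim" "X \<noteq> Y" shows "ron X (rjoin X Y)" "ron Y (rjoin X Y)"
proof -
  have "ron X (rjoin X Y) \<and> ron Y (rjoin X Y)"
    unfolding join_def ron_def[symmetric] by (rule theI'[OF ron_join[OF assms]])
  then show "ron X (rjoin X Y)" "ron Y (rjoin X Y)" by auto
qed

lemma rjoin_eq: assumes "X \<noteq> Y" "ron X l" "ron Y l" shows "rjoin X Y = l"
  using ron_join[OF ron_rim[OF assms(2)] ron_rim[OF assms(3)] assms(1)]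
    rjoin_on[OF ron_rim[OF assms(2)] ron_rim[OF assms(3)] assms(1)] assms(2,3) by blast

lemma rjoin_sym: "rjoin X Y = rjoin Y X"
  unfolding join_def by (simp add: conj_commute)

lemma rims_rjoin: assumes "X \<in> rim" "Y \<in> rim" "X \<noteq> Y" shows "ron Z (rjoin X Y) \<longleftrightarrow> Z = X \<or> Z = Y"
proof -
  obtain A B where "rims_of (rjoin X Y) = {A, B}" using rims_of_two by metis
  then have *: "ron Z (rjoin X Y) \<longleftrightarrow> Z = A \<or> Z = B" for Z
    using rims_of_iff[of Z "rjoin X Y"] by simp
  have "X = A \<or> X = B" "Y = A \<or> Y = B" using *[of X] *[of Y] rjoin_on[OF assms] by metis+
  then show ?thesis using *[of Z] assms(3) by metis
qed

lemma crosses_distinct: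
  assumes "crosses A C B D" "A \<in> rim" "B \<in> rim" "C \<in> rim" "D \<in> rim"
  shows "A \<noteq> C" "B \<noteq> D" "A \<noteq> B" "A \<noteq> D" "C \<noteq> B" "C \<noteq> D"
proof -
  show d: "A \<noteq> C" "B \<noteq> D" using assms unfolding crosses_def by auto
  have "meets (rjoin A C) (rjoin B D)" using assms unfolding crosses_def by auto
  then have "\<not> (ron X (rjoin A C) \<and> ron X (rjoin B D))" for X using ron_disjoint by blast
  then show "A \<noteq> B" "A \<noteq> D" "C \<noteq> B" "C \<noteq> D"
    using rims_rjoin[OF assms(2,4) d(1)] rims_rjoin[OF assms(3,5) d(2)] by metis+
qed

lemma crosses_sym: "crosses A C B D \<longleftrightarrow> crosses C A B D" "crosses A C B D \<longleftrightarrow> crosses B D A C"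
  unfolding crosses_def using rjoin_sym meets_sym by metis+

text \<open>The sides of \<open>B\<close> and \<open>D\<close> are compared by one observer
  \<open>P\<close>, and \<open>tow_side\<close> lets the observer move to a point of
  \<open>BD\<close>, from which the two rays run in opposite directions.\<close>

lemma crosses_tow:
  assumes r: "A \<in> rim" "B \<in> rim" "C \<in> rim" "D \<in> rim" and d: "A \<noteq> C" "B \<noteq> A" "B \<noteq> C" "D \<noteq> A" "D \<noteq> C"
    and P: "\<not> inc P (rjoin A C)"
  shows "crosses A C B D \<longleftrightarrow> tow (rjoin A C) P B \<noteq> tow (rjoin A C) P D"
proof (cases "B = D")
  case True then show ?thesis unfolding crosses_def by simp
next
  case False
  define m where "m = rjoin A C"
  define n where "n = rjoin B D"
  have off: "\<not> ron B m" "\<not> ron D m" using rims_rjoin r d m_def by metis+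
  have n: "ron B n" "ron D n" using rjoin_on r False n_def by metis+
  have mn: "m \<noteq> n" using n off by blast
  have inv: "(tow m P B \<noteq> tow m P D) = (tow m Q B \<noteq> tow m Q D)" if "\<not> inc Q m" for Q
    using tow_side[OF r(2) off(1) P[folded m_def] that] tow_side[OF r(4) off(2) P[folded m_def] that] by blast
  have "meets m n \<longleftrightarrow> tow m P B \<noteq> tow m P D"
  proof (cases "meets m n")
    case True
    then obtain M where M: "inc M m" "inc M n" by (auto elim: meetsE)
    obtain V where V: "M \<noteq> V" "inc V n" "B = rp M V" "n = ln M V" using rp_at[OF n(1) M(2)] by metis
    obtain W where W: "M \<noteq> W" "inc W n" "D = rp M W" "n = ln M W" using rp_at[OF n(2) M(2)] by metis
    have Vm: "\<not> inc V m" using V M mn line_unique by metis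
    have "tow m V B \<longleftrightarrow> opp m V V" using tow_meet[of M m V V] M V mn by metis
    moreover have "tow m V D \<longleftrightarrow> opp m V W" using tow_meet[of M m W V] M V W mn by metis
    moreover have "\<not> opp m V V" using ss_refl[OF Vm] ss_not_opp by blast
    moreover have "opp m V W"
    proof -
      have "pen M V \<noteq> pen M W" using False V W rp_eq_iff by metis
      then have "between V M W" using pen_same[of M W V] V W by metis
      then show ?thesis using between_opp M Vm by blast
    qed
    ultimately show ?thesis using inv[OF Vm] True by blast
  next
    case F: False
    obtain Q where Q: "inc Q n" by (rule point_on)
    have nm: "\<not> meets n m" using F meets_sym by blast
    have Qm: "\<not> inc Q m" using Q nm mn meetsI by metis
    have "\<not> tow m Q B" "\<not> tow m Q D" using tow_miss[OF n(1) Q nm Qm] tow_miss[OF n(2) Q nm Qm] by auto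
    then show ?thesis using inv[OF Qm] F by blast
  qed
  then show ?thesis unfolding crosses_def m_def n_def using d False by blast
qed

lemma crosses_parity:
  assumes r: "A \<in> rim" "B \<in> rim" "C \<in> rim" "D \<in> rim" "E \<in> rim"
    and d: "A \<noteq> C" "B \<noteq> A" "B \<noteq> C" "D \<noteq> A" "D \<noteq> C" "E \<noteq> A" "E \<noteq> C"
  shows "crosses A C B E \<longleftrightarrow> (crosses A C B D \<noteq> crosses A C D E)"
proof -
  obtain P where P: "\<not> inc P (rjoin A C)" by (rule off_line)
  show ?thesis
    using crosses_tow[OF r(1,2,3,4) d(1-5) P] crosses_tow[OF r(1,2,3,5) d(1-3,6,7) P] crosses_tow[OF r(1,4,3,5) d(1,4-7) P]
    by blast
qed

text \<open>From a common point of \<open>AB\<close> and \<open>CD\<close> the rays towards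
  \<open>B\<close> and towards \<open>D\<close> both miss \<open>AC\<close>, because these lines
  share an end with it. So \<open>B\<close> and \<open>D\<close> are on one side of
  \<open>AC\<close>.\<close>

lemma crosses_exclusive:
  assumes c: "crosses A C B D" and r: "A \<in> rim" "B \<in> rim" "C \<in> rim" "D \<in> rim"
  shows "\<not> crosses A B C D"
proof
  assume "crosses A B C D"
  note d = crosses_distinct[OF c r]
  define m where "m = rjoin A C"
  have off: "\<not> ron B m" "\<not> ron D m" using rims_rjoin r d m_def by metis+
  obtain P where P: "inc P (rjoin A B)" "inc P (rjoin C D)" using \<open>crosses A B C D\<close> unfolding crosses_def by (auto elim: meetsE)
  have m: "ron A m" "ron C m" using rjoin_on r d m_def by metis+
  have 1: "\<not> meets (rjoin A B) m" "\<not> meets (rjoin C D) m"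
    using ron_disjoint[OF rjoin_on(1)[OF r(1,2) d(3)] m(1)] ron_disjoint[OF rjoin_on(1)[OF r(3,4) d(6)] m(2)] by auto
  have "rjoin A B \<noteq> m" using off rjoin_on(2)[OF r(1,2) d(3)] by metis
  then have Pm: "\<not> inc P m" using 1 P meetsI by metis
  have "\<not> tow m P B" "\<not> tow m P D"
    using tow_miss[OF rjoin_on(2)[OF r(1,2) d(3)] P(1) 1(1) Pm] tow_miss[OF rjoin_on(2)[OF r(3,4) d(6)] P(2) 1(2) Pm] by auto
  then show False using crosses_tow[OF r d(1) d(3)[symmetric] d(5)[symmetric] d(4)[symmetric] d(6)[symmetric]] Pm c m_def by metis
qed

text \<open>\<open>PW\<close> separates \<open>U\<close> from \<open>V\<close>, hence the end
  \<open>A\<close> from the end \<open>B\<close>, so it meets \<open>AB\<close>, and on the ray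
  towards \<open>D\<close>. As \<open>AC\<close> misses \<open>AB\<close>, the observer
  \<open>P\<close> sees \<open>D\<close> but not \<open>C\<close> beyond \<open>AB\<close>.\<close>

lemma crosses_inside:
  assumes r: "A \<in> rim" "B \<in> rim" "C \<in> rim" "D \<in> rim" and d: "A \<noteq> C" "B \<noteq> A" "B \<noteq> C" "D \<noteq> A" "D \<noteq> C" "B \<noteq> D"
    and P: "P \<noteq> V" "P \<noteq> W" "P \<noteq> U" "inc P (rjoin A C)" "A = rp P U" "B = rp P V" "D = rp P W"
    and i: "inside U P V W"
  shows "crosses A B C D"
proof -
  define m where "m = rjoin A C"
  have m: "ron A m" "ron C m" using rjoin_on r d m_def by metis+
  have Um: "ln P U = m" using ron_point[OF r(1), of P] m P rp_on ln_inc m_def by metis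
  define q where "q = rjoin A B"
  have q: "ron A q" "ron B q" using rjoin_on[OF r(1,2)] d q_def by metis+
  have qm: "\<not> meets m q" "\<not> meets q m" using ron_disjoint m q by blast+
  have Bm: "\<not> ron B m" using rims_rjoin r d m_def by metis
  have Pq: "\<not> inc P q" using q qm P(4) Bm m_def meetsI by metis
  define g where "g = ln P W"
  have g: "inc P g" "inc W g" using ln_inc P g_def by auto
  have VW: "ss m W V" "ss (ln P V) W U" using i Um unfolding inside_def by auto
  have UV: "opp g U V" using crossbar[OF i P(3,1)] g_def by simp
  have off: "\<not> ron A g" "\<not> ron B g"
    using ron_point[OF r(1), of P] ron_point[OF r(2), of P] rp_on P g ln_inc UV opp_off by metis+
  have "tow g U A \<longleftrightarrow> opp g U U" "tow g V B \<longleftrightarrow> opp g V V"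
    using tow_meet[of P g U U] tow_meet[of P g V V] P g off rp_on ln_inc by metis+
  then have n: "\<not> tow g U A" "\<not> tow g V B" using UV ss_refl ss_not_opp opp_off by metis+
  have "tow g U B" using tow_side[OF r(2) off(2), of U V] n UV opp_off ss_not_opp by metis
  obtain D' where D': "D' \<noteq> D" "rims_of g = {D, D'}" "D' \<in> rim"
  proof -
    obtain X Y where X: "X \<noteq> Y" "rims_of g = {X, Y}" "X \<in> rim" "Y \<in> rim" by (rule rims_of_two)
    have "ron D g" using rp_on P g_def by metis
    then have "D \<in> rims_of g" using rims_of_iff by blast
    then have "(X = D \<and> Y \<noteq> D) \<or> (Y = D \<and> X \<noteq> D)" using X by auto
    then show thesis using that[of Y] that[of X] X by auto
  qed
  have gj: "rjoin D D' = g" using rjoin_eq[of D D' g] D' rims_of_iff by blast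
  have nD: "A \<noteq> D'" "B \<noteq> D'" using off D' rims_of_iff by blast+
  have "crosses D D' A B"
    using crosses_tow[OF r(4) r(1) D'(3) r(2), of U] d nD D' gj opp_off(1)[OF UV] n \<open>tow g U B\<close> by metis
  then have "meets g q" unfolding crosses_def gj q_def by blast
  then obtain Y where Y: "inc Y g" "inc Y q" by (auto elim: meetsE)
  have Ym: "\<not> inc Y m" using Y q qm Bm meetsI by metis
  have "tow m V B \<longleftrightarrow> opp m V V" using tow_meet[of P m V V] P Bm rp_on ln_inc m_def by metis
  then have "\<not> tow m V B" using VW ss_refl ss_off ss_not_opp by metis
  moreover have "\<not> tow m Y B" using tow_miss[OF q(2) Y(2) qm(2) Ym] .
  ultimately have "ss m Y V" using tow_side[OF r(2) Bm Ym, of V] VW ss_off by metis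
  then have YW: "ss m Y W" using VW ss_sym ss_trans by blast
  have YP: "Y \<noteq> P" using Y Pq by blast
  have gm: "g \<noteq> m" using g VW ss_off by blast
  have "\<not> between Y P W" using ray_ss(1)[of Y g W P m] Y g P(4) gm YP P(2) YW m_def by metis
  then have "pen P Y = pen P W" using pen_same[of P W Y] P(2) YP Y g_def by metis
  then have "D = rp P Y" using P rp_eq_iff YP by metis
  then have 1: "tow q P D" unfolding tow_def using Y YP by blast
  have "\<not> tow q P C" using tow_miss[OF m(2) _ qm(1) Pq] P m_def by metis
  then show ?thesis using crosses_tow[OF r(1,3,2,4), of P] Pq 1 d q_def by metis
qed

text \<open>If \<open>AC\<close> does not separate \<open>B\<close> from \<open>D\<close>, the rays
  to them from a point of \<open>AC\<close> are on one side of \<open>AC\<close>, so one lies in the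
  angle between the other and the ray to \<open>A\<close>; this is the situation of
  \<open>crosses_inside\<close>.\<close>

lemma crosses_total:
  assumes r: "A \<in> rim" "B \<in> rim" "C \<in> rim" "D \<in> rim" and d: "distinct [A, B, C, D]"
  shows "crosses A C B D \<or> crosses A B C D \<or> crosses A D B C"
proof (rule ccontr)
  assume n: "\<not> ?thesis"
  define m where "m = rjoin A C"
  have AC: "A \<noteq> C" using d by simp
  obtain P where P: "inc P m" by (rule point_on)
  have m: "ron A m" "ron C m" using rjoin_on r AC m_def by metis+
  obtain U where U: "P \<noteq> U" "inc U m" "A = rp P U" "m = ln P U" using rp_at[OF m(1) P] by metis
  obtain b where b: "inc P b" "ron B b" using ron_point[OF r(2)] by metis
  obtain V where V: "P \<noteq> V" "inc V b" "B = rp P V" "b = ln P V" using rp_at[OF b(2,1)] by metis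
  obtain g where g: "inc P g" "ron D g" using ron_point[OF r(4)] by metis
  obtain W where W: "P \<noteq> W" "inc W g" "D = rp P W" "g = ln P W" using rp_at[OF g(2,1)] by metis
  have off: "\<not> ron B m" "\<not> ron D m" using rims_rjoin[OF r(1,3) AC] d m_def by auto
  then have nm: "b \<noteq> m" "g \<noteq> m" using b g by blast+
  have Vm: "\<not> inc V m" "\<not> inc W m" using V W P nm b(1) g(1) line_unique by metis+
  have "tow m V B \<longleftrightarrow> opp m V V" "tow m W D \<longleftrightarrow> opp m W W"
    using tow_meet[of P m V V] tow_meet[of P m W W] P V W nm by metis+
  then have t: "\<not> tow m V B" "\<not> tow m W D" using ss_refl Vm ss_not_opp by metis+
  have "tow m V B = tow m V D" using crosses_tow[OF r, of V] n d Vm m_def by auto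
  then have VW: "ss m V W" using tow_side[OF r(4) off(2) Vm] t by blast
  have "\<not> inc W (ln P V)"
  proof
    assume a: "inc W (ln P V)"
    then have "\<not> between W P V" using ray_ss(1)[of W b V P m] V W b P nm VW ss_sym by metis
    then have "pen P W = pen P V" using pen_same[of P V W] V W a by metis
    then show False using V W d rp_eq_iff by auto
  qed
  then have "inside U P V W \<or> inside U P W V" using inside_cases[of P U V W] VW U by metis
  then show False
  proof
    assume "inside U P V W"
    then have "crosses A B C D" using crosses_inside[OF r, of P V W U] U V W P d m_def by auto
    then show False using n by blast
  next
    assume "inside U P W V"
    then have "crosses A D C B" using crosses_inside[OF r(1,4,3,2), of P W V U] U V W P d m_def by auto
    then show False using n crosses_sym by metis
  qed
qed

end

section \<open>The cyclic order\<close>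

text \<open>Rimpoints are sets, and extensionality must not be applied to equations between them.\<close>

declare equalityI [rule del] equalityCE [rule del]

context incidence
begin

text \<open>
  Interleaving and cyclic order of integers. Finitely many rimpoints are numbered in their cyclic order,
  so that statements about them become linear arithmetic.
\<close>

definition ilv :: "int \<Rightarrow> int \<Rightarrow> int \<Rightarrow> int \<Rightarrow> bool" where
  "ilv a c b d \<longleftrightarrow> a < b \<and> b < c \<and> c < d \<or> b < c \<and> c < d \<and> d < a \<or> c < d \<and> d < a \<and> a < b \<or> d < a \<and> a < b \<and> b < c \<or>
     c < b \<and> b < a \<and> a < d \<or> b < a \<and> a < d \<and> d < c \<or> a < d \<and> d < c \<and> c < b \<or> d < c \<and> c < b \<and> b < a"

definition cyc3 :: "int \<Rightarrow> int \<Rightarrow> int \<Rightarrow> bool" where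
  "cyc3 a b c \<longleftrightarrow> a < b \<and> b < c \<or> b < c \<and> c < a \<or> c < a \<and> a < b"

end

context ordered_plane
begin

lemma three_rims: assumes "N \<in> rim" obtains a b where "a \<in> rim" "b \<in> rim" "a \<noteq> b" "a \<noteq> N" "b \<noteq> N"
proof -
  obtain P :: 'a where True by blast
  obtain l where l: "inc P l" "ron N l" using ron_point assms by metis
  obtain m where m: "inc P m" "m \<noteq> l" by (rule line_through)
  obtain X Y where X: "X \<noteq> Y" "rims_of m = {X, Y}" "X \<in> rim" "Y \<in> rim" by (rule rims_of_two)
  have "\<not> ron N m" using ron_disjoint[OF l(2)] l m meetsI by metis
  then have "X \<noteq> N" "Y \<noteq> N" using X rims_of_iff[of _ m] by auto
  then show thesis using that X by metis
qed

text \<open>Cutting the circle at \<open>N\<close> leaves a betweenness: \<open>B x y z\<close> says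
  that the line \<open>Ny\<close> separates \<open>x\<close> from \<open>z\<close>. Two reference
  ends \<open>a\<close> and \<open>b\<close> orient it, and \<open>N\<close> is put first, which
  makes it the least element.\<close>

lemma order_at:
  assumes N: "N \<in> rim"
  obtains lt where "\<And>x y. x \<in> rim \<Longrightarrow> y \<in> rim \<Longrightarrow> x \<noteq> y \<Longrightarrow> lt x y \<noteq> lt y x" "\<And>x. \<not> lt x x"
    "\<And>x y z. x \<in> rim \<Longrightarrow> y \<in> rim \<Longrightarrow> z \<in> rim \<Longrightarrow> lt x y \<Longrightarrow> lt y z \<Longrightarrow> lt x z"
    "\<And>A B C D. A \<in> rim \<Longrightarrow> B \<in> rim \<Longrightarrow> C \<in> rim \<Longrightarrow> D \<in> rim \<Longrightarrow> distinct [A, B, C, D] \<Longrightarrow>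
       crosses A C B D \<longleftrightarrow> (lt B A \<noteq> lt B C) \<noteq> (lt D A \<noteq> lt D C)"
proof -
  obtain a b where ab: "a \<in> rim" "b \<in> rim" "a \<noteq> b" "a \<noteq> N" "b \<noteq> N" using three_rims N by metis
  define B where "B = (\<lambda>x y z. crosses N y x z)"
  \<comment> \<open>\<open>pos x\<close> says that \<open>x\<close> is on the same side of
    \<open>a\<close> as \<open>b\<close>. Beyond a positive \<open>x\<close> lies what it separates
    from \<open>a\<close>, beyond a negative one what it does not; hence the equation in
    \<open>L\<close>.\<close>
  define pos where "pos = (\<lambda>x. \<not> B x a b)"
  define L where "L = (\<lambda>x y. x \<noteq> y \<and> (if x = a then pos y else pos x = B a x y))"
  define R where "R = rim - {N}"
  have abR: "a \<in> R" "b \<in> R" using ab R_def by auto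
  have Bsym: "B x y z = B z y x" for x y z unfolding B_def using crosses_sym by metis
  have Bd: "x \<noteq> y \<and> y \<noteq> z \<and> x \<noteq> z" if "B x y z" "x \<in> R" "y \<in> R" "z \<in> R" for x y z
    using crosses_distinct[of N y x z] that N unfolding B_def R_def by blast
  have B1: "\<not> (B x y z \<and> B y x z)" if "x \<in> R" "y \<in> R" "z \<in> R" for x y z
    using crosses_exclusive[of N y x z] that N unfolding B_def R_def by blast
  have B3: "B x y z \<or> B y x z \<or> B x z y" if "x \<in> R" "y \<in> R" "z \<in> R" "x \<noteq> y" "y \<noteq> z" "x \<noteq> z" for x y z
    using crosses_total[of N x y z] that N unfolding B_def R_def by auto
  have Bp: "B x y w = (B x y z \<noteq> B z y w)"
    if "x \<in> R" "y \<in> R" "z \<in> R" "w \<in> R" "x \<noteq> y" "z \<noteq> y" "w \<noteq> y" for x y z w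
    using crosses_parity[of N x y z w] that N unfolding B_def R_def by blast
  have pp: "B x a y = (pos x \<noteq> pos y)" if "x \<in> R" "y \<in> R" "x \<noteq> a" "y \<noteq> a" for x y
    using Bp[of x a b y] that abR ab Bsym[of b a y] unfolding pos_def by blast
  have Ba: "\<not> B a y a" if "y \<in> R" for y using Bd[of a y a] that abR by blast
  have tot: "L x y \<noteq> L y x" if "x \<in> R" "y \<in> R" "x \<noteq> y" for x y
  proof -
    consider "x = a" | "y = a" | "x \<noteq> a" "y \<noteq> a" by blast
    then show ?thesis
    proof cases
      case 1 then show ?thesis using that Ba unfolding L_def by auto
    next
      case 2 then show ?thesis using that Ba unfolding L_def by auto
    next
      case 3
      then show ?thesis
        using that abR pp[of x y] B1[of a x y] B1[of x a y] B1[of a y x] B1[of x y a] B1[of y x a] B3[of a x y]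
          Bsym[of a x y] Bsym[of x a y] Bsym[of a y x] unfolding L_def by auto
    qed
  qed
  have E: "B x y z = (L y x \<noteq> L y z)" if "x \<in> R" "y \<in> R" "z \<in> R" "x \<noteq> y" "z \<noteq> y" for x y z
  proof (cases "y = a")
    case True then show ?thesis using that pp[of x z] unfolding L_def by auto
  next
    case False
    then show ?thesis using that abR Bp[of x y a z] Bsym[of x y a] unfolding L_def by auto
  qed
  have tr: "L x z" if "x \<in> R" "y \<in> R" "z \<in> R" "L x y" "L y z" for x y z
  proof (rule ccontr)
    assume n: "\<not> L x z"
    have d: "x \<noteq> y" "y \<noteq> z" using that unfolding L_def by auto
    then have xz: "x \<noteq> z" using tot that by blast
    have "B x y z" using E[of x y z] tot[of x y] that d by auto
    moreover have "B y z x" using E[of y z x] tot[of y z] tot[of x z] that d xz n by auto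
    ultimately show False using B1[of z y x] Bsym that by blast
  qed
  define lt where "lt = (\<lambda>x y. x \<noteq> y \<and> (x = N \<or> y \<noteq> N \<and> L x y))"
  have RI: "x \<in> R" if "x \<in> rim" "x \<noteq> N" for x using that R_def by blast
  show thesis
  proof (rule that[of lt])
    show "lt x y \<noteq> lt y x" if "x \<in> rim" "y \<in> rim" "x \<noteq> y" for x y
      using tot[of x y] RI that unfolding lt_def by auto
    show "\<not> lt x x" for x unfolding lt_def by simp
    show "lt x z" if "x \<in> rim" "y \<in> rim" "z \<in> rim" "lt x y" "lt y z" for x y z
    proof -
      have "x \<noteq> N \<Longrightarrow> L x z \<and> x \<noteq> z" using tr[of x y z] RI that L_def unfolding lt_def by auto
      then show ?thesis using that unfolding lt_def by auto
    qed
    show "crosses A C B' D \<longleftrightarrow> (lt B' A \<noteq> lt B' C) \<noteq> (lt D A \<noteq> lt D C)"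
      if r: "A \<in> rim" "B' \<in> rim" "C \<in> rim" "D \<in> rim" and d: "distinct [A, B', C, D]" for A B' C D
    proof -
      have two: "crosses N C B' D \<longleftrightarrow> (L C B' \<noteq> L C D)" if "C \<in> R" "B' \<in> R" "D \<in> R" "distinct [B', C, D]" for B' C D
        using E[of B' C D] that unfolding B_def by auto
      consider "A = N" | "C = N" | "B' = N" | "D = N" | "A \<noteq> N" "C \<noteq> N" "B' \<noteq> N" "D \<noteq> N" by blast
      then show ?thesis
      proof cases
        case 1
        then show ?thesis using two[of C B' D] tot[of C B'] tot[of C D] RI r d unfolding lt_def by auto
      next
        case 2
        then show ?thesis using two[of A B' D] tot[of A B'] tot[of A D] RI r d crosses_sym(1)[of A C] unfolding lt_def by auto
      next
        case 3
        then show ?thesis using two[of D A C] RI r d crosses_sym(2)[of A C B' D] unfolding lt_def by auto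
      next
        case 4
        then show ?thesis using two[of B' A C] RI r d crosses_sym(2)[of A C B' D] crosses_sym(1)[of B' D A C] unfolding lt_def by auto
      next
        case 5
        have "crosses A C B' D \<longleftrightarrow> (crosses A C B' N \<noteq> crosses A C N D)"
          using crosses_parity[of A B' C N D] r N d 5 by auto
        moreover have "crosses A C B' N = crosses N B' A C" using crosses_sym by metis
        moreover have "crosses A C N D = crosses N D A C" using crosses_sym by metis
        ultimately show ?thesis using two[of B' A C] two[of D A C] RI r d 5 unfolding lt_def by auto
      qed
    qed
  qed
qed

lemma rank:
  assumes F: "finite F" and tot: "\<And>x y. x \<in> F \<Longrightarrow> y \<in> F \<Longrightarrow> x \<noteq> y \<Longrightarrow> lt x y \<noteq> lt y x" and irr: "\<And>x. \<not> lt x x"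
    and tr: "\<And>x y z. x \<in> F \<Longrightarrow> y \<in> F \<Longrightarrow> z \<in> F \<Longrightarrow> lt x y \<Longrightarrow> lt y z \<Longrightarrow> lt x z"
  obtains f :: "'c \<Rightarrow> int" where "\<And>x y. x \<in> F \<Longrightarrow> y \<in> F \<Longrightarrow> lt x y \<longleftrightarrow> f x < f y" "inj_on f F"
proof -
  define f where "f = (\<lambda>x. int (card {y \<in> F. lt y x}))"
  have 1: "f x < f y" if "x \<in> F" "y \<in> F" "lt x y" for x y
  proof -
    have "{z \<in> F. lt z x} \<subseteq> {z \<in> F. lt z y}" "x \<in> {z \<in> F. lt z y}" "x \<notin> {z \<in> F. lt z x}"
      using that tr irr by blast+
    then have "{z \<in> F. lt z x} \<subset> {z \<in> F. lt z y}" by (metis psubsetI)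
    then have "card {z \<in> F. lt z x} < card {z \<in> F. lt z y}" using F by (intro psubset_card_mono) simp
    then show ?thesis unfolding f_def by simp
  qed
  have 2: "lt x y \<longleftrightarrow> f x < f y" if "x \<in> F" "y \<in> F" for x y
    using 1[of x y] 1[of y x] tot[of x y] irr[of x] that by force
  moreover have "inj_on f F" using 2 tot unfolding inj_on_def by (metis less_irrefl)
  ultimately show thesis using that by blast
qed

lemma cyc_ex: obtains cyc where "rim_cyclic_order cyc" "compatible cyc"
proof -
  obtain N where N: "N \<in> rim" using rims_of_two by metis
  obtain lt where tot: "\<And>x y. x \<in> rim \<Longrightarrow> y \<in> rim \<Longrightarrow> x \<noteq> y \<Longrightarrow> lt x y \<noteq> lt y x" and irr: "\<And>x. \<not> lt x x"
    and tr: "\<And>x y z. x \<in> rim \<Longrightarrow> y \<in> rim \<Longrightarrow> z \<in> rim \<Longrightarrow> lt x y \<Longrightarrow> lt y z \<Longrightarrow> lt x z"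
    and cr: "\<And>A B C D. A \<in> rim \<Longrightarrow> B \<in> rim \<Longrightarrow> C \<in> rim \<Longrightarrow> D \<in> rim \<Longrightarrow> distinct [A, B, C, D] \<Longrightarrow>
       crosses A C B D \<longleftrightarrow> (lt B A \<noteq> lt B C) \<noteq> (lt D A \<noteq> lt D C)"
    using order_at[OF N] by blast
  define cyc where "cyc = (\<lambda>x y z. lt x y \<and> lt y z \<or> lt y z \<and> lt z x \<or> lt z x \<and> lt x y)"
  have f4: "\<exists>f :: _ \<Rightarrow> int. (\<forall>x\<in>{A, B, C, D}. \<forall>y\<in>{A, B, C, D}. lt x y \<longleftrightarrow> f x < f y) \<and> inj_on f {A, B, C, D}"
    if "A \<in> rim" "B \<in> rim" "C \<in> rim" "D \<in> rim" for A B C D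
    using rank[of "{A, B, C, D}" lt] tot irr tr that by (smt (verit) empty_iff finite.emptyI finite_insert insert_iff)
  have "rim_cyclic_order cyc" unfolding rim_cyclic_order_def
  proof (intro conjI ballI impI)
    fix A B C assume r: "A \<in> rim" "B \<in> rim" "C \<in> rim"
    obtain f :: "_ \<Rightarrow> int" where "\<forall>x\<in>{A, B, C, C}. \<forall>y\<in>{A, B, C, C}. lt x y \<longleftrightarrow> f x < f y" "inj_on f {A, B, C, C}"
      using f4[OF r r(3)] by metis
    then have f: "x \<in> {A, B, C} \<Longrightarrow> y \<in> {A, B, C} \<Longrightarrow> lt x y \<longleftrightarrow> f x < f y" "distinct [A, B, C] \<Longrightarrow> distinct [f A, f B, f C]" for x y
      by (auto simp: inj_on_eq_iff)
    show "cyc B C A" if "cyc A B C" using that unfolding cyc_def by blast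
    show "\<not> cyc C B A" if "cyc A B C" using that f(1) unfolding cyc_def by auto
    show "cyc A B C \<or> cyc C B A" if "distinct [A, B, C]"
      using f(2)[OF that] f(1)[of A B] f(1)[of B C] f(1)[of C A] f(1)[of B A] f(1)[of C B] f(1)[of A C]
      unfolding cyc_def by simp linarith
  next
    fix A B C D assume r: "A \<in> rim" "B \<in> rim" "C \<in> rim" "D \<in> rim" and c: "cyc A B C \<and> cyc A C D"
    obtain f :: "_ \<Rightarrow> int" where "\<forall>x\<in>{A, B, C, D}. \<forall>y\<in>{A, B, C, D}. lt x y \<longleftrightarrow> f x < f y"
      using f4[OF r] by metis
    then have l: "lt A B \<longleftrightarrow> f A < f B" "lt B C \<longleftrightarrow> f B < f C" "lt C A \<longleftrightarrow> f C < f A"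
      "lt C D \<longleftrightarrow> f C < f D" "lt D A \<longleftrightarrow> f D < f A" "lt A C \<longleftrightarrow> f A < f C" "lt B D \<longleftrightarrow> f B < f D" by simp_all
    show "cyc A B D" using c unfolding cyc_def l by linarith
  qed
  moreover have "compatible cyc" unfolding compatible_def
  proof (intro ballI)
    fix A B C D assume r: "A \<in> rim" "B \<in> rim" "C \<in> rim" "D \<in> rim"
    obtain f :: "_ \<Rightarrow> int" where f: "\<forall>x\<in>{A, B, C, D}. \<forall>y\<in>{A, B, C, D}. lt x y \<longleftrightarrow> f x < f y" "inj_on f {A, B, C, D}"
      using f4[OF r] by metis
    have l: "lt A B \<longleftrightarrow> f A < f B" "lt B A \<longleftrightarrow> f B < f A" "lt A C \<longleftrightarrow> f A < f C" "lt C A \<longleftrightarrow> f C < f A"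
      "lt A D \<longleftrightarrow> f A < f D" "lt D A \<longleftrightarrow> f D < f A" "lt B C \<longleftrightarrow> f B < f C" "lt C B \<longleftrightarrow> f C < f B"
      "lt B D \<longleftrightarrow> f B < f D" "lt D B \<longleftrightarrow> f D < f B" "lt C D \<longleftrightarrow> f C < f D" "lt D C \<longleftrightarrow> f D < f C"
      using f(1) by auto
    show "crosses A C B D = (cyc A B C \<and> cyc C D A \<or> cyc A D C \<and> cyc C B A)"
    proof (cases "distinct [A, B, C, D]")
      case True
      then have "distinct [f A, f B, f C, f D]" using f(2) by (auto simp: inj_on_def)
      then show ?thesis unfolding cr[OF r True] cyc_def l by (simp, smt (verit))
    next
      case False
      then have "\<not> crosses A C B D" using crosses_distinct[OF _ r] by auto
      moreover have "\<not> (cyc A B C \<and> cyc C D A \<or> cyc A D C \<and> cyc C B A)"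
        using False irr unfolding cyc_def l by auto
      ultimately show ?thesis by blast
    qed
  qed
  ultimately show thesis using that by blast
qed

text \<open>The compatible order is arbitrary here, because an order-preserving axial map comes with
  an unspecified one. Making \<open>N\<close> the least element cuts the circle at a convenient
  place.\<close>

lemma cyc_rank:
  assumes c: "rim_cyclic_order cyc" "compatible cyc" and F: "finite F" "F \<subseteq> rim" and N: "N \<in> F"
  obtains f :: "_ \<Rightarrow> int" where "inj_on f F" "\<And>x. x \<in> F \<Longrightarrow> x \<noteq> N \<Longrightarrow> f N < f x"
    "\<And>A B C. A \<in> F \<Longrightarrow> B \<in> F \<Longrightarrow> C \<in> F \<Longrightarrow> cyc A B C \<longleftrightarrow> cyc3 (f A) (f B) (f C)"
    "\<And>A B C D. A \<in> F \<Longrightarrow> B \<in> F \<Longrightarrow> C \<in> F \<Longrightarrow> D \<in> F \<Longrightarrow> crosses A C B D \<longleftrightarrow> ilv (f A) (f C) (f B) (f D)"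
proof -
  define lt where "lt = (\<lambda>x y. x \<noteq> y \<and> (x = N \<or> y \<noteq> N \<and> cyc N x y))"
  have rot: "cyc A B C \<Longrightarrow> cyc B C A" and asym: "cyc A B C \<Longrightarrow> \<not> cyc C B A" and tot: "distinct [A, B, C] \<Longrightarrow> cyc A B C \<or> cyc C B A"
    if "A \<in> F" "B \<in> F" "C \<in> F" for A B C
    using c(1) that F unfolding rim_cyclic_order_def by blast+
  have tr: "cyc A B C \<Longrightarrow> cyc A C D \<Longrightarrow> cyc A B D" if "A \<in> F" "B \<in> F" "C \<in> F" "D \<in> F" for A B C D
  proof -
    have "\<forall>A\<in>rim. \<forall>B\<in>rim. \<forall>C\<in>rim. \<forall>D\<in>rim. cyc A B C \<and> cyc A C D \<longrightarrow> cyc A B D"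
      using c(1) unfolding rim_cyclic_order_def by (elim conjE)
    then show "cyc A B C \<Longrightarrow> cyc A C D \<Longrightarrow> cyc A B D" using that F by blast
  qed
  have dist: "A \<noteq> B \<and> B \<noteq> C \<and> A \<noteq> C" if "cyc A B C" "A \<in> F" "B \<in> F" "C \<in> F" for A B C
    using that rot asym by metis
  have t1: "lt x y \<noteq> lt y x" if "x \<in> F" "y \<in> F" "x \<noteq> y" for x y
  proof -
    consider "x = N" | "y = N" | "x \<noteq> N" "y \<noteq> N" by blast
    then show ?thesis
    proof cases
      case 3
      then have "distinct [N, x, y]" using that by simp
      then show ?thesis using tot[OF N that(1,2)] asym[OF N that(1,2)] rot[OF N that(1,2)] rot[OF N that(2,1)]
          rot[OF that(2,1) N] rot[OF that(1) N that(2)] that 3 unfolding lt_def by blast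
    qed (use that in \<open>simp_all add: lt_def\<close>)
  qed
  have t2: "lt x z" if "x \<in> F" "y \<in> F" "z \<in> F" "lt x y" "lt y z" for x y z
    using that tr[of N x y z] N dist[of N x z] unfolding lt_def by auto
  obtain f :: "_ \<Rightarrow> int" where f: "\<And>x y. x \<in> F \<Longrightarrow> y \<in> F \<Longrightarrow> lt x y \<longleftrightarrow> f x < f y" "inj_on f F"
  proof -
    have irr: "\<not> lt x x" for x unfolding lt_def by simp
    show thesis if "\<And>f :: _ \<Rightarrow> int. (\<And>x y. x \<in> F \<Longrightarrow> y \<in> F \<Longrightarrow> lt x y \<longleftrightarrow> f x < f y) \<Longrightarrow> inj_on f F \<Longrightarrow> thesis"
      by (rule rank[OF F(1) t1 irr t2]) (use that in blast)+
  qed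
  have fN: "f N < f x" if "x \<in> F" "x \<noteq> N" for x using f(1)[of N x] N that unfolding lt_def by blast
  have pos: "cyc A B C" if "A \<in> F" "B \<in> F" "C \<in> F" "f A < f B" "f B < f C" for A B C
  proof -
    have l: "lt A B" "lt B C" using f(1) that by blast+
    show ?thesis
    proof (cases "A = N")
      case True then show ?thesis using l unfolding lt_def by auto
    next
      case False
      then have "cyc N A B" "cyc N B C" using l unfolding lt_def by auto
      then have "cyc B N A" "cyc B C N" using rot N that by blast+
      then have "cyc B C A" using tr[of B C N A] N that by blast
      then show ?thesis using rot that by blast
    qed
  qed
  have pos': "cyc A B C" if "A \<in> F" "B \<in> F" "C \<in> F" "cyc3 (f A) (f B) (f C)" for A B C
    using that pos[of A B C] pos[of B C A] pos[of C A B] rot unfolding cyc3_def by blast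
  have cyc: "cyc A B C \<longleftrightarrow> cyc3 (f A) (f B) (f C)" if F: "A \<in> F" "B \<in> F" "C \<in> F" for A B C
  proof
    assume h: "cyc A B C"
    have "f A \<noteq> f B" "f B \<noteq> f C" "f A \<noteq> f C" using dist[OF h F] f(2) F unfolding inj_on_def by blast+
    then have "cyc3 (f A) (f B) (f C) \<or> cyc3 (f C) (f B) (f A)" unfolding cyc3_def by auto
    then show "cyc3 (f A) (f B) (f C)" using pos'[of C B A] asym[OF F h] F by blast
  qed (rule pos'[OF F])
  have "crosses A C B D \<longleftrightarrow> ilv (f A) (f C) (f B) (f D)" if "A \<in> F" "B \<in> F" "C \<in> F" "D \<in> F" for A B C D
  proof -
    have "crosses A C B D \<longleftrightarrow> cyc A B C \<and> cyc C D A \<or> cyc A D C \<and> cyc C B A"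
      using c(2) that F(2) unfolding compatible_def by blast
    also have "\<dots> \<longleftrightarrow> ilv (f A) (f C) (f B) (f D)"
      unfolding cyc[OF that(1-3)] cyc[OF that(3,4,1)] cyc[OF that(1,4,3)] cyc[OF that(3,2,1)] cyc3_def ilv_def by (smt (verit))
    finally show ?thesis .
  qed
  then show thesis using that f(2) fN cyc by blast
qed

lemma circle:
  assumes "finite F" "F \<subseteq> rim" "N \<in> F"
  obtains f :: "_ \<Rightarrow> int" where "inj_on f F" "\<And>x. x \<in> F \<Longrightarrow> x \<noteq> N \<Longrightarrow> f N < f x"
    "\<And>A B C D. A \<in> F \<Longrightarrow> B \<in> F \<Longrightarrow> C \<in> F \<Longrightarrow> D \<in> F \<Longrightarrow> crosses A C B D \<longleftrightarrow> ilv (f A) (f C) (f B) (f D)"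
proof -
  obtain cyc where "rim_cyclic_order cyc" "compatible cyc" by (rule cyc_ex)
  then show thesis using cyc_rank[OF _ _ assms] that by metis
qed

section \<open>Half-turns as permutations of the ends\<close>

abbreviation h :: "'a \<Rightarrow> 'b rimpoint \<Rightarrow> 'b rimpoint" where
  "h \<equiv> half_turn"

lemma half_turn_eq: assumes "X \<noteq> Y" "ron X l" "ron Y l" "inc P l" shows "h P X = Y"
proof -
  have X: "X \<in> rim" "Y \<in> rim" using assms ron_rim by auto
  have "join (Rim X) (Fin P) = l"
    unfolding join_def on.simps(1) ron_def[symmetric] using ron_point[OF X(1), of P] assms by (intro the_equality) blast+
  moreover have "(THE Z. Z \<noteq> X \<and> ron Z l) = Y"
  proof (rule the_equality)
    show "Z = Y" if "Z \<noteq> X \<and> ron Z l" for Z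
      using that rims_rjoin[OF X assms(1), of Z] rjoin_eq[OF assms(1-3)] by metis
  qed (use assms in metis)
  ultimately show ?thesis unfolding half_turn_def ron_def using X by simp
qed

lemma half_turn_line:
  assumes "X \<in> rim" obtains l where "inc P l" "ron X l" "ron (h P X) l" "h P X \<noteq> X" "h P X \<in> rim" "rjoin X (h P X) = l"
proof -
  obtain l where l: "inc P l" "ron X l" using ron_point assms by metis
  obtain A B where A: "A \<noteq> B" "rims_of l = {A, B}" "A \<in> rim" "B \<in> rim" by (rule rims_of_two)
  obtain Y where Y: "Y \<noteq> X" "ron Y l" using A rims_of_iff[of _ l] by (metis insertI1 insertI2)
  have "h P X = Y" using half_turn_eq Y l by metis
  then show thesis using that l Y rjoin_eq ron_rim by metis
qed

lemma half_turn_rim: "X \<in> rim \<Longrightarrow> h P X \<in> rim" "X \<in> rim \<Longrightarrow> h P X \<noteq> X"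
  using half_turn_line by metis+

lemma half_turn_inc: "X \<in> rim \<Longrightarrow> inc P (rjoin X (h P X))"
  using half_turn_line by metis

lemma half_turn_iff: assumes "X \<in> rim" "Y \<in> rim" shows "h P X = Y \<longleftrightarrow> X \<noteq> Y \<and> inc P (rjoin X Y)"
  using half_turn_inc[OF assms(1)] half_turn_rim(2)[OF assms(1)] half_turn_eq rjoin_on[OF assms] by metis

lemma half_turn_off: "X \<notin> rim \<Longrightarrow> h P X = X"
  unfolding half_turn_def by simp

lemma half_turn_half_turn [simp]: "h P (h P X) = X"
proof (cases "X \<in> rim")
  case True
  then show ?thesis using half_turn_iff[OF half_turn_rim(1)[OF True] True] half_turn_inc rjoin_sym half_turn_rim by metis
qed (simp add: half_turn_off)

lemma half_turn_permutes: "h P permutes rim"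
  unfolding permutes_def using half_turn_off half_turn_half_turn by metis

lemma half_turn_crosses:
  assumes "X \<in> rim" "Y \<in> rim" "Y \<noteq> X" "Y \<noteq> h P X" shows "crosses X (h P X) Y (h P Y)"
proof -
  have "\<not> ron Y (rjoin X (h P X))" using rims_rjoin half_turn_rim assms by metis
  then have "rjoin X (h P X) \<noteq> rjoin Y (h P Y)" using rjoin_on half_turn_rim assms by metis
  then show ?thesis unfolding crosses_def using half_turn_inc half_turn_rim meetsI assms by metis
qed

text \<open>The basic rigidity: a point of \<open>l\<close> is determined by the image of a single
  end off \<open>l\<close>. Most identities below are obtained by testing one end in this
  way.\<close>

lemma half_turn_unique:
  assumes "X \<in> rim" "h P X = h Q X" "P \<noteq> Q" "inc P l" "inc Q l" shows "ron X l" "ron (h P X) l"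
  using half_turn_inc[OF assms(1)] assms line_unique rjoin_on[OF assms(1)] half_turn_rim by metis+

text \<open>Two different lines through \<open>P\<close> cross, so each end and its image separate
  every other such pair. For three pairs this forces the images into the order of the
  originals.\<close>

lemma half_turn_cyc:
  assumes c: "rim_cyclic_order cyc" "compatible cyc" and r: "A \<in> rim" "B \<in> rim" "C \<in> rim" and abc: "cyc A B C"
  shows "cyc (h P A) (h P B) (h P C)"
proof -
  define F where "F = {A, B, C, h P A, h P B, h P C}"
  have F: "finite F" "F \<subseteq> rim" "A \<in> F" unfolding F_def using r half_turn_rim by auto
  obtain f :: "_ \<Rightarrow> int" where f: "inj_on f F" "\<And>x. x \<in> F \<Longrightarrow> x \<noteq> A \<Longrightarrow> f A < f x"
    "\<And>A B C. A \<in> F \<Longrightarrow> B \<in> F \<Longrightarrow> C \<in> F \<Longrightarrow> cyc A B C \<longleftrightarrow> cyc3 (f A) (f B) (f C)"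
    "\<And>A B C D. A \<in> F \<Longrightarrow> B \<in> F \<Longrightarrow> C \<in> F \<Longrightarrow> D \<in> F \<Longrightarrow> crosses A C B D \<longleftrightarrow> ilv (f A) (f C) (f B) (f D)"
    using cyc_rank[OF c F] by blast
  have m: "A \<in> F" "B \<in> F" "C \<in> F" "h P A \<in> F" "h P B \<in> F" "h P C \<in> F" unfolding F_def by auto
  have e: "f x = f y \<longleftrightarrow> x = y" if "x \<in> F" "y \<in> F" for x y using f(1) that unfolding inj_on_def by blast
  have k: "Y = X \<or> Y = h P X \<or> crosses X (h P X) Y (h P Y)" if "X \<in> rim" "Y \<in> rim" for X Y
    using half_turn_crosses that by blast
  have k': "f Y = f X \<or> (f Y = f (h P X) \<and> f (h P Y) = f X) \<or> ilv (f X) (f (h P X)) (f Y) (f (h P Y))"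
    if "X \<in> rim" "Y \<in> rim" "X \<in> F" "Y \<in> F" "h P X \<in> F" "h P Y \<in> F" for X Y
    using k[OF that(1,2)] f(4)[of X Y "h P X" "h P Y"] that by auto
  have g: "f (h P X) \<noteq> f X" if "X \<in> rim" "X \<in> F" "h P X \<in> F" for X using e that half_turn_rim by metis
  have "cyc3 (f (h P A)) (f (h P B)) (f (h P C))"
    using k'[of A B] k'[of A C] k'[of B C] g[of A] g[of B] g[of C] r m f(3)[OF m(1-3)] abc
    unfolding cyc3_def ilv_def by smt
  then show ?thesis using f(3) m by blast
qed

end

section \<open>Products of half-turns\<close>

context incidence
begin

definition ends :: "'l \<Rightarrow> 'l rimpoint \<Rightarrow> 'l rimpoint \<Rightarrow> bool" where
  "ends l A B \<longleftrightarrow> A \<noteq> B \<and> ron A l \<and> ron B l"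

end

context ordered_plane
begin

lemma ends_sym: "ends l A B \<longleftrightarrow> ends l B A"
  unfolding ends_def by blast

lemma endsD:
  assumes "ends l A B"
  shows "A \<noteq> B" "ron A l" "ron B l" "A \<in> rim" "B \<in> rim" "rjoin A B = l" "ron X l \<longleftrightarrow> X = A \<or> X = B"
proof -
  show 1: "A \<noteq> B" "ron A l" "ron B l" using assms unfolding ends_def by auto
  then show 2: "A \<in> rim" "B \<in> rim" using ron_rim by auto
  show 3: "rjoin A B = l" using rjoin_eq 1 by metis
  show "ron X l \<longleftrightarrow> X = A \<or> X = B" using rims_rjoin[OF 2 1(1)] 3 by metis
qed

lemma ends_ex: obtains A B where "ends l A B"
proof -
  obtain A B where "A \<noteq> B" "rims_of l = {A, B}" by (rule rims_of_two)
  then have "ends l A B" unfolding ends_def using rims_of_iff[of _ l] by (metis insertI1 insertI2)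
  then show thesis by (rule that)
qed

lemma ends_rims: assumes "ends l A B" shows "rims_of l = {A, B}"
  using endsD(7)[OF assms] rims_of_iff[of _ l] by (intro set_eqI) simp

lemma ends_half_turn: assumes "ends l A B" "inc P l" shows "h P A = B" "h P B = A"
  using half_turn_eq endsD[OF assms(1)] assms(2) by metis+

lemma ends_swap: "ron X l \<Longrightarrow> inc P l \<Longrightarrow> ends l X (h P X)"
  using half_turn_line ron_point ron_rim unfolding ends_def by metis

lemma ends_unique: "ends l A B \<Longrightarrow> ends l C D \<Longrightarrow> C = A \<and> D = B \<or> C = B \<and> D = A"
  using endsD by metis

lemma ends_points: assumes "P \<noteq> Q" "inc P l" "inc Q l" shows "ends l (rp Q P) (rp P Q)"
proof -
  have "ln P Q = l" "ln Q P = l" using ln_eq assms by metis+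
  then show ?thesis unfolding ends_def using rp_on assms rp_eq_iff pen_swap by metis
qed

lemma off_rim: assumes "ends l A B" obtains X where "X \<in> rim" "\<not> ron X l"
  using three_rims[of A] endsD[OF assms] by metis

lemma half_turn_side:
  assumes "ends l A B" "inc P l" "X \<in> rim" "\<not> ron X l"
  shows "crosses A B X (h P X)" "\<not> ron (h P X) l"
proof -
  have d: "X \<noteq> A" "X \<noteq> h P A" using assms endsD[OF assms(1)] ends_half_turn by metis+
  show "crosses A B X (h P X)" using half_turn_crosses[OF endsD(4)[OF assms(1)] assms(3) d] ends_half_turn assms by metis
  show "\<not> ron (h P X) l" using assms ends_half_turn[OF assms(1,2)] endsD[OF assms(1)] half_turn_half_turn by metis
qed

lemma side_parity:
  assumes "ends l A B" "X \<in> rim" "\<not> ron X l" "Y \<in> rim" "\<not> ron Y l" "Z \<in> rim" "\<not> ron Z l"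
  shows "crosses A B X Z \<longleftrightarrow> (crosses A B X Y \<noteq> crosses A B Y Z)"
  using crosses_parity[of A X B Y Z] assms endsD[OF assms(1)] by metis

lemma side_meet:
  assumes "ends l A B" "crosses A B X Y" "X \<in> rim" "Y \<in> rim"
  obtains P where "inc P l" "h P X = Y"
proof -
  have "meets l (rjoin X Y)" "X \<noteq> Y" using assms(2) endsD(6)[OF assms(1)] unfolding crosses_def by auto
  then show thesis using that half_turn_iff assms(3,4) by (auto elim!: meetsE)
qed

lemma side_off:
  assumes "ends l A B" "crosses A B X Y" "X \<in> rim" "Y \<in> rim" shows "\<not> ron X l" "\<not> ron Y l"
  using crosses_distinct[OF assms(2) endsD(4)[OF assms(1)] assms(3) endsD(5)[OF assms(1)] assms(4)] endsD(7)[OF assms(1)] by metis+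

text \<open>The translation pushes \<open>X\<close> away from the end of \<open>QP\<close> and
  towards the end \<open>B\<close> of \<open>PQ\<close>. The line from \<open>h P X\<close> through
  \<open>Q\<close> shares an end with the line \<open>m\<close> from \<open>X\<close> to
  \<open>h P X\<close> and misses it, so the image lies on the side of \<open>m\<close> that
  contains \<open>Q\<close> and \<open>B\<close>.\<close>

lemma direction:
  assumes l: "P \<noteq> Q" "inc P l" "inc Q l" and X: "X \<in> rim" "\<not> ron X l"
  shows "crosses (rp Q P) (h Q (h P X)) X (rp P Q)"
proof -
  define A where "A = rp Q P"
  define B where "B = rp P Q"
  have e: "ends l A B" unfolding A_def B_def by (rule ends_points[OF l])
  note E = endsD[OF e]
  define Y where "Y = h P X"
  define Z where "Z = h Q Y"
  have Y: "Y \<in> rim" "\<not> ron Y l" "crosses A B X Y" using half_turn_rim half_turn_side[OF e l(2) X] X Y_def by auto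
  have Z: "Z \<in> rim" "\<not> ron Z l" "crosses A B Y Z" using half_turn_rim half_turn_side[OF e l(3) Y(1,2)] Y Z_def by auto
  have d: "X \<noteq> Y" "Y \<noteq> Z" using half_turn_rim X Y Y_def Z_def by metis+
  have ZX: "Z \<noteq> X" using half_turn_unique[OF X(1), of P Q l] l X Z_def Y_def half_turn_half_turn by metis
  define m where "m = rjoin X Y"
  have m: "inc P m" "ron X m" "ron Y m" using half_turn_inc X m_def Y_def rjoin_on Y d by auto
  have Qm: "\<not> inc Q m" using m l X line_unique by metis
  have lPQ: "ln P Q = l" using ln_eq l by metis
  have lm: "l \<noteq> m" using m X by blast
  have "tow m Q B \<longleftrightarrow> opp m Q Q" using tow_meet[of P m Q Q] m l lPQ lm B_def by metis
  then have t1: "\<not> tow m Q B" using ss_refl Qm ss_not_opp by blast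
  have "\<not> meets (rjoin Y Z) m" using ron_disjoint rjoin_on Y Z d m by metis
  then have t2: "\<not> tow m Q Z" using tow_miss[of Z "rjoin Y Z" Q m] rjoin_on Y Z d half_turn_inc Qm Z_def by metis
  have AB: "B \<noteq> X" "B \<noteq> Y" "B \<noteq> Z" "A \<noteq> X" "A \<noteq> Y" "A \<noteq> Z" using E X Y Z by metis+
  have n: "\<not> crosses X Y Z B"
    using crosses_tow[OF X(1) Z(1) Y(1) E(5), of Q] d ZX AB Qm t1 t2 m_def by metis
  define F where "F = {A, B, X, Y, Z}"
  have F: "finite F" "F \<subseteq> rim" "A \<in> F" unfolding F_def using E X Y Z by auto
  have mem: "A \<in> F" "B \<in> F" "X \<in> F" "Y \<in> F" "Z \<in> F" unfolding F_def by auto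
  obtain f :: "_ \<Rightarrow> int" where f: "inj_on f F" "\<And>x. x \<in> F \<Longrightarrow> x \<noteq> A \<Longrightarrow> f A < f x"
    "\<And>A B C D. A \<in> F \<Longrightarrow> B \<in> F \<Longrightarrow> C \<in> F \<Longrightarrow> D \<in> F \<Longrightarrow> crosses A C B D \<longleftrightarrow> ilv (f A) (f C) (f B) (f D)"
    using circle[OF F] by metis
  have ne: "f x \<noteq> f y" if "x \<in> F" "y \<in> F" "x \<noteq> y" for x y using f(1) that unfolding inj_on_def by blast
  have "f A < f B" "f A < f X" "f A < f Y" "f A < f Z" using f(2) mem AB E(1) by metis+
  moreover have "f X \<noteq> f Y" "f Y \<noteq> f Z" "f Z \<noteq> f X" "f B \<noteq> f X" "f B \<noteq> f Y" "f B \<noteq> f Z" using ne mem d ZX AB by metis+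
  moreover have "ilv (f A) (f B) (f X) (f Y)" "ilv (f A) (f B) (f Y) (f Z)" "\<not> ilv (f X) (f Y) (f Z) (f B)"
    using f(3) mem Y Z n by blast+
  ultimately have "ilv (f A) (f Z) (f X) (f B)" unfolding ilv_def by smt
  then have "crosses A Z X B" using f(3) mem by blast
  then show ?thesis unfolding A_def B_def Y_def Z_def .
qed

lemma no_fixed_point:
  assumes "P \<noteq> Q" "inc P l" "inc Q l" "X \<in> rim" "\<not> ron X l" shows "h Q (h P X) \<noteq> X"
  using half_turn_unique[OF assms(4), of P Q l] assms half_turn_half_turn by metis

lemma circle_order:
  assumes A: "A \<in> rim" "B \<in> rim" "A \<noteq> B" and r: "X \<in> rim" "X' \<in> rim" "Y \<in> rim" "Y' \<in> rim"
    and c: "crosses A X' X B" "crosses A Y' Y B" "crosses A B X Y"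
  shows "crosses X Y' Y X'"
proof -
  define F where "F = {A, B, X, X', Y, Y'}"
  have F: "finite F" "F \<subseteq> rim" "A \<in> F" unfolding F_def using A r by auto
  have mem: "A \<in> F" "B \<in> F" "X \<in> F" "X' \<in> F" "Y \<in> F" "Y' \<in> F" unfolding F_def by auto
  obtain f :: "_ \<Rightarrow> int" where f: "inj_on f F" "\<And>x. x \<in> F \<Longrightarrow> x \<noteq> A \<Longrightarrow> f A < f x"
    "\<And>A B C D. A \<in> F \<Longrightarrow> B \<in> F \<Longrightarrow> C \<in> F \<Longrightarrow> D \<in> F \<Longrightarrow> crosses A C B D \<longleftrightarrow> ilv (f A) (f C) (f B) (f D)"
    using circle[OF F] by metis
  note d = crosses_distinct[OF c(1) A(1) r(1,2) A(2)] crosses_distinct[OF c(2) A(1) r(3,4) A(2)]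
  have "f A < f B" "f A < f X" "f A < f X'" "f A < f Y" "f A < f Y'" using f(2) mem A(3) d by metis+
  moreover have "ilv (f A) (f X') (f X) (f B)" "ilv (f A) (f Y') (f Y) (f B)" "ilv (f A) (f B) (f X) (f Y)"
    using f(3) mem c by blast+
  ultimately have "ilv (f X) (f Y') (f Y) (f X')" unfolding ilv_def by smt
  then show "crosses X Y' Y X'" using f(3) mem by blast
qed

end

locale oval_plane = ordered_plane +
  assumes ax7: A7 and ax10: A10 and ax11: A11
begin

text \<open>
  Pascal for the hexagon \<open>X, X\<^sup>P, X\<^sup>P\<^sup>Q, Y, Y\<^sup>P, Y\<^sup>P\<^sup>Q\<close>; when two opposite sides of it coincide, the meeting point is \<open>P\<close> or \<open>Q\<close>.
\<close>

lemma axial: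
  assumes e: "ends l A B" and l: "P \<noteq> Q" "inc P l" "inc Q l" and X: "X \<in> rim" "Y \<in> rim" "crosses A B X Y"
  obtains Z where "inc Z l" "h Z X = h Q (h P Y)" "h Z Y = h Q (h P X)" "crosses X (h Q (h P Y)) Y (h Q (h P X))"
proof -
  note E = endsD[OF e]
  have off: "\<not> ron X l" "\<not> ron Y l" using side_off[OF e X(3,1,2)] by auto
  define X' where "X' = h Q (h P X)"
  define Y' where "Y' = h Q (h P Y)"
  have r: "X' \<in> rim" "Y' \<in> rim" "h P X \<in> rim" "h P Y \<in> rim" using half_turn_rim X X'_def Y'_def by auto
  have "crosses (rp Q P) X' X (rp P Q)" "crosses (rp Q P) Y' Y (rp P Q)"
    using direction l X off X'_def Y'_def by auto
  moreover have "crosses (rp Q P) (rp P Q) X Y"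
    using ends_unique[OF e ends_points[OF l]] X(3) crosses_sym(1)[of A B X Y] by metis
  moreover have "rp Q P \<in> rim" "rp P Q \<in> rim" "rp Q P \<noteq> rp P Q" using endsD[OF ends_points[OF l]] by auto
  ultimately have c: "crosses X Y' Y X'" using circle_order[of "rp Q P" "rp P Q" X X' Y Y'] X(1,2) r(1,2) by blast
  note d = crosses_distinct[OF c X(1,2) r(2,1)]
  obtain Z where Z: "inc Z (rjoin X Y')" "inc Z (rjoin Y X')" "rjoin X Y' \<noteq> rjoin Y X'" using c unfolding crosses_def by (auto elim: meetsE)
  have hZ: "h Z X = Y'" "h Z Y = X'" using half_turn_iff X r d Z by metis+
  have n: "X \<noteq> h P X" "h P X \<noteq> X'" "Y \<noteq> h P Y" "h P Y \<noteq> Y'" using half_turn_rim X r X'_def Y'_def by metis+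
  have XY: "X \<noteq> Y" using X(3) unfolding crosses_def by blast
  have "inc Z l"
  proof (cases "rjoin X (h P X) = rjoin Y (h P Y) \<or> rjoin (h P X) X' = rjoin (h P Y) Y'")
    case True
    have "Y = h P X" if "rjoin X (h P X) = rjoin Y (h P Y)"
      using that rims_rjoin[OF X(1) r(3) n(1), of Y] rjoin_on[OF X(2) r(4) n(3)] XY by metis
    moreover have "h P Y = X'" if "rjoin (h P X) X' = rjoin (h P Y) Y'"
      using that rims_rjoin[OF r(3,1) n(2), of "h P Y"] rjoin_on[OF r(4,2) n(4)] XY half_turn_half_turn[of P] by metis
    ultimately consider "Y = h P X" | "h P Y = X'" using True by blast
    then show ?thesis
    proof cases
      case 1
      then have "X' = h Q Y" "Y' = h Q X" using X'_def Y'_def by auto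
      then have "inc Q (rjoin X Y')" "inc Q (rjoin Y X')" using half_turn_inc X by auto
      then show ?thesis using Z meet_unique l by metis
    next
      case 2
      then have "Y' = h P X" "X' = h P Y" using X'_def Y'_def half_turn_half_turn by metis+
      then have "inc P (rjoin X Y')" "inc P (rjoin Y X')" using half_turn_inc X by auto
      then show ?thesis using Z meet_unique l by metis
    qed
  next
    case False
    have P: "meet_at (rjoin X (h P X)) (rjoin Y (h P Y)) P" unfolding meet_at_def using False half_turn_inc X by auto
    have Q: "meet_at (rjoin (h P X) X') (rjoin (h P Y) Y') Q"
      unfolding meet_at_def using False half_turn_inc r X'_def Y'_def by auto
    have R: "meet_at (rjoin X' Y) (rjoin Y' X) Z" unfolding meet_at_def using Z rjoin_sym by metis
    have "collinear {P, Q, Z}"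
      using ax7 X r n d P Q R unfolding A7_def by metis
    then show ?thesis using l line_unique unfolding collinear_def by (metis insertCI)
  qed
  then show thesis using that hZ c unfolding X'_def Y'_def by blast
qed

section \<open>Translations along a line\<close>

lemma half_turn_cancel: "h P X = h P Y \<longleftrightarrow> X = Y"
  using half_turn_half_turn by metis

text \<open>For \<open>Y\<close> across \<open>l\<close> from \<open>X\<close>, \<open>axial\<close>
  writes the image of \<open>Y\<close> as \<open>h Z X\<close>, where \<open>Z\<close> on
  \<open>l\<close> is determined by the image of \<open>X\<close>, which is \<open>h Z Y\<close>.
  Ends on the side of \<open>X\<close> are reached by way of \<open>h P X\<close>.\<close>

lemma translation_unique:
  assumes l: "inc P l" "inc Q l" "inc R l" "inc S l" and X: "X \<in> rim" "\<not> ron X l" and eq: "h Q (h P X) = h R (h S X)"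
  shows "h Q (h P Z) = h R (h S Z)"
proof (cases "P = Q")
  case True
  then have "S = R" using eq no_fixed_point[OF _ l(4,3) X] by auto
  then show ?thesis using True by simp
next
  case PQ: False
  then have SR: "S \<noteq> R" using eq no_fixed_point[OF _ l(1,2) X] by auto
  obtain A B where e: "ends l A B" by (rule ends_ex)
  note E = endsD[OF e]
  have step: "h Q (h P Y) = h R (h S Y)"
    if X: "X \<in> rim" and Y: "Y \<in> rim" and c: "crosses A B X Y" and eq: "h Q (h P X) = h R (h S X)" for X Y
  proof -
    have off: "\<not> ron Y l" using side_off[OF e c X Y] by blast
    obtain Z where Z: "inc Z l" "h Z X = h Q (h P Y)" "h Z Y = h Q (h P X)"
      using axial[OF e PQ l(1,2) X Y c] by metis
    obtain W where W: "inc W l" "h W X = h R (h S Y)" "h W Y = h R (h S X)"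
      using axial[OF e SR l(4,3) X Y c] by metis
    have "Z = W" using half_turn_unique[OF Y, of Z W l] off Z W eq by metis
    then show ?thesis using Z W by metis
  qed
  have PX: "h P X \<in> rim" "\<not> ron (h P X) l" "crosses A B X (h P X)"
    using half_turn_rim half_turn_side[OF e l(1) X] X by auto
  have eq': "h Q (h P (h P X)) = h R (h S (h P X))" using step[OF X(1) PX(1,3) eq] .
  consider "Z \<notin> rim" | "Z \<in> rim" "ron Z l" | "Z \<in> rim" "\<not> ron Z l" by blast
  then show ?thesis
  proof cases
    case 1 then show ?thesis by (simp add: half_turn_off)
  next
    case 2 then show ?thesis using E(7) ends_half_turn[OF e] l by metis
  next
    case 3
    then have "crosses A B X Z \<or> crosses A B (h P X) Z" using side_parity[OF e X PX(1,2) 3] PX(3) by blast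
    then show ?thesis using step[OF X(1) 3(1) _ eq] step[OF PX(1) 3(1) _ eq'] by blast
  qed
qed

text \<open>Three half-turns take an end off \<open>l\<close> to the other side of \<open>l\<close>,
  which supplies \<open>S\<close>; agreement at that end is enough by
  \<open>translation_unique\<close>.\<close>

lemma half_turns_product:
  assumes l: "inc P l" "inc Q l" "inc R l" obtains S where "inc S l" "\<And>X. h R (h Q (h P X)) = h S X"
proof -
  obtain A B where e: "ends l A B" by (rule ends_ex)
  obtain X where X: "X \<in> rim" "\<not> ron X l" using off_rim[OF e] by metis
  define X1 where "X1 = h P X"
  define X2 where "X2 = h Q X1"
  define Y where "Y = h R X2"
  have X1: "X1 \<in> rim" "\<not> ron X1 l" "crosses A B X X1" using half_turn_rim half_turn_side[OF e l(1) X] X X1_def by auto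
  have X2: "X2 \<in> rim" "\<not> ron X2 l" "crosses A B X1 X2" using half_turn_rim half_turn_side[OF e l(2) X1(1,2)] X1 X2_def by auto
  have Y: "Y \<in> rim" "\<not> ron Y l" "crosses A B X2 Y" using half_turn_rim half_turn_side[OF e l(3) X2(1,2)] X2 Y_def by auto
  have "crosses A B X Y" using side_parity[OF e X X1(1,2) X2(1,2)] side_parity[OF e X X2(1,2) Y(1,2)] X1 X2 Y by blast
  then obtain S where S: "inc S l" "h S X = Y" using side_meet[OF e] X Y by metis
  have "h Q (h P X) = h R (h S X)" using S Y_def X2_def X1_def by simp
  then have "h Q (h P Z) = h R (h S Z)" for Z using translation_unique[OF l S(1) X] by blast
  then have "h R (h Q (h P Z)) = h S Z" for Z by simp
  then show thesis using that S by blast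
qed

text \<open>The lines \<open>a\<close> and \<open>b\<close> of (A10) join the ends of
  \<open>l\<close> to those of \<open>m\<close>. The half-turn about their common point
  \<open>M\<close> therefore exchanges the two pairs and conjugates the half-turn about
  \<open>P\<close> to that about \<open>Q\<close>.\<close>

lemma midpoint:
  assumes "P \<noteq> Q" obtains M where "inc M (ln P Q)" "\<And>X. h M (h P (h M X)) = h Q X"
proof -
  define k where "k = ln P Q"
  have k: "inc P k" "inc Q k" using ln_inc assms k_def by auto
  have "join (Fin P) (Fin Q) = k" unfolding join_def on.simps(1) k_def ln_def ..
  then obtain l m where lm: "inc P l" "inc Q m" "common_parallels_meet_on l m k"
    using ax10 assms unfolding A10_def by metis
  then obtain a b M where ab: "parallel a l" "parallel a m" "parallel b l" "parallel b m" "a \<noteq> b" "inc M a" "inc M b" "inc M k"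
    unfolding common_parallels_meet_on_def meet_at_def by blast
  have meet: "meets a b" using ab meetsI by blast
  obtain E1 where E1: "ron E1 a" "ron E1 l" using ab(1) parallel_ron by blast
  obtain F1 where F1: "ron F1 a" "ron F1 m" using ab(2) parallel_ron by blast
  obtain E2 where E2: "ron E2 b" "ron E2 l" using ab(3) parallel_ron by blast
  obtain F2 where F2: "ron F2 b" "ron F2 m" using ab(4) parallel_ron by blast
  have d: "E1 \<noteq> E2" "F1 \<noteq> F2" "E1 \<noteq> F2" "F1 \<noteq> E2" using ron_disjoint meet E1 E2 F1 F2 by metis+
  have ne: "a \<noteq> l" "b \<noteq> l" "a \<noteq> m" "b \<noteq> m" using ab parallel_ron by blast+
  have ak: "n = k \<Longrightarrow> ron X n \<Longrightarrow> \<not> ron X a \<or> a = k" for n X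
    using ron_disjoint[of X k a] ab meetsI[of M k a] by metis
  have lk: "l \<noteq> k" "m \<noteq> k" using ak E1 F1 ne by metis+
  have eP: "h P E1 = E2" "h Q F1 = F2" using half_turn_eq d E1 E2 F1 F2 lm by metis+
  have E1k: "\<not> ron E1 k" "\<not> ron E2 k" "\<not> ron F1 k" "\<not> ron F2 k"
    using ron_disjoint[of _ k l] ron_disjoint[of _ k m] meetsI[of P k l] meetsI[of Q k m] k lm lk E1 E2 F1 F2 by metis+
  obtain A B where e: "ends k A B" by (rule ends_ex)
  have r: "E1 \<in> rim" "E2 \<in> rim" "F1 \<in> rim" "F2 \<in> rim" using E1 E2 F1 F2 ron_rim by blast+
  have side: "crosses A B E1 E2" "crosses A B F1 F2"
    using half_turn_side[OF e k(1) r(1)] half_turn_side[OF e k(2) r(3)] E1k eP by auto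
  have cut: "crosses A B X Y" if "X \<noteq> Y" "ron X c" "ron Y c" "inc M c" "\<not> ron X k" for X Y c
  proof -
    have "h M X = Y" using half_turn_eq that by metis
    then show ?thesis using half_turn_side[OF e ab(8) ron_rim[OF that(2)] that(5)] by simp
  qed
  \<comment> \<open>If \<open>a\<close> met \<open>l\<close> and \<open>m\<close> in the same end
    \<open>E1\<close>, the three ends \<open>E1\<close>, \<open>E2\<close>, \<open>F2\<close> would
    lie pairwise on different sides of \<open>k\<close>.\<close>
  have EF: "E1 \<noteq> F1" "E2 \<noteq> F2"
  proof -
    show "E1 \<noteq> F1"
    proof
      assume "E1 = F1"
      then have "E2 \<noteq> F2" using eP half_turn_unique[OF r(1), of P Q k] assms k E1k by metis
      then have "crosses A B E2 F2" using cut E2 F2 ab E1k by blast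
      then show False using side_parity[OF e r(2) E1k(2) r(1) E1k(1) r(4) E1k(4)] side \<open>E1 = F1\<close> crosses_sym by metis
    qed
    show "E2 \<noteq> F2"
    proof
      assume "E2 = F2"
      then have "E1 \<noteq> F1" using eP half_turn_unique[OF r(2), of P Q k] assms k E1k half_turn_half_turn by metis
      then have "crosses A B E1 F1" using cut E1 F1 ab E1k by blast
      then show False using side_parity[OF e r(1) E1k(1) r(2) E1k(2) r(3) E1k(3)] side \<open>E2 = F2\<close> crosses_sym by metis
    qed
  qed
  have M: "h M E1 = F1" "h M F2 = E2" using half_turn_eq EF E1 F1 E2 F2 ab by metis+
  obtain T where T: "inc T k" "\<And>X. h M (h Q (h M X)) = h T X" using half_turns_product[OF ab(8) k(2) ab(8)] by metis
  have "h T E1 = h P E1" using T(2)[of E1] M eP by simp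
  then have "T = P" using half_turn_unique[OF r(1), of T P k] E1k T k by metis
  then have "h M (h P (h M X)) = h Q X" for X using T(2)[of "h M X"] half_turn_half_turn by metis
  then show thesis using that ab k_def by metis
qed

end

section \<open>Reflections\<close>

context incidence
begin

text \<open>
  The half-turn about \<open>P\<close> takes the ends of \<open>l\<close> to \<open>U\<close> and \<open>V\<close>, that is, \<open>P\<close> is the intersection
  point \<open>l \<bowtie> UV\<close>; and \<open>foot\<close> is the relation between \<open>X\<close> and the point \<open>R\<close> of (A11).
\<close>

definition sw :: "'l \<Rightarrow> 'p \<Rightarrow> 'l rimpoint \<Rightarrow> 'l rimpoint \<Rightarrow> bool" where
  "sw l P U V \<longleftrightarrow> half_turn P ` rims_of l = {U, V}"

definition foot :: "'l \<Rightarrow> 'p \<Rightarrow> 'l rimpoint \<Rightarrow> bool" where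
  "foot l R X \<longleftrightarrow> inc R l \<and> (\<forall>S. inc S l \<and> S \<noteq> R \<longrightarrow>
     (\<exists>P. half_turn P X = half_turn R X \<and>
          sw l P (half_turn R (half_turn S X)) (half_turn S (half_turn R X))))"

end

context oval_plane
begin

section \<open>The foot of an end on a line\<close>

lemma sw_iff: assumes "ends l A B"
  shows "sw l P U V \<longleftrightarrow> h P A = U \<and> h P B = V \<or> h P A = V \<and> h P B = U"
  unfolding sw_def ends_rims[OF assms] by (simp add: doubleton_eq_iff)

lemma sw_sym: "sw l P U V \<longleftrightarrow> sw l P V U"
  unfolding sw_def by (simp add: insert_commute)

text \<open>If the half-turns about different points agreed at both ends of \<open>l\<close>, the
  line \<open>PQ\<close> would have the ends \<open>A\<close>, \<open>B\<close> and
  \<open>U\<close>. If they took the ends to \<open>U\<close> and \<open>V\<close> in different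
  ways, both \<open>AU // BV\<close> and \<open>AV // BU\<close> would hold, which exclude each
  other.\<close>

lemma sw_unique:
  assumes s: "sw l P U V" "sw l Q U V" and o: "\<not> ron U l" "\<not> ron V l" shows "P = Q"
proof -
  obtain A B where e: "ends l A B" by (rule ends_ex)
  note E = endsD[OF e]
  have *: "P = Q" if c: "h P A = U" "h P B = V" and s: "sw l Q U V" and o: "\<not> ron U l" "\<not> ron V l" for P Q U V
  proof (rule ccontr)
    assume n: "P \<noteq> Q"
    have r: "U \<in> rim" "V \<in> rim" using c half_turn_rim E by metis+
    have d: "U \<noteq> A" "U \<noteq> B" "V \<noteq> A" "V \<noteq> B" using o E by metis+
    consider "h Q A = U" "h Q B = V" | "h Q A = V" "h Q B = U" using s sw_iff[OF e] by blast
    then show False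
    proof cases
      case 1
      note k = ln_inc[OF n]
      have "ron A (ln P Q)" "ron U (ln P Q)" "ron B (ln P Q)"
        using half_turn_unique[OF E(4), of P Q "ln P Q"] half_turn_unique[OF E(5), of P Q "ln P Q"] 1 c n k by auto
      then show False using d E rjoin_eq by metis
    next
      case 2
      have "crosses A U B V" using half_turn_crosses[OF E(4,5), of P] E(1) d c by metis
      then have "crosses A U V B" using crosses_sym by metis
      then have "\<not> crosses A V U B" using crosses_exclusive E r by metis
      moreover have "crosses A V B U" using half_turn_crosses[OF E(4,5), of Q] E(1) d 2 by metis
      ultimately show False using crosses_sym by metis
    qed
  qed
  have "(h P A = U \<and> h P B = V) \<or> (h P A = V \<and> h P B = U)" using s(1) sw_iff[OF e] by blast
  then show ?thesis using *[of P U V Q] *[of P V U Q] s(2) o sw_sym by metis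
qed

lemma translation_side:
  assumes l: "inc P l" "inc Q l" and X: "X \<in> rim" "\<not> ron X l"
  shows "h Q (h P X) \<in> rim" "\<not> ron (h Q (h P X)) l" "ends l A B \<Longrightarrow> \<not> crosses A B X (h Q (h P X))"
proof -
  obtain A B where e: "ends l A B" by (rule ends_ex)
  have 1: "h P X \<in> rim" "\<not> ron (h P X) l" using half_turn_side[OF e l(1) X] half_turn_rim X by auto
  show 2: "h Q (h P X) \<in> rim" "\<not> ron (h Q (h P X)) l" using half_turn_side[OF e l(2) 1] half_turn_rim 1 by auto
  show "\<not> crosses A B X (h Q (h P X))" if e: "ends l A B" for A B
    using side_parity[OF e X 1 2] half_turn_side[OF e l(1) X] half_turn_side[OF e l(2) 1] by blast
qed

lemma translation_order:
  assumes l: "P \<noteq> Q" "inc P l" "inc Q l" and X: "X \<in> rim" "\<not> ron X l"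
  shows "crosses (rp Q P) (h Q (h P X)) (h P (h Q X)) (rp P Q)"
proof -
  define A where "A = rp Q P"
  define B where "B = rp P Q"
  define U where "U = h Q (h P X)"
  define V where "V = h P (h Q X)"
  have e: "ends l A B" unfolding A_def B_def by (rule ends_points[OF l])
  note E = endsD[OF e]
  have r: "U \<in> rim" "V \<in> rim" "\<not> ron U l" "\<not> ron V l" using translation_side l X U_def V_def by metis+
  have c: "crosses A U X B" "crosses B V X A" using direction[OF l X] direction[of Q P l X] l X A_def B_def U_def V_def by auto
  define F where "F = {A, B, X, U, V}"
  have F: "finite F" "F \<subseteq> rim" "A \<in> F" unfolding F_def using E r X by auto
  have mem: "A \<in> F" "B \<in> F" "X \<in> F" "U \<in> F" "V \<in> F" unfolding F_def by auto
  obtain f :: "_ \<Rightarrow> int" where f: "inj_on f F" "\<And>x. x \<in> F \<Longrightarrow> x \<noteq> A \<Longrightarrow> f A < f x"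
    "\<And>A B C D. A \<in> F \<Longrightarrow> B \<in> F \<Longrightarrow> C \<in> F \<Longrightarrow> D \<in> F \<Longrightarrow> crosses A C B D \<longleftrightarrow> ilv (f A) (f C) (f B) (f D)"
    using circle[OF F] by metis
  have "f A < f B" "f A < f X" "f A < f U" "f A < f V" using f(2) mem E r X by metis+
  moreover have "ilv (f A) (f U) (f X) (f B)" "ilv (f B) (f V) (f X) (f A)" using f(3) mem c by blast+
  ultimately have "ilv (f A) (f U) (f V) (f B)" unfolding ilv_def by smt
  then have "crosses A U V B" using f(3) mem by blast
  then show ?thesis unfolding A_def B_def U_def V_def .
qed

text \<open>With \<open>A\<close>, \<open>B\<close> the ends of \<open>l\<close> and
  \<open>U\<close>, \<open>V\<close> the two images of \<open>X\<close>, the lines \<open>AU\<close>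
  and \<open>VB\<close> cross by \<open>translation_order\<close>; their common point is the one
  used in the definition of the reflection.\<close>

lemma sw_ex:
  assumes l: "P \<noteq> Q" "inc P l" "inc Q l" and X: "X \<in> rim" "\<not> ron X l"
  obtains R where "h R (rp Q P) = h Q (h P X)" "h R (rp P Q) = h P (h Q X)" "sw l R (h Q (h P X)) (h P (h Q X))"
proof -
  define A where "A = rp Q P"
  define B where "B = rp P Q"
  define U where "U = h Q (h P X)"
  define V where "V = h P (h Q X)"
  have e: "ends l A B" unfolding A_def B_def by (rule ends_points[OF l])
  note E = endsD[OF e]
  have r: "U \<in> rim" "V \<in> rim" using translation_side l X U_def V_def by metis+
  have c: "crosses A U V B" using translation_order[OF assms] A_def B_def U_def V_def by simp
  then obtain R where R: "inc R (rjoin A U)" "inc R (rjoin V B)" unfolding crosses_def by (auto elim: meetsE)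
  have d: "A \<noteq> U" "B \<noteq> V" using crosses_distinct[OF c E(4) r(2,1) E(5)] by auto
  have "h R A = U" "h R B = V" using half_turn_iff E r R d rjoin_sym by metis+
  then show thesis using that sw_iff[OF e] A_def B_def U_def V_def by metis
qed

lemma bowtie_eq:
  assumes n: "ends n U V" and s: "sw l P U V" and o: "\<not> ron U l" "\<not> ron V l"
  shows "bowtie l n = P"
proof -
  obtain A B where AB: "ends l A B" "h P A = U" "h P B = V"
  proof -
    obtain A B where e: "ends l A B" by (rule ends_ex)
    then show thesis using that[of A B] that[of B A] s sw_iff[OF e] ends_sym by metis
  qed
  note E = endsD[OF AB(1)] and N = endsD[OF n]
  have d: "A \<noteq> U" "A \<noteq> V" "B \<noteq> U" "B \<noteq> V" using o E by metis+
  show ?thesis unfolding bowtie_def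
  proof (rule the_equality)
    have "crosses A U B V" using half_turn_crosses[OF E(4,5), of P] E(1) d AB by metis
    moreover have "meet_at (rjoin A U) (rjoin B V) P"
      using calculation half_turn_inc[OF E(4), of P] half_turn_inc[OF E(5), of P] AB unfolding meet_at_def crosses_def meets_def by metis
    moreover have "l \<noteq> n" using o N by blast
    moreover have "\<not> parallel l n" using parallel_ron N(7) o by metis
    moreover have "rims_of l = {A, B}" "rims_of n = {V, U}" using ends_rims[OF AB(1)] ends_rims[OF n] by (auto simp: insert_commute)
    ultimately show "\<exists>L1 L2 M1 M2. l \<noteq> n \<and> \<not> parallel l n \<and> rims_of l = {L1, L2} \<and> rims_of n = {M1, M2} \<and>
      crosses L1 M2 L2 M1 \<and> meet_at (rjoin L1 M2) (rjoin L2 M1) P" by blast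
  next
    fix Q assume "\<exists>L1 L2 M1 M2. l \<noteq> n \<and> \<not> parallel l n \<and> rims_of l = {L1, L2} \<and> rims_of n = {M1, M2} \<and>
      crosses L1 M2 L2 M1 \<and> meet_at (rjoin L1 M2) (rjoin L2 M1) Q"
    then obtain L1 L2 M1 M2 where q: "rims_of l = {L1, L2}" "rims_of n = {M1, M2}" "crosses L1 M2 L2 M1"
      "inc Q (rjoin L1 M2)" "inc Q (rjoin L2 M1)" unfolding meet_at_def by blast
    have "L1 = A \<and> L2 = B \<or> L1 = B \<and> L2 = A" "M1 = U \<and> M2 = V \<or> M1 = V \<and> M2 = U"
      using q(1,2) ends_rims[OF AB(1)] ends_rims[OF n] by (auto simp: doubleton_eq_iff)
    moreover have "L1 \<noteq> M2" "L2 \<noteq> M1" using q(3) unfolding crosses_def by auto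
    ultimately have "sw l Q U V" using half_turn_iff[of _ _ Q] sw_iff[OF AB(1)] q E N by metis
    then show "Q = P" using sw_unique s o by blast
  qed
qed

text \<open>A common parallel of \<open>l\<close> and \<open>n\<close> joins an end of one to an end
  of the other. Two of them through \<open>P\<close> thus record how the half-turn about
  \<open>P\<close> maps the ends of \<open>l\<close> onto those of \<open>n\<close>.\<close>

lemma common_parallels_sw:
  assumes n: "ends n U V" and o: "\<not> ron U l" "\<not> ron V l"
  shows "common_parallels_meet_on l n k \<longleftrightarrow> (\<exists>P. inc P k \<and> sw l P U V)"
proof -
  obtain A B where e: "ends l A B" by (rule ends_ex)
  note E = endsD[OF e] and N = endsD[OF n]
  have d: "A \<noteq> U" "A \<noteq> V" "B \<noteq> U" "B \<noteq> V" using o E by metis+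
  show ?thesis
  proof
    assume "common_parallels_meet_on l n k"
    then obtain a b P where ab: "parallel a l" "parallel a n" "parallel b l" "parallel b n" "meet_at a b P" "inc P k"
      unfolding common_parallels_meet_on_def by blast
    then have P: "inc P a" "inc P b" "meets a b" unfolding meet_at_def using meetsI by auto
    obtain E1 where E1: "ron E1 a" "E1 = A \<or> E1 = B" using ab(1) parallel_ron E(7) by metis
    obtain F1 where F1: "ron F1 a" "F1 = U \<or> F1 = V" using ab(2) parallel_ron N(7) by metis
    obtain E2 where E2: "ron E2 b" "E2 = A \<or> E2 = B" using ab(3) parallel_ron E(7) by metis
    obtain F2 where F2: "ron F2 b" "F2 = U \<or> F2 = V" using ab(4) parallel_ron N(7) by metis
    have "E1 \<noteq> E2" "F1 \<noteq> F2" using ron_disjoint P(3) E1 E2 F1 F2 by metis+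
    moreover have "h P E1 = F1" "h P E2 = F2" using half_turn_eq E1 E2 F1 F2 P d by metis+
    ultimately have "sw l P U V" using sw_iff[OF e] E1 E2 F1 F2 by metis
    then show "\<exists>P. inc P k \<and> sw l P U V" using ab by blast
  next
    assume "\<exists>P. inc P k \<and> sw l P U V"
    then obtain P where P: "inc P k" "sw l P U V" by blast
    have *: "parallel (rjoin A (h P A)) l \<and> parallel (rjoin A (h P A)) n" if "ends l A B" "h P A = U \<or> h P A = V" for A B
    proof -
      note E = endsD[OF that(1)]
      have "A \<noteq> h P A" using that o E by metis
      then have "ron A (rjoin A (h P A))" "ron (h P A) (rjoin A (h P A))" using rjoin_on E half_turn_rim by metis+
      moreover have "\<not> ron A n" using N(7) E(2) o by metis
      moreover have "\<not> ron (h P A) l" "ron (h P A) n" using that(2) o N by metis+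
      ultimately show ?thesis using parallel_ron E by metis
    qed
    have i: "h P A = U \<or> h P A = V" "h P B = U \<or> h P B = V" using P sw_iff[OF e] by blast+
    have "B \<noteq> h P A" using i d by metis
    then have "crosses A (h P A) B (h P B)" using half_turn_crosses[OF E(4,5)] E(1) by metis
    then have "meet_at (rjoin A (h P A)) (rjoin B (h P B)) P"
      using half_turn_inc E unfolding meet_at_def crosses_def meets_def by metis
    then show "common_parallels_meet_on l n k"
      unfolding common_parallels_meet_on_def using *[OF e i(1)] *[OF e[unfolded ends_sym[of l A B]] i(2)] P by blast
  qed
qed

lemma join_half_turn: assumes "X \<in> rim" shows "join (Rim X) (Fin P) = rjoin X (h P X)"
proof -
  have r: "h P X \<in> rim" "X \<noteq> h P X" using half_turn_rim assms by metis+
  show ?thesis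
    unfolding join_def[of "Rim X" "Fin P"] on.simps(1) ron_def[symmetric]
    using ron_point[OF assms, of P] half_turn_inc[OF assms] rjoin_on[OF assms r] by (intro the_equality) blast+
qed

text \<open>(A11) in terms of half-turns: that the parallels meet in a point \<open>P\<close> of the
  line from \<open>X\<close> through \<open>R\<close> becomes \<open>h P X = h R X\<close>.\<close>

lemma foot_unique: assumes X: "X \<in> rim" "\<not> ron X l" shows "\<exists>!R. foot l R X"
proof -
  have "(inc R l \<and> (\<forall>S. inc S l \<and> S \<noteq> R \<longrightarrow> common_parallels_meet_on l
          (rjoin (h R (h S X)) (h S (h R X))) (join (Rim X) (Fin R)))) \<longleftrightarrow> foot l R X" for R
  proof -
    have "common_parallels_meet_on l (rjoin (h R (h S X)) (h S (h R X))) (join (Rim X) (Fin R)) \<longleftrightarrow>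
        (\<exists>P. h P X = h R X \<and> sw l P (h R (h S X)) (h S (h R X)))" if S: "inc R l" "inc S l" "S \<noteq> R" for S
    proof -
      define U where "U = h R (h S X)"
      define V where "V = h S (h R X)"
      have r: "U \<in> rim" "V \<in> rim" "\<not> ron U l" "\<not> ron V l" using translation_side S X U_def V_def by metis+
      have "rp R S \<in> rim" "rp S R \<in> rim" using rp_rim S by metis+
      then have "U \<noteq> V"
        using crosses_distinct(5)[OF translation_order[OF S(3,2,1) X]] r unfolding U_def V_def by blast
      then have "ends (rjoin U V) U V" unfolding ends_def using rjoin_on r by metis
      then have "common_parallels_meet_on l (rjoin U V) (join (Rim X) (Fin R)) \<longleftrightarrow> (\<exists>P. inc P (rjoin X (h R X)) \<and> sw l P U V)"
        using common_parallels_sw r join_half_turn[OF X(1)] by metis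
      also have "\<dots> \<longleftrightarrow> (\<exists>P. h P X = h R X \<and> sw l P U V)"
        using half_turn_iff[OF X(1) half_turn_rim(1)[OF X(1)]] half_turn_rim(2)[OF X(1)] by metis
      finally show ?thesis unfolding U_def V_def .
    qed
    then show ?thesis unfolding foot_def by blast
  qed
  moreover have "\<exists>!R. inc R l \<and> (\<forall>S. inc S l \<and> S \<noteq> R \<longrightarrow> common_parallels_meet_on l
          (rjoin (h R (h S X)) (h S (h R X))) (join (Rim X) (Fin R)))"
    using ax11 X unfolding A11_def ron_def by blast
  ultimately show ?thesis by simp
qed

text \<open>(A11) speaks of the products of \<open>S\<close> with the foot \<open>R\<close>. By
  \<open>half_turns_product\<close> every translation \<open>PQ\<close> along \<open>l\<close> is
  such a product, so all translations detect the same foot.\<close>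

lemma foot_half_turn_eq:
  assumes f: "foot l R X" and X: "X \<in> rim" "\<not> ron X l" and l: "P \<noteq> Q" "inc P l" "inc Q l"
    and s: "sw l T (h Q (h P X)) (h P (h Q X))"
  shows "h T X = h R X"
proof -
  have R: "inc R l" using f unfolding foot_def by blast
  obtain S where S: "inc S l" "\<And>X. h R (h Q (h P X)) = h S X" using half_turns_product[OF l(2,3) R] by metis
  have 1: "h Q (h P Z) = h R (h S Z)" for Z using S(2)[of Z] half_turn_half_turn by metis
  have 2: "h P (h Q Z) = h S (h R Z)" for Z using 1[of "h P (h Q Z)"] half_turn_half_turn by metis
  have "S \<noteq> R" using 1[of X] no_fixed_point[OF l X] by auto
  then obtain T' where T': "h T' X = h R X" "sw l T' (h R (h S X)) (h S (h R X))"
    using f S(1) unfolding foot_def by blast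
  then have "sw l T' (h Q (h P X)) (h P (h Q X))" using 1 2 by simp
  then have "T' = T" using sw_unique s translation_side(2) l X by metis
  then show ?thesis using T' by simp
qed

text \<open>As the foot exists and is unique, testing a single translation identifies it.\<close>

lemma footI:
  assumes X: "X \<in> rim" "\<not> ron X l" and R: "inc R l" and l: "P \<noteq> Q" "inc P l" "inc Q l"
    and s: "sw l T (h Q (h P X)) (h P (h Q X))" and T: "h T X = h R X"
  shows "foot l R X"
proof -
  obtain R' where R': "foot l R' X" using foot_unique[OF X] by blast
  then have "h R X = h R' X" using foot_half_turn_eq[OF R' X l s] T by simp
  then have "R = R'" using half_turn_unique[OF X(1), of R R' l] X R R' unfolding foot_def by metis
  then show ?thesis using R' by simp
qed

text \<open>The lines in the axial condition cross only for \<open>X\<close> and \<open>Y\<close> on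
  different sides of \<open>l\<close>, the case of \<open>axial\<close>: on one side of
  \<open>l\<close> the translation moves both ends in the same direction and keeps their
  order.\<close>

lemma translation_opa:
  assumes l: "P \<noteq> Q" "inc P l" "inc Q l"
  shows "order_preserving_axial (h Q \<circ> h P) l"
proof -
  define A where "A = rp Q P"
  define B where "B = rp P Q"
  have e: "ends l A B" unfolding A_def B_def by (rule ends_points[OF l])
  note E = endsD[OF e]
  define t where "t = h Q \<circ> h P"
  have tt: "t X = h Q (h P X)" for X unfolding t_def by simp
  have r: "t X \<in> rim" if "X \<in> rim" for X using half_turn_rim that tt by simp
  have fx: "t A = A" "t B = B" using ends_half_turn[OF e] l tt by auto
  obtain cyc where cyc: "rim_cyclic_order cyc" "compatible cyc" by (rule cyc_ex)
  have tc: "cyc (t X) (t Y) (t Z)" if "X \<in> rim" "Y \<in> rim" "Z \<in> rim" "cyc X Y Z" for X Y Z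
    unfolding tt
    using half_turn_cyc[OF cyc half_turn_rim(1)[OF that(1)] half_turn_rim(1)[OF that(2)] half_turn_rim(1)[OF that(3)]
        half_turn_cyc[OF cyc that]] .
  obtain X where X: "X \<in> rim" "\<not> ron X l" using off_rim[OF e] by metis
  have "t permutes rim" unfolding t_def using half_turn_permutes permutes_compose by blast
  moreover have "t \<noteq> id" using no_fixed_point[OF l X] tt[of X] by auto
  moreover have "\<exists>Z. meet_at (rjoin X (t Y)) (rjoin Y (t X)) Z \<and> inc Z l"
    if X: "X \<in> rim" "Y \<in> rim" and c: "crosses X (t Y) Y (t X)" for X Y
  proof -
    note d = crosses_distinct[OF c X r[OF X(2)] r[OF X(1)]]
    have off: "\<not> ron X l" "\<not> ron Y l" using d fx E(7) by metis+
    have "crosses A B X Y"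
    proof (rule ccontr)
      assume n: "\<not> crosses A B X Y"
      define X' where "X' = t X"
      define Y' where "Y' = t Y"
      have d: "crosses A X' X B" "crosses A Y' Y B"
        using direction[OF l] X off unfolding X'_def Y'_def A_def B_def tt by auto
      define F where "F = {A, B, X, X', Y, Y'}"
      have r': "X' \<in> rim" "Y' \<in> rim" using r X X'_def Y'_def by auto
      have F: "finite F" "F \<subseteq> rim" "A \<in> F" unfolding F_def using E r' X by auto
      have mem: "A \<in> F" "B \<in> F" "X \<in> F" "X' \<in> F" "Y \<in> F" "Y' \<in> F" unfolding F_def by auto
      obtain f :: "_ \<Rightarrow> int" where f: "inj_on f F" "\<And>x. x \<in> F \<Longrightarrow> x \<noteq> A \<Longrightarrow> f A < f x"
        "\<And>A B C. A \<in> F \<Longrightarrow> B \<in> F \<Longrightarrow> C \<in> F \<Longrightarrow> cyc A B C \<longleftrightarrow> cyc3 (f A) (f B) (f C)"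
        "\<And>A B C D. A \<in> F \<Longrightarrow> B \<in> F \<Longrightarrow> C \<in> F \<Longrightarrow> D \<in> F \<Longrightarrow> crosses A C B D \<longleftrightarrow> ilv (f A) (f C) (f B) (f D)"
        using cyc_rank[OF cyc F] by blast
      note d' = crosses_distinct[OF d(1) E(4) X(1) r'(1) E(5)] crosses_distinct[OF d(2) E(4) X(2) r'(2) E(5)]
      have "f A < f B" "f A < f X" "f A < f X'" "f A < f Y" "f A < f Y'" using f(2) mem E(1) d' by metis+
      moreover have "ilv (f A) (f X') (f X) (f B)" "ilv (f A) (f Y') (f Y) (f B)" "\<not> ilv (f A) (f B) (f X) (f Y)"
        "ilv (f X) (f Y') (f Y) (f X')" using f(4) mem d n c X'_def Y'_def by blast+
      moreover have "cyc3 (f A) (f X) (f Y) \<longrightarrow> cyc3 (f A) (f X') (f Y')" "cyc3 (f A) (f Y) (f X) \<longrightarrow> cyc3 (f A) (f Y') (f X')"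
        using f(3) mem tc[OF E(4) X] tc[OF E(4) X(2,1)] fx X'_def Y'_def by metis+
      ultimately show False unfolding ilv_def cyc3_def by smt
    qed
    then obtain Z where Z: "inc Z l" "h Z X = t Y" "h Z Y = t X" using axial[OF e l X] tt by metis
    have "meet_at (rjoin X (t Y)) (rjoin Y (t X)) Z"
      using half_turn_inc[OF X(1), of Z] half_turn_inc[OF X(2), of Z] Z c unfolding meet_at_def crosses_def meets_def by simp
    then show ?thesis using Z by blast
  qed
  moreover have "\<exists>X\<in>rim. \<exists>Y\<in>rim. crosses X (t Y) Y (t X)"
  proof -
    have "h P X \<in> rim" "crosses A B X (h P X)" using half_turn_rim half_turn_side[OF e l(2) X] X by auto
    then show ?thesis using axial[OF e l X(1)] X tt by metis
  qed
  moreover have "\<exists>cyc. rim_cyclic_order cyc \<and> compatible cyc \<and>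
        (\<forall>A\<in>rim. \<forall>B\<in>rim. \<forall>C\<in>rim. cyc A B C \<longrightarrow> cyc (t A) (t B) (t C))" using cyc tc by blast
  ultimately show ?thesis unfolding order_preserving_axial_def t_def[symmetric] by blast
qed

end

section \<open>Order-preserving axial maps\<close>

context oval_plane
begin

text \<open>\<open>X'\<close>, \<open>Y'\<close> and \<open>M\<close> stand for the images of
  \<open>X\<close>, \<open>Y\<close> and the end \<open>A\<close> of the axis. The absence of the
  crossings involving \<open>M\<close>, together with the preserved order, leaves \<open>M\<close>
  no place other than \<open>A\<close>.\<close>

lemma opa_fixes_end:
  assumes e: "ends l A B" and c: "rim_cyclic_order cyc" "compatible cyc"
    and r: "X \<in> rim" "Y \<in> rim" "X' \<in> rim" "Y' \<in> rim" "M \<in> rim"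
    and k: "crosses X Y' Y X'" "crosses A B X Y'" "crosses A B Y X'"
    and n: "\<not> crosses X M A X'" "\<not> crosses Y M A Y'" "M \<noteq> X'" "M \<noteq> Y'"
    and p: "cyc X Y A \<longrightarrow> cyc X' Y' M" "cyc Y X A \<longrightarrow> cyc Y' X' M"
  shows "M = A"
proof (rule ccontr)
  assume MA: "M \<noteq> A"
  note E = endsD[OF e]
  define F where "F = {A, B, X, X', Y, Y', M}"
  have F: "finite F" "F \<subseteq> rim" "A \<in> F" unfolding F_def using E r by auto
  have mem: "A \<in> F" "B \<in> F" "X \<in> F" "X' \<in> F" "Y \<in> F" "Y' \<in> F" "M \<in> F" unfolding F_def by auto
  obtain f :: "_ \<Rightarrow> int" where f: "inj_on f F" "\<And>x. x \<in> F \<Longrightarrow> x \<noteq> A \<Longrightarrow> f A < f x"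
    "\<And>A B C. A \<in> F \<Longrightarrow> B \<in> F \<Longrightarrow> C \<in> F \<Longrightarrow> cyc A B C \<longleftrightarrow> cyc3 (f A) (f B) (f C)"
    "\<And>A B C D. A \<in> F \<Longrightarrow> B \<in> F \<Longrightarrow> C \<in> F \<Longrightarrow> D \<in> F \<Longrightarrow> crosses A C B D \<longleftrightarrow> ilv (f A) (f C) (f B) (f D)"
    using cyc_rank[OF c F] by blast
  have ne: "f x \<noteq> f y" if "x \<in> F" "y \<in> F" "x \<noteq> y" for x y using f(1) that unfolding inj_on_def by blast
  note d = crosses_distinct[OF k(2) E(4) r(1) E(5) r(4)] crosses_distinct[OF k(3) E(4) r(2) E(5) r(3)]
  have "f A < f B" "f A < f X" "f A < f X'" "f A < f Y" "f A < f Y'" "f A < f M" using f(2) mem E(1) d MA by metis+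
  moreover have "f M \<noteq> f X'" "f M \<noteq> f Y'" using ne mem n by metis+
  moreover have "ilv (f X) (f Y') (f Y) (f X')" "ilv (f A) (f B) (f X) (f Y')" "ilv (f A) (f B) (f Y) (f X')"
    "\<not> ilv (f X) (f M) (f A) (f X')" "\<not> ilv (f Y) (f M) (f A) (f Y')" using f(4) mem k n by blast+
  moreover have "cyc3 (f X) (f Y) (f A) \<longrightarrow> cyc3 (f X') (f Y') (f M)" "cyc3 (f Y) (f X) (f A) \<longrightarrow> cyc3 (f Y') (f X') (f M)"
    using f(3) mem p by blast+
  ultimately show False unfolding ilv_def cyc3_def by smt
qed

lemma opa_moves:
  assumes e: "ends l A B" and c: "rim_cyclic_order cyc" "compatible cyc"
    and r: "X \<in> rim" "Y \<in> rim" "X' \<in> rim" "Y' \<in> rim"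
    and k: "crosses X Y' Y X'" "crosses A B X Y'" "crosses A B Y X'"
    and p: "cyc A X B \<longrightarrow> cyc A X' B" "cyc B X A \<longrightarrow> cyc B X' A"
  shows "crosses A B X Y" "crosses A X' X B \<and> crosses A Y' Y B \<or> crosses B X' X A \<and> crosses B Y' Y A"
proof -
  note E = endsD[OF e]
  define F where "F = {A, B, X, X', Y, Y'}"
  have F: "finite F" "F \<subseteq> rim" "A \<in> F" unfolding F_def using E r by auto
  have mem: "A \<in> F" "B \<in> F" "X \<in> F" "X' \<in> F" "Y \<in> F" "Y' \<in> F" unfolding F_def by auto
  obtain f :: "_ \<Rightarrow> int" where f: "inj_on f F" "\<And>x. x \<in> F \<Longrightarrow> x \<noteq> A \<Longrightarrow> f A < f x"
    "\<And>A B C. A \<in> F \<Longrightarrow> B \<in> F \<Longrightarrow> C \<in> F \<Longrightarrow> cyc A B C \<longleftrightarrow> cyc3 (f A) (f B) (f C)"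
    "\<And>A B C D. A \<in> F \<Longrightarrow> B \<in> F \<Longrightarrow> C \<in> F \<Longrightarrow> D \<in> F \<Longrightarrow> crosses A C B D \<longleftrightarrow> ilv (f A) (f C) (f B) (f D)"
    using cyc_rank[OF c F] by blast
  note d = crosses_distinct[OF k(2) E(4) r(1) E(5) r(4)] crosses_distinct[OF k(3) E(4) r(2) E(5) r(3)]
  have 1: "f A < f B" "f A < f X" "f A < f X'" "f A < f Y" "f A < f Y'" using f(2) mem E(1) d by metis+
  have 2: "ilv (f X) (f Y') (f Y) (f X')" "ilv (f A) (f B) (f X) (f Y')" "ilv (f A) (f B) (f Y) (f X')"
    using f(4) mem k by blast+
  have 3: "cyc3 (f A) (f X) (f B) \<longrightarrow> cyc3 (f A) (f X') (f B)" "cyc3 (f B) (f X) (f A) \<longrightarrow> cyc3 (f B) (f X') (f A)"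
    using f(3) mem p by blast+
  have "ilv (f A) (f B) (f X) (f Y)" using 1 2 3 unfolding ilv_def cyc3_def by smt
  then show "crosses A B X Y" using f(4) mem by blast
  have "ilv (f A) (f X') (f X) (f B) \<and> ilv (f A) (f Y') (f Y) (f B) \<or> ilv (f B) (f X') (f X) (f A) \<and> ilv (f B) (f Y') (f Y) (f A)"
    using 1 2 3 unfolding ilv_def cyc3_def by smt
  then show "crosses A X' X B \<and> crosses A Y' Y B \<or> crosses B X' X A \<and> crosses B Y' Y A" using f(4) mem by blast
qed

text \<open>If \<open>T\<close>, on the side of \<open>X\<close>, moved in the opposite direction,
  the lines \<open>T X'\<close> and \<open>X T'\<close> would cross.\<close>

lemma opa_same_way:
  assumes e: "ends l A B" and c: "rim_cyclic_order cyc" "compatible cyc"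
    and r: "X \<in> rim" "T \<in> rim" "X' \<in> rim" "T' \<in> rim" and d: "X \<noteq> A" "X \<noteq> B" "T \<noteq> A" "T \<noteq> B" "T' \<noteq> A" "T' \<noteq> B" "T \<noteq> T'"
    and k: "crosses A X' X B" "\<not> crosses A B X T" "\<not> crosses T X' X T'"
    and p: "cyc A X T \<longrightarrow> cyc A X' T'" "cyc A T X \<longrightarrow> cyc A T' X'" "X = T \<longrightarrow> X' = T'" "cyc A T B \<longrightarrow> cyc A T' B" "cyc B T A \<longrightarrow> cyc B T' A"
  shows "crosses A T' T B"
proof -
  note E = endsD[OF e]
  define F where "F = {A, B, X, X', T, T'}"
  have F: "finite F" "F \<subseteq> rim" "A \<in> F" unfolding F_def using E r by auto
  have mem: "A \<in> F" "B \<in> F" "X \<in> F" "X' \<in> F" "T \<in> F" "T' \<in> F" unfolding F_def by auto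
  obtain f :: "_ \<Rightarrow> int" where f: "inj_on f F" "\<And>x. x \<in> F \<Longrightarrow> x \<noteq> A \<Longrightarrow> f A < f x"
    "\<And>A B C. A \<in> F \<Longrightarrow> B \<in> F \<Longrightarrow> C \<in> F \<Longrightarrow> cyc A B C \<longleftrightarrow> cyc3 (f A) (f B) (f C)"
    "\<And>A B C D. A \<in> F \<Longrightarrow> B \<in> F \<Longrightarrow> C \<in> F \<Longrightarrow> D \<in> F \<Longrightarrow> crosses A C B D \<longleftrightarrow> ilv (f A) (f C) (f B) (f D)"
    using cyc_rank[OF c F] by blast
  have ne: "f x = f y \<longleftrightarrow> x = y" if "x \<in> F" "y \<in> F" for x y using f(1) that unfolding inj_on_def by blast
  note d' = crosses_distinct[OF k(1) E(4) r(1,3) E(5)]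
  have 1: "f A < f B" "f A < f X" "f A < f X'" "f A < f T" "f A < f T'" using f(2) mem E(1) d d' by metis+
  have 2: "f X \<noteq> f B" "f T \<noteq> f B" "f T' \<noteq> f B" "f T \<noteq> f T'" "f X = f T \<longrightarrow> f X' = f T'" using ne mem d p(3) by metis+
  have 3: "ilv (f A) (f X') (f X) (f B)" "\<not> ilv (f A) (f B) (f X) (f T)" "\<not> ilv (f T) (f X') (f X) (f T')"
    using f(4) mem k by blast+
  have 4: "cyc3 (f A) (f X) (f T) \<longrightarrow> cyc3 (f A) (f X') (f T')" "cyc3 (f A) (f T) (f X) \<longrightarrow> cyc3 (f A) (f T') (f X')"
    "cyc3 (f A) (f T) (f B) \<longrightarrow> cyc3 (f A) (f T') (f B)" "cyc3 (f B) (f T) (f A) \<longrightarrow> cyc3 (f B) (f T') (f A)"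
    using f(3) mem p by blast+
  have "ilv (f A) (f T') (f T) (f B)" using 1 2 3 4 unfolding ilv_def cyc3_def by smt
  then show ?thesis using f(4) mem by blast
qed

text \<open>From the crossing pair \<open>X\<close>, \<open>Y\<close> a second one is obtained,
  \<open>Y'\<close> and \<open>X\<close>, with \<open>Y''\<close> the image of \<open>Y'\<close>. It
  serves to show that \<open>X\<close> is not an end of the axis.\<close>

lemma opa_end_on:
  assumes c: "rim_cyclic_order cyc" "compatible cyc"
    and r: "X \<in> rim" "Y \<in> rim" "X' \<in> rim" "Y' \<in> rim" "Y'' \<in> rim" and k: "crosses X Y' Y X'"
    and p: "cyc X Y' Y \<longrightarrow> cyc X' Y'' Y'" "cyc Y Y' X \<longrightarrow> cyc Y' Y'' X'"
  shows "crosses Y' X' X Y''"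
proof -
  define F where "F = {X, X', Y, Y', Y''}"
  have F: "finite F" "F \<subseteq> rim" "X \<in> F" unfolding F_def using r by auto
  have mem: "X \<in> F" "X' \<in> F" "Y \<in> F" "Y' \<in> F" "Y'' \<in> F" unfolding F_def by auto
  obtain f :: "_ \<Rightarrow> int" where f: "inj_on f F" "\<And>x. x \<in> F \<Longrightarrow> x \<noteq> X \<Longrightarrow> f X < f x"
    "\<And>A B C. A \<in> F \<Longrightarrow> B \<in> F \<Longrightarrow> C \<in> F \<Longrightarrow> cyc A B C \<longleftrightarrow> cyc3 (f A) (f B) (f C)"
    "\<And>A B C D. A \<in> F \<Longrightarrow> B \<in> F \<Longrightarrow> C \<in> F \<Longrightarrow> D \<in> F \<Longrightarrow> crosses A C B D \<longleftrightarrow> ilv (f A) (f C) (f B) (f D)"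
    using cyc_rank[OF c F] by blast
  have "ilv (f X) (f Y') (f Y) (f X')" using f(4) mem k by blast
  moreover have "cyc3 (f X) (f Y') (f Y) \<longrightarrow> cyc3 (f X') (f Y'') (f Y')" "cyc3 (f Y) (f Y') (f X) \<longrightarrow> cyc3 (f Y') (f Y'') (f X')"
    using f(3) mem p by blast+
  ultimately have "ilv (f Y') (f X') (f X) (f Y'')" unfolding ilv_def cyc3_def by smt
  then show ?thesis using f(4) mem by blast
qed

text \<open>
  The ends of \<open>l\<close> are fixed by \<open>\<alpha>\<close>, and since lines \<open>X Y\<^sup>\<alpha>\<close> and \<open>Y X\<^sup>\<alpha>\<close> on one side of \<open>l\<close> cannot meet,
  all ends moved by \<open>\<alpha>\<close> move towards the same end \<open>B\<close> of \<open>l\<close>.  The translation agreeing with \<open>\<alpha>\<close> at \<open>T\<close>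
  then agrees with it at a moved end \<open>W\<close> on the other side, and hence at \<open>T\<^sup>\<alpha>\<^sup>-\<^sup>1\<close>.
\<close>

lemma opa_translation:
  assumes a: "order_preserving_axial \<alpha> l" and T: "T \<in> rim" "\<not> ron T l" and ne: "\<alpha> T \<noteq> inv \<alpha> T"
  obtains P Q where "inc P l" "inc Q l" "P \<noteq> Q" "\<alpha> T = h Q (h P T)" "inv \<alpha> T = h P (h Q T)"
proof -
  have perm: "\<alpha> permutes rim" using a unfolding order_preserving_axial_def by blast
  obtain cyc where c: "rim_cyclic_order cyc" "compatible cyc"
    and ac: "\<And>A B C. A \<in> rim \<Longrightarrow> B \<in> rim \<Longrightarrow> C \<in> rim \<Longrightarrow> cyc A B C \<Longrightarrow> cyc (\<alpha> A) (\<alpha> B) (\<alpha> C)"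
    using a unfolding order_preserving_axial_def by blast
  have ax: "\<exists>P. meet_at (rjoin X (\<alpha> Y)) (rjoin Y (\<alpha> X)) P \<and> inc P l" if "X \<in> rim" "Y \<in> rim" "crosses X (\<alpha> Y) Y (\<alpha> X)" for X Y
    using a that unfolding order_preserving_axial_def by blast
  obtain X Y where X: "X \<in> rim" "Y \<in> rim" "crosses X (\<alpha> Y) Y (\<alpha> X)" using a unfolding order_preserving_axial_def by blast
  have ar: "\<alpha> X \<in> rim" if "X \<in> rim" for X using perm that permutes_in_image by metis
  have inj: "\<alpha> X = \<alpha> Y \<longleftrightarrow> X = Y" for X Y using permutes_inj[OF perm] by (auto dest: injD)
  have axial': "\<exists>Z. inc Z l \<and> h Z X = \<alpha> Y \<and> h Z Y = \<alpha> X" if W: "X \<in> rim" "Y \<in> rim" "crosses X (\<alpha> Y) Y (\<alpha> X)" for X Y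
  proof -
    obtain Z where Z: "inc Z (rjoin X (\<alpha> Y))" "inc Z (rjoin Y (\<alpha> X))" "inc Z l" using ax[OF W] unfolding meet_at_def by blast
    moreover have "X \<noteq> \<alpha> Y" "Y \<noteq> \<alpha> X" using W(3) unfolding crosses_def by auto
    ultimately show ?thesis using half_turn_iff[OF W(1) ar[OF W(2)]] half_turn_iff[OF W(2) ar[OF W(1)]] by metis
  qed
  have off: "\<not> ron X l" if X: "X \<in> rim" "Y \<in> rim" "crosses X (\<alpha> Y) Y (\<alpha> X)" for X Y
  proof
    assume "ron X l"
    obtain Z where Z: "inc Z l" "h Z X = \<alpha> Y" using axial'[OF X] by blast
    have e: "ends l X (\<alpha> Y)" using ends_swap \<open>ron X l\<close> Z by metis
    \<comment> \<open>The second crossing pair makes \<open>\<alpha> (\<alpha> Y)\<close>, like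
      \<open>\<alpha> Y\<close>, the end of \<open>l\<close> opposite to \<open>X\<close>, so
      \<open>Y\<close> would be fixed.\<close>
    have "crosses (\<alpha> Y) (\<alpha> X) X (\<alpha> (\<alpha> Y))"
      using opa_end_on[OF c X(1,2) ar[OF X(1)] ar[OF X(2)] ar[OF ar[OF X(2)]] X(3)]
        ac[of X "\<alpha> Y" Y] ac[of Y "\<alpha> Y" X] X ar by blast
    then obtain W where "inc W l" "h W X = \<alpha> (\<alpha> Y)" using axial'[OF ar[OF X(2)] X(1)] by blast
    then have "\<alpha> (\<alpha> Y) = \<alpha> Y" using ends_half_turn[OF e] by metis
    then have "\<alpha> Y = Y" using inj by blast
    then show False using crosses_distinct[OF X(3) X(1,2) ar[OF X(2)] ar[OF X(1)]] by metis
  qed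
  have X2: "crosses Y (\<alpha> X) X (\<alpha> Y)" using X(3) crosses_sym(2) by blast
  have oX: "\<not> ron X l" "\<not> ron Y l" using off X X2 by blast+
  obtain Z where Z: "inc Z l" "h Z X = \<alpha> Y" "h Z Y = \<alpha> X" using axial'[OF X] by blast
  obtain A0 B0 where e0: "ends l A0 B0" by (rule ends_ex)
  have sd: "crosses A B X (\<alpha> Y)" "crosses A B Y (\<alpha> X)" "\<not> ron (\<alpha> X) l" "\<not> ron (\<alpha> Y) l" if e: "ends l A B" for A B
    using half_turn_side[OF e Z(1) X(1) oX(1)] half_turn_side[OF e Z(1) X(2) oX(2)] Z by auto
  have fx: "\<alpha> A = A" if e: "ends l A B" for A B
  proof -
    note E = endsD[OF e]
    have nc: "\<not> crosses W (\<alpha> A) A (\<alpha> W)" if W: "W \<in> rim" "\<not> ron (\<alpha> W) l" for W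
    proof
      assume "crosses W (\<alpha> A) A (\<alpha> W)"
      then obtain V where "inc V l" "h V A = \<alpha> W" using axial'[OF W(1) E(4)] by blast
      then show False using ends_half_turn[OF e] E W by metis
    qed
    show ?thesis
    proof (rule opa_fixes_end[OF e c X(1,2) ar[OF X(1)] ar[OF X(2)] ar[OF E(4)] X(3)])
      show "crosses A B X (\<alpha> Y)" "crosses A B Y (\<alpha> X)" using sd e by blast+
      show "\<not> crosses X (\<alpha> A) A (\<alpha> X)" "\<not> crosses Y (\<alpha> A) A (\<alpha> Y)" using nc X sd[OF e] by blast+
      show "\<alpha> A \<noteq> \<alpha> X" "\<alpha> A \<noteq> \<alpha> Y" using inj oX E by metis+
    qed (use ac X E in blast)+
  qed
  have "crosses A0 B0 X Y" "crosses A0 (\<alpha> X) X B0 \<and> crosses A0 (\<alpha> Y) Y B0 \<or> crosses B0 (\<alpha> X) X A0 \<and> crosses B0 (\<alpha> Y) Y A0"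
    using opa_moves[OF e0 c X(1,2) ar[OF X(1)] ar[OF X(2)] X(3) sd(1,2)[OF e0]] ac[of A0 X B0] ac[of B0 X A0]
      fx[OF e0] fx[OF e0[unfolded ends_sym[of l A0 B0]]] X endsD(4,5)[OF e0] by metis+
  then obtain A B where e: "ends l A B" "crosses A B X Y" "crosses A (\<alpha> X) X B" "crosses A (\<alpha> Y) Y B"
    using e0 ends_sym crosses_sym(1) by metis
  note E = endsD[OF e(1)]
  have fAB: "\<alpha> A = A" "\<alpha> B = B" using fx e(1) ends_sym by metis+
  have aoff: "\<not> ron (\<alpha> T) l" if "\<not> ron T l" for T using that fAB E inj by metis
  have aside: "\<not> crosses A B T (\<alpha> T)" if T: "T \<in> rim" "\<not> ron T l" for T
  proof -
    define F where "F = {A, B, T, \<alpha> T}"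
    have F: "finite F" "F \<subseteq> rim" "A \<in> F" unfolding F_def using E ar T by auto
    have mem: "A \<in> F" "B \<in> F" "T \<in> F" "\<alpha> T \<in> F" unfolding F_def by auto
    obtain f :: "_ \<Rightarrow> int" where f: "inj_on f F" "\<And>x. x \<in> F \<Longrightarrow> x \<noteq> A \<Longrightarrow> f A < f x"
      "\<And>A B C. A \<in> F \<Longrightarrow> B \<in> F \<Longrightarrow> C \<in> F \<Longrightarrow> cyc A B C \<longleftrightarrow> cyc3 (f A) (f B) (f C)"
      "\<And>A B C D. A \<in> F \<Longrightarrow> B \<in> F \<Longrightarrow> C \<in> F \<Longrightarrow> D \<in> F \<Longrightarrow> crosses A C B D \<longleftrightarrow> ilv (f A) (f C) (f B) (f D)"
      using cyc_rank[OF c F] by blast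
    have "cyc3 (f A) (f T) (f B) \<longrightarrow> cyc3 (f A) (f (\<alpha> T)) (f B)" "cyc3 (f B) (f T) (f A) \<longrightarrow> cyc3 (f B) (f (\<alpha> T)) (f A)"
      using f(3) mem ac[OF E(4) T(1) E(5)] ac[OF E(5) T(1) E(4)] fAB by metis+
    then have "\<not> ilv (f A) (f B) (f T) (f (\<alpha> T))" unfolding ilv_def cyc3_def by smt
    then show ?thesis using f(4) mem by blast
  qed
  have way1: "crosses A (\<alpha> T) T B"
    if T: "T \<in> rim" "\<not> ron T l" "\<alpha> T \<noteq> T" and W: "W \<in> rim" "\<not> ron W l" "crosses A (\<alpha> W) W B" "\<not> crosses A B W T" for T W
  proof (rule opa_same_way[OF e(1) c W(1) T(1) ar[OF W(1)] ar[OF T(1)]])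
    show "\<not> crosses T (\<alpha> W) W (\<alpha> T)"
    proof
      assume "crosses T (\<alpha> W) W (\<alpha> T)"
      then obtain V where V: "inc V l" "h V T = \<alpha> W" using axial'[OF T(1) W(1)] by blast
      have "crosses A B T (\<alpha> W)" using half_turn_side[OF e(1) V(1) T(1,2)] V by simp
      then show False
        using side_parity[OF e(1) T(1,2) W(1,2) ar[OF W(1)] aoff[OF W(2)]] aside[OF W(1,2)] W(4) crosses_sym by metis
    qed
  qed (use T W E aoff ac fAB in metis)+
  have way: "crosses A (\<alpha> T) T B" if T: "T \<in> rim" "\<not> ron T l" "\<alpha> T \<noteq> T" for T
    using way1[OF T X(1) oX(1) e(3)] way1[OF T X(2) oX(2) e(4)] side_parity[OF e(1) X(1) oX(1) X(2) oX(2) T(1,2)] 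
      side_parity[OF e(1) X(2) oX(2) X(1) oX(1) T(1,2)] e(2) crosses_sym by metis
  define D where "D = inv \<alpha> T"
  have aD: "\<alpha> D = T" unfolding D_def using permutes_inverses(1)[OF perm] .
  have Dr: "D \<in> rim" using aD perm T permutes_in_image by metis
  have mv: "\<alpha> T \<noteq> T" using ne aD inj D_def by metis
  have mvD: "\<alpha> D \<noteq> D" using mv aD inj by metis
  have Doff: "\<not> ron D l" using aD fAB E T by metis
  have "\<exists>W. W \<in> rim \<and> \<not> ron W l \<and> crosses A (\<alpha> W) W B \<and> crosses A B T W"
    using side_parity[OF e(1) X(1) oX(1) X(2) oX(2) T] side_parity[OF e(1) X(1) oX(1) T X(2) oX(2)] e X oX crosses_sym by metis
  then obtain W where W: "W \<in> rim" "\<not> ron W l" "crosses A (\<alpha> W) W B" "crosses A B T W" by blast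
  have DT: "\<not> crosses A B D T" using aside[OF Dr Doff] aD by simp
  have DW: "crosses A B D W" using side_parity[OF e(1) Dr Doff T W(1,2)] DT W(4) by blast
  have "crosses T (\<alpha> W) W (\<alpha> T)"
    using circle_order[OF E(4,5,1) T(1) ar[OF T(1)] W(1) ar[OF W(1)] way[OF T mv] W(3,4)] .
  then obtain Z1 where Z1: "inc Z1 l" "h Z1 T = \<alpha> W" "h Z1 W = \<alpha> T" using axial'[OF T(1) W(1)] by blast
  have "crosses D (\<alpha> W) W (\<alpha> D)"
    using circle_order[OF E(4,5,1) Dr ar[OF Dr] W(1) ar[OF W(1)] way[OF Dr Doff mvD] W(3) DW] .
  then obtain Z3 where Z3: "inc Z3 l" "h Z3 D = \<alpha> W" "h Z3 W = T" using axial'[OF Dr W(1)] aD by metis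
  \<comment> \<open>\<open>Q\<close> is any point of \<open>l\<close>, and \<open>P\<close> is
    adjusted so that the translation agrees with \<open>\<alpha>\<close> at
    \<open>T\<close>.\<close>
  obtain Q where Q: "inc Q l" by (rule point_on)
  have "crosses A B T (h Q (\<alpha> T))"
    using side_parity[OF e(1) T ar[OF T(1)] aoff[OF T(2)] half_turn_rim(1)[OF ar[OF T(1)]] half_turn_side(2)[OF e(1) Q ar[OF T(1)] aoff[OF T(2)]]]
      half_turn_side(1)[OF e(1) Q ar[OF T(1)] aoff[OF T(2)]] aside[OF T] by blast
  then obtain P where P: "inc P l" "h P T = h Q (\<alpha> T)" using side_meet[OF e(1)] T ar half_turn_rim by metis
  have tT: "h Q (h P T) = \<alpha> T" using P by simp
  have PQ: "P \<noteq> Q" using tT mv by auto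
  obtain Z2 where Z2: "inc Z2 l" "h Z2 T = h Q (h P W)" "h Z2 W = h Q (h P T)"
    using axial[OF e(1) PQ P(1) Q T(1) W(1,4)] by metis
  have "Z2 = Z1" using half_turn_unique[OF W(1), of Z1 Z2 l] W(2) Z1 Z2 tT by metis
  then have tW: "h Q (h P W) = \<alpha> W" using Z1 Z2 by simp
  define D' where "D' = h P (h Q T)"
  have tD: "h Q (h P D') = T" unfolding D'_def by simp
  have D': "D' \<in> rim" "\<not> ron D' l" "\<not> crosses A B T D'" using translation_side[OF Q P(1) T] e(1) D'_def by auto
  have D'W: "crosses A B D' W" using side_parity[OF e(1) T D'(1,2) W(1,2)] D'(3) W(4) by blast
  obtain Z4 where Z4: "inc Z4 l" "h Z4 D' = h Q (h P W)" "h Z4 W = h Q (h P D')"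
    using axial[OF e(1) PQ P(1) Q D'(1) W(1) D'W] by metis
  have "Z4 = Z3" using half_turn_unique[OF W(1), of Z3 Z4 l] W(2) Z3 Z4 tD by metis
  then have "h Z3 D' = h Z3 D" using Z3 Z4 tW by simp
  then have "D' = D" by (simp add: half_turn_cancel)
  then show thesis using that[OF P(1) Q PQ] tT D_def D'_def by simp
qed

text \<open>\<open>main\<close> evaluates the definition for translations, and
  \<open>opa_translation\<close> reduces every admissible axial map to one. The translation from
  \<open>R\<close> to a second point of \<open>l\<close> shows that an admissible map
  exists.\<close>

lemma reflection_foot: assumes f: "foot l R X" and X: "X \<in> rim" "\<not> ron X l" shows "reflection l X = h R X"
proof -
  have R: "inc R l" using f unfolding foot_def by blast
  have main: "half_turn (bowtie l (rjoin (h Q (h P X)) (h P (h Q X)))) X = h R X \<and> h Q (h P X) \<noteq> h P (h Q X)"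
    if l: "P \<noteq> Q" "inc P l" "inc Q l" for P Q
  proof -
    obtain O' where O': "sw l O' (h Q (h P X)) (h P (h Q X))" using sw_ex[OF l X] by metis
    have r: "h Q (h P X) \<in> rim" "h P (h Q X) \<in> rim" "\<not> ron (h Q (h P X)) l" "\<not> ron (h P (h Q X)) l"
      using translation_side(1,2)[OF l(2,3) X] translation_side(1,2)[OF l(3,2) X] by auto
    have d: "h Q (h P X) \<noteq> h P (h Q X)"
      using crosses_distinct(5)[OF translation_order[OF l X]] endsD(4,5)[OF ends_points[OF l]] r by metis
    have "ends (rjoin (h Q (h P X)) (h P (h Q X))) (h Q (h P X)) (h P (h Q X))"
      unfolding ends_def using rjoin_on r d by metis
    then have "bowtie l (rjoin (h Q (h P X)) (h P (h Q X))) = O'" using bowtie_eq O' r by metis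
    then show ?thesis using foot_half_turn_eq[OF f X l O'] d by simp
  qed
  have "(THE B. \<exists>\<alpha>. order_preserving_axial \<alpha> l \<and> \<alpha> X \<noteq> inv \<alpha> X \<and> B = half_turn (bowtie l (rjoin (\<alpha> X) (inv \<alpha> X))) X) = h R X"
  proof (rule the_equality)
    obtain P where P: "inc P l" "R \<noteq> P" using second_point[OF R] by metis
    define \<alpha> where "\<alpha> = h P \<circ> h R"
    have i: "inv \<alpha> = h R \<circ> h P" unfolding \<alpha>_def by (rule inv_unique_comp) auto
    have "order_preserving_axial \<alpha> l" unfolding \<alpha>_def using translation_opa P R by blast
    moreover have "\<alpha> X \<noteq> inv \<alpha> X" "h R X = half_turn (bowtie l (rjoin (\<alpha> X) (inv \<alpha> X))) X"
      unfolding i unfolding \<alpha>_def using main[OF P(2) R P(1)] by simp_all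
    ultimately show "\<exists>\<alpha>. order_preserving_axial \<alpha> l \<and> \<alpha> X \<noteq> inv \<alpha> X \<and> h R X = half_turn (bowtie l (rjoin (\<alpha> X) (inv \<alpha> X))) X"
      by blast
  next
    fix B assume "\<exists>\<alpha>. order_preserving_axial \<alpha> l \<and> \<alpha> X \<noteq> inv \<alpha> X \<and> B = half_turn (bowtie l (rjoin (\<alpha> X) (inv \<alpha> X))) X"
    then obtain \<alpha> where a: "order_preserving_axial \<alpha> l" "\<alpha> X \<noteq> inv \<alpha> X" "B = half_turn (bowtie l (rjoin (\<alpha> X) (inv \<alpha> X))) X" by blast
    obtain P Q where "inc P l" "inc Q l" "P \<noteq> Q" "\<alpha> X = h Q (h P X)" "inv \<alpha> X = h P (h Q X)"
      using opa_translation[OF a(1) X a(2)] by metis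
    then show "B = h R X" using main[of P Q] a(3) by simp
  qed
  then show ?thesis unfolding reflection_def ron_def[symmetric] using X by simp
qed

lemma reflection_fix: "X \<notin> rim \<or> ron X l \<Longrightarrow> reflection l X = X"
  unfolding reflection_def ron_def[symmetric] by simp

end

section \<open>Perpendiculars\<close>

context oval_plane
begin

lemma foot_on: "foot l R X \<Longrightarrow> inc R l"
  unfolding foot_def by blast

lemma reflection_ex:
  assumes X: "X \<in> rim" "\<not> ron X l" obtains R where "foot l R X" "inc R l" "reflection l X = h R X"
  using foot_unique[OF X] reflection_foot[OF _ X] foot_on by metis

lemma foot_of_reflection:
  assumes X: "X \<in> rim" "\<not> ron X l" and R: "inc R l" "reflection l X = h R X" shows "foot l R X"
proof -
  obtain S where S: "foot l S X" "inc S l" "reflection l X = h S X" using reflection_ex[OF X] by metis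
  then have "S = R" using half_turn_unique[OF X(1), of S R l] X R by metis
  then show ?thesis using S by simp
qed

text \<open>Conjugation by the half-turn about \<open>R\<close> exchanges \<open>X\<close> with its
  image and the two ends of \<open>l\<close>; the point \<open>P\<close> becomes the point
  \<open>T\<close> whose half-turn is the product of those about \<open>R\<close>, \<open>P\<close>,
  \<open>R\<close>.\<close>

lemma foot_half_turn:
  assumes f: "foot l R X" and X: "X \<in> rim" "\<not> ron X l" shows "foot l R (h R X)"
  unfolding foot_def
proof (intro conjI allI impI)
  show R: "inc R l" using foot_on f .
  fix S assume "inc S l \<and> S \<noteq> R"
  then obtain P where P: "h P X = h R X" "sw l P (h R (h S X)) (h S (h R X))" using f unfolding foot_def by blast
  define n where "n = rjoin X (h R X)"
  have n: "inc R n" "inc P n" using half_turn_inc[OF X(1), of R] half_turn_inc[OF X(1), of P] P n_def by auto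
  obtain T where T: "\<And>Z. h R (h P (h R Z)) = h T Z" using half_turns_product[OF n(1,2,1)] by metis
  obtain A B where e: "ends l A B" by (rule ends_ex)
  have AB: "h R A = B" "h R B = A" using ends_half_turn[OF e R] by auto
  have "h T (h R X) = h R (h R X)" using T[of "h R X"] P by simp
  moreover have "h T A = h R (h P B)" "h T B = h R (h P A)" using T[of A] T[of B] AB by auto
  then have "sw l T (h R (h S (h R X))) (h S (h R (h R X)))"
    using P(2) unfolding sw_iff[OF e] by auto
  ultimately show "\<exists>P. h P (h R X) = h R (h R X) \<and> sw l P (h R (h S (h R X))) (h S (h R (h R X)))" by blast
qed

lemma reflection_reflection [simp]: "reflection l (reflection l X) = X"
proof (cases "X \<in> rim \<and> \<not> ron X l")
  case True
  then obtain R where R: "foot l R X" "inc R l" "reflection l X = h R X" using reflection_ex by metis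
  obtain A B where e: "ends l A B" by (rule ends_ex)
  have "reflection l (h R X) = h R (h R X)"
    using reflection_foot[OF foot_half_turn[OF R(1)]] half_turn_side[OF e R(2)] half_turn_rim True by blast
  then show ?thesis using R by simp
next
  case False then show ?thesis using reflection_fix by metis
qed

lemma reflection_side:
  assumes "ends l A B" "X \<in> rim" "\<not> ron X l"
  shows "crosses A B X (reflection l X)" "reflection l X \<in> rim" "\<not> ron (reflection l X) l"
  using reflection_ex[OF assms(2,3)] half_turn_side[OF assms(1) _ assms(2,3)] half_turn_rim assms by metis+

lemma perp_off:
  assumes R: "inc R l" and X: "X \<in> rim" "\<not> ron X l" and A: "ron A l"
  shows "\<not> ron A (rjoin X (h R X))" "l \<noteq> rjoin X (h R X)" "ends (rjoin X (h R X)) X (h R X)" "inc R (rjoin X (h R X))"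
proof -
  define n where "n = rjoin X (h R X)"
  have n: "ron X n" "ron (h R X) n" "inc R n" using rjoin_on X half_turn_rim half_turn_inc n_def by metis+
  show "ends (rjoin X (h R X)) X (h R X)" "inc R (rjoin X (h R X))"
    using n half_turn_rim X unfolding ends_def n_def by metis+
  show "l \<noteq> rjoin X (h R X)" using n X n_def by metis
  then show "\<not> ron A (rjoin X (h R X))" using ron_disjoint[OF A, of n] n R meetsI n_def by metis
qed

text \<open>The configuration is self-dual. \<open>P\<close> on \<open>n\<close> carries the ends of
  \<open>l\<close> to the images of \<open>X\<close> under the two products of \<open>R\<close> and
  \<open>S\<close>; equivalently \<open>S\<close>, or its conjugate \<open>T\<close>, on
  \<open>l\<close> carries the ends of \<open>n\<close> to the images of \<open>A\<close> under the
  two products of \<open>R\<close> and \<open>P\<close>.\<close>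

lemma foot_perp:
  assumes f: "foot l R X" and X: "X \<in> rim" "\<not> ron X l" and e: "ends l A B"
  shows "foot (rjoin X (h R X)) R A"
proof -
  have R: "inc R l" using foot_on f .
  note E = endsD[OF e]
  define n where "n = rjoin X (h R X)"
  have n: "\<not> ron A n" "ends n X (h R X)" "inc R n" using perp_off[OF R X E(2)] n_def by auto
  obtain S where S: "inc S l" "S \<noteq> R" using second_point[OF R] by metis
  obtain P where P: "h P X = h R X" "sw l P (h R (h S X)) (h S (h R X))" using f S unfolding foot_def by blast
  have Pn: "inc P n" using half_turn_inc[OF X(1), of P] P n_def by simp
  have hA: "h R A = B" "h S A = B" using ends_half_turn[OF e] R S by auto
  have PR: "P \<noteq> R"
  proof
    assume "P = R"
    then have "B = h R (h S X) \<or> B = h S (h R X)" using P(2) hA sw_iff[OF e] by blast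
    then show False using translation_side(2)[OF S(1) R X] translation_side(2)[OF R S(1) X] E(3) by metis
  qed
  obtain T where T: "inc T l" "\<And>Z. h R (h S (h R Z)) = h T Z" using half_turns_product[OF R S(1) R] by metis
  have TA: "h T A = B" using ends_half_turn[OF e T(1)] by simp
  have "(h P A = h R (h S X) \<and> h P B = h S (h R X)) \<or> (h P A = h S (h R X) \<and> h P B = h R (h S X))"
    using P(2) sw_iff[OF e] by blast
  then have "sw n S (h R (h P A)) (h P (h R A)) \<or> sw n T (h R (h P A)) (h P (h R A))"
  proof
    assume "h P A = h R (h S X) \<and> h P B = h S (h R X)"
    then have "h R (h P A) = h S X" "h P (h R A) = h S (h R X)" using hA by auto
    then show ?thesis unfolding sw_iff[OF n(2)] by simp
  next
    assume "h P A = h S (h R X) \<and> h P B = h R (h S X)"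
    then have "h R (h P A) = h T X" "h P (h R A) = h T (h R X)" using hA T(2)[of X] T(2)[of "h R X"] by auto
    then show ?thesis unfolding sw_iff[OF n(2)] by simp
  qed
  then have "foot n R A"
    using footI[OF E(4) n(1,3) PR Pn n(3), of S] footI[OF E(4) n(1,3) PR Pn n(3), of T] hA TA by metis
  then show ?thesis unfolding n_def .
qed

text \<open>\<open>S\<close> is found from \<open>h S (h R X) = h P A\<close>, which is possible
  because these ends are on different sides of \<open>l\<close>. The point that the foot condition
  assigns to \<open>S\<close> is on \<open>n\<close> and has the same image of \<open>A\<close>, so
  it is \<open>P\<close>.\<close>

lemma perp_point:
  assumes f: "foot l R X" and X: "X \<in> rim" "\<not> ron X l" and e: "ends l A B"
    and P: "inc P (rjoin X (h R X))" "P \<noteq> R" and c: "crosses A B (h R X) (h P A)"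
  obtains S where "inc S l" "S \<noteq> R" "h P A = h S (h R X)" "h P B = h R (h S X)"
proof -
  have R: "inc R l" using foot_on f .
  note E = endsD[OF e]
  define n where "n = rjoin X (h R X)"
  have n: "\<not> ron A n" "\<not> ron B n" "ends n X (h R X)" "inc R n" using perp_off[OF R X E(2)] perp_off[OF R X E(3)] n_def by auto
  have Pn: "inc P n" using P n_def by simp
  obtain S where S: "inc S l" "h S (h R X) = h P A" using side_meet[OF e c] half_turn_rim X E by metis
  have An: "\<not> ron (h P A) n" "crosses X (h R X) A (h P A)" using half_turn_side[OF n(3) Pn E(4) n(1)] by auto
  have "S \<noteq> R" using S An n(3) half_turn_half_turn endsD by metis
  then obtain Q where Q: "h Q X = h R X" "sw l Q (h R (h S X)) (h S (h R X))" using f S unfolding foot_def by blast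
  have Qn: "inc Q n" using half_turn_inc[OF X(1), of Q] Q n_def by simp
  have "h Q B \<noteq> h P A"
  proof
    assume "h Q B = h P A"
    then have "crosses X (h R X) B (h P A)" using half_turn_side[OF n(3) Qn E(5) n(2)] by simp
    moreover have "crosses X (h R X) A B" using half_turn_side[OF n(3,4) E(4) n(1)] ends_half_turn[OF e R] by simp
    ultimately show False
      using side_parity[OF n(3) E(4) n(1) E(5) n(2) half_turn_rim(1)[OF E(4)] An(1)] An(2) by blast
  qed
  then have q: "h Q A = h P A" "h Q B = h R (h S X)" using Q(2) S sw_iff[OF e] by metis+
  have "Q = P" using half_turn_unique[OF E(4), of Q P n] q n(1) Qn Pn by metis
  then show thesis using that[OF S(1) \<open>S \<noteq> R\<close>] S q by metis
qed

text \<open>(A7) requires opposite sides to be different lines; here one vertex of each of the first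
  three sides is kept off the opposite side.\<close>

lemma pascal:
  assumes r: "A \<in> rim" "B \<in> rim" "C \<in> rim" "D \<in> rim" "E \<in> rim" "F \<in> rim"
    and d: "A \<noteq> B" "B \<noteq> C" "C \<noteq> D" "D \<noteq> E" "E \<noteq> F" "F \<noteq> A"
    and n: "A \<notin> {D, E}" "B \<notin> {E, F}" "C \<notin> {F, A}"
    and P: "inc P (rjoin A B)" "inc P (rjoin D E)" and Q: "inc Q (rjoin B C)" "inc Q (rjoin E F)"
    and R: "inc R (rjoin C D)" "inc R (rjoin F A)"
  shows "collinear {P, Q, R}"
proof -
  have "rjoin A B \<noteq> rjoin D E" "rjoin B C \<noteq> rjoin E F" "rjoin C D \<noteq> rjoin F A"
    using rims_rjoin[OF r(4,5) d(4), of A] rjoin_on[OF r(1,2) d(1)] rims_rjoin[OF r(5,6) d(5), of B] rjoin_on[OF r(2,3) d(2)]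
      rims_rjoin[OF r(6,1) d(6), of C] rjoin_on[OF r(3,4) d(3)] n by auto
  then have "meet_at (rjoin A B) (rjoin D E) P" "meet_at (rjoin B C) (rjoin E F) Q" "meet_at (rjoin C D) (rjoin F A) R"
    unfolding meet_at_def using P Q R by auto
  then show ?thesis using ax7 r d unfolding A7_def by blast
qed

text \<open>
  With \<open>V = A\<^sup>P\<close>, \<open>W = B\<^sup>P\<close>, \<open>K = V\<^sup>R\<^sup>P\<close>, the translation \<open>PR\<close> along \<open>n\<close> takes \<open>V\<close> to \<open>B\<close> and its inverse takes
  \<open>V\<close> to \<open>K\<close>, so \<open>V\<close> and its mirror image are joined by a line through \<open>XB \<inter> X'K\<close>.  Pascal for the hexagons
  \<open>V W X' X B A\<close> and \<open>X' K V\<^sup>R X B W\<close> puts both \<open>XB \<inter> VW\<close> and \<open>XB \<inter> X'K\<close> on the line \<open>PM\<close>.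
\<close>

lemma perp_commute_side:
  assumes f: "foot l R X" and X: "X \<in> rim" "\<not> ron X l" and e: "ends l A B"
    and P: "inc P (rjoin X (h R X))" "P \<noteq> R" and c: "crosses A B (h R X) (h P A)"
  shows "reflection (rjoin X (h R X)) (h P A) = h P B"
proof -
  have R: "inc R l" using foot_on f .
  note E = endsD[OF e]
  define n where "n = rjoin X (h R X)"
  define X' where "X' = h R X"
  have n: "\<not> ron A n" "\<not> ron B n" "ends n X X'" "inc R n" "l \<noteq> n"
    using perp_off[OF R X E(2)] perp_off[OF R X E(3)] n_def X'_def by auto
  have Pn: "inc P n" using P n_def by simp
  have AB: "h R A = B" "h R B = A" using ends_half_turn[OF e R] by auto
  obtain S where S: "inc S l" "S \<noteq> R" "h P A = h S X'" "h P B = h R (h S X)"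
    using perp_point[OF f X e P c] X'_def by metis
  define V where "V = h P A"
  define W where "W = h P B"
  define N where "N = h R V"
  define K where "K = h P N"
  obtain M where M: "inc M l" "\<And>Z. h R (h S (h R Z)) = h M Z" using half_turns_product[OF R S(1) R] by metis
  have MW: "h M X' = W" "h M X = N" using M(2)[of X'] M(2)[of X] S X'_def W_def N_def V_def by auto
  have PX: "h P X = X'" using ends_half_turn[OF n(3) Pn] by simp
  have r: "X' \<in> rim" "V \<in> rim" "W \<in> rim" "N \<in> rim" "K \<in> rim"
    using half_turn_rim E X unfolding X'_def V_def W_def N_def K_def by auto
  have Voff: "\<not> ron V n" "crosses X X' A V" "\<not> ron W n" "crosses X X' B W"
    using half_turn_side[OF n(3) Pn E(4) n(1)] half_turn_side[OF n(3) Pn E(5) n(2)] V_def W_def by auto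
  have Noff: "\<not> ron N n" "crosses X X' V N" using half_turn_side[OF n(3,4) r(2) Voff(1)] N_def by auto
  have KN: "crosses X X' N K" "\<not> ron K n" using half_turn_side[OF n(3) Pn r(4) Noff(1)] K_def by auto
  have Vl: "\<not> ron V l" using side_off[OF e c] half_turn_rim X E V_def by metis
  have VN: "crosses A B V N" "\<not> ron N l" using half_turn_side[OF e R r(2) Vl] N_def by auto
  have XX: "crosses A B X X'" "\<not> ron X' l" using half_turn_side[OF e R X] X'_def by auto
  have XV: "crosses A B X' V" using c X'_def V_def by simp
  have VB: "V \<noteq> B" "V \<noteq> A" "N \<noteq> A" using Vl VN E by metis+
  have AVBW: "crosses A V B W" using half_turn_crosses[OF E(4,5), of P] E(1) VB V_def W_def by metis
  have NV: "N \<noteq> V" using half_turn_rim r N_def by metis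
  have AVNK: "crosses A V N K" using half_turn_crosses[OF E(4) r(4), of P] VB NV V_def K_def by metis
  have cr: "crosses V W X B" "crosses X' K X B"
  proof -
    define F where "F = {A, B, X, X', V, W, N, K}"
    have F: "finite F" "F \<subseteq> rim" "A \<in> F" unfolding F_def using E r X by auto
    have mem: "A \<in> F" "B \<in> F" "X \<in> F" "X' \<in> F" "V \<in> F" "W \<in> F" "N \<in> F" "K \<in> F" unfolding F_def by auto
    obtain f :: "_ \<Rightarrow> int" where f: "inj_on f F" "\<And>x. x \<in> F \<Longrightarrow> x \<noteq> A \<Longrightarrow> f A < f x"
      "\<And>A B C D. A \<in> F \<Longrightarrow> B \<in> F \<Longrightarrow> C \<in> F \<Longrightarrow> D \<in> F \<Longrightarrow> crosses A C B D \<longleftrightarrow> ilv (f A) (f C) (f B) (f D)"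
      using circle[OF F] by metis
    have ne: "f x \<noteq> f y" if "x \<in> F" "y \<in> F" "x \<noteq> y" for x y using f(1) that unfolding inj_on_def by blast
    note d = crosses_distinct[OF AVBW E(4,5) r(2,3)] crosses_distinct[OF AVNK E(4) r(4,2,5)] crosses_distinct[OF XX(1) E(4) X(1) E(5) r(1)]
    have 1: "f A < f B" "f A < f X" "f A < f X'" "f A < f V" "f A < f W" "f A < f N" "f A < f K" using f(2) mem E(1) d by metis+
    have 2: "ilv (f A) (f B) (f X) (f X')" "ilv (f A) (f B) (f X') (f V)" "ilv (f X) (f X') (f A) (f V)"
      "ilv (f X) (f X') (f B) (f W)" "ilv (f A) (f V) (f B) (f W)"
      using f(3) mem XX(1) XV Voff AVBW by blast+
    have 3: "ilv (f A) (f B) (f V) (f N)" "ilv (f X) (f X') (f V) (f N)" "ilv (f X) (f X') (f N) (f K)" "ilv (f A) (f V) (f N) (f K)"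
      using f(3) mem VN Noff KN AVNK by blast+
    have "ilv (f V) (f W) (f X) (f B)" using 1(1-5) 2 unfolding ilv_def by smt
    then show "crosses V W X B" using f(3) mem by blast
    \<comment> \<open>The order of \<open>X\<close>, \<open>V\<close>, \<open>B\<close>,
      \<open>X'\<close> is fixed up to reversal before \<open>N\<close> and \<open>K\<close> are
      placed.\<close>
    have "f X < f V \<and> f V < f B \<and> f B < f X' \<or> f X' < f B \<and> f B < f V \<and> f V < f X"
      using 1(1-4) 2(1-3) unfolding ilv_def by smt
    then have "f X < f K \<and> f K < f B \<and> f B < f X' \<or> f X' < f B \<and> f B < f K \<and> f K < f X"
      using 1 3 unfolding ilv_def by smt
    then have "ilv (f X') (f K) (f X) (f B)" unfolding ilv_def by smt
    then show "crosses X' K X B" using f(3) mem by blast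
  qed
  obtain G where G: "inc G (rjoin V W)" "inc G (rjoin X B)" using cr(1) unfolding crosses_def by (auto elim: meetsE)
  obtain G' where G': "inc G' (rjoin X' K)" "inc G' (rjoin X B)" using cr(2) unfolding crosses_def by (auto elim: meetsE)
  note d = crosses_distinct[OF cr(1) r(2) X(1) r(3) E(5)] crosses_distinct[OF cr(2) r(1) X(1) r(5) E(5)]
    crosses_distinct[OF AVBW E(4,5) r(2,3)] crosses_distinct[OF XX(1) E(4) X(1) E(5) r(1)]
    crosses_distinct[OF Voff(4) X(1) E(5) r(1,3)] crosses_distinct[OF Noff(2) X(1) r(2,1,4)] crosses_distinct[OF KN(1) X(1) r(4,1,5)]
  have NB: "N \<noteq> B" using VN E by metis
  have inc: "inc P (rjoin A V)" "inc P (rjoin X X')" "inc P (rjoin B W)" "inc P (rjoin N K)" "inc M (rjoin X' W)" "inc M (rjoin X N)" "inc M (rjoin A B)"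
    using half_turn_inc E(4-6) X r MW PX M V_def W_def K_def by metis+
  have NW: "N \<noteq> W"
  proof
    assume "N = W"
    then have "X = X'" using MW half_turn_cancel by metis
    then show False using d by blast
  qed
  have KW: "K \<noteq> W" using K_def W_def NB half_turn_cancel by metis
  have "collinear {G, M, P}"
    by (rule pascal[of V W X' X B A G M P]) (use r X E d VB G inc rjoin_sym in \<open>auto simp del: insert_iff\<close>)
  moreover have "collinear {G', P, M}"
    by (rule pascal[of X' K N X B W G' P M]) (use r X E d VB NB NW KW G' inc rjoin_sym in \<open>auto\<close>)
  moreover have PM: "P \<noteq> M"
    using Pn M n(4,5) R P(2) meet_unique by metis
  ultimately have GG: "inc G (ln P M)" "inc G' (ln P M)" unfolding collinear_def using ln_eq by auto
  have XB: "ron X (rjoin X B)" "ron B (rjoin X B)" using rjoin_on X E d by metis+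
  have "\<not> inc P (rjoin X B)" using ron_disjoint[OF XB(1), of n] endsD(2)[OF n(3)] XB n(2) Pn meetsI by metis
  then have "G = G'" using GG G G' meet_unique ln_inc[OF PM] by metis
  then have g: "h G X = B" "h G X' = K" "h G V = W"
    using half_turn_iff X E r d G G' by metis+
  have "sw n G (h R (h P V)) (h P (h R V))"
    unfolding sw_iff[OF n(3)] using g AB V_def K_def N_def by simp
  moreover obtain Q where Q: "foot n Q V" "reflection n V = h Q V" using reflection_ex[OF r(2) Voff(1)] by metis
  ultimately have "h G V = h Q V" using foot_half_turn_eq[OF Q(1) r(2) Voff(1) P(2) Pn n(4)] by blast
  then have "reflection n V = W" using Q g by simp
  then show ?thesis unfolding n_def V_def W_def .
qed

text \<open>\<open>h P A\<close> is on the side of \<open>h R X\<close> or on that of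
  \<open>X\<close>; in the second case \<open>h R X\<close>, which has the same foot and the same
  perpendicular, takes the place of \<open>X\<close>.\<close>

lemma perp_commute:
  assumes f: "foot l R X" and X: "X \<in> rim" "\<not> ron X l" and e: "ends l A B"
    and P: "inc P (rjoin X (h R X))" "P \<noteq> R"
  shows "reflection (rjoin X (h R X)) (h P A) = h P B"
proof -
  have R: "inc R l" using foot_on f .
  note E = endsD[OF e]
  define n where "n = rjoin X (h R X)"
  have n: "\<not> ron A n" "ends n X (h R X)" "inc R n" using perp_off[OF R X E(2)] n_def by auto
  have Pn: "inc P n" using P n_def by simp
  have X': "h R X \<in> rim" "\<not> ron (h R X) l" "crosses A B X (h R X)" using half_turn_side[OF e R X] half_turn_rim X by auto
  have "\<not> ron (h P A) l"
  proof
    assume "ron (h P A) l"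
    then have "h P A = B" using E(7) half_turn_rim E(4) by metis
    then have "P = R" using half_turn_unique[OF E(4), of P R n] ends_half_turn[OF e R] n Pn by metis
    then show False using P by blast
  qed
  then consider "crosses A B (h R X) (h P A)" | "crosses A B X (h P A)"
    using side_parity[OF e X X'(1,2) half_turn_rim(1)[OF E(4)]] X'(3) by blast
  then show ?thesis
  proof cases
    case 1 then show ?thesis using perp_commute_side[OF assms] by blast
  next
    case 2
    then show ?thesis using perp_commute_side[OF foot_half_turn[OF f X] X'(1,2) e, of P] P rjoin_sym by simp
  qed
qed

text \<open>By the symmetry of perpendicularity, \<open>l\<close> is in turn the perpendicular to
  \<open>n\<close> at \<open>R\<close>. So \<open>perp_commute\<close> applies with \<open>l\<close>
  and \<open>n\<close> exchanged, \<open>P\<close> running on \<open>l\<close> and \<open>X\<close>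
  being an end of \<open>n\<close>.\<close>

lemma reflection_half_turn: assumes P: "inc P l" shows "reflection l (h P X) = h P (reflection l X)"
proof (cases "X \<in> rim \<and> \<not> ron X l")
  case True
  then have X: "X \<in> rim" "\<not> ron X l" by auto
  obtain A B where e: "ends l A B" by (rule ends_ex)
  note E = endsD[OF e]
  obtain R where R: "foot l R X" "inc R l" "reflection l X = h R X" using reflection_ex[OF X] by metis
  show ?thesis
  proof (cases "P = R")
    case True then show ?thesis using R reflection_reflection[of l X] by simp
  next
    case False
    define n where "n = rjoin X (h R X)"
    have n: "\<not> ron A n" "ends n X (h R X)" using perp_off[OF R(2) X E(2)] n_def by auto
    have "foot n R A" using foot_perp[OF R(1) X e] n_def by simp
    moreover have "rjoin A (h R A) = l" using ends_half_turn[OF e R(2)] E(6) by simp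
    ultimately show ?thesis using perp_commute[of n R A X "h R X" P] E(4) n P False R(3) by simp
  qed
next
  case False
  then have "h P X \<notin> rim \<or> ron (h P X) l" using half_turn_off ends_swap[OF _ P] endsD by metis
  then show ?thesis using False reflection_fix by metis
qed

text \<open>(A11) gives a perpendicular with some foot \<open>R\<close>. The half-turn about the
  midpoint of \<open>R\<close> and \<open>P\<close> commutes with the reflection and carries this
  perpendicular to one at \<open>P\<close>.\<close>

lemma perp_ex: assumes P: "inc P l" obtains X where "X \<in> rim" "\<not> ron X l" "foot l P X"
proof -
  obtain A B where e: "ends l A B" by (rule ends_ex)
  obtain Y where Y: "Y \<in> rim" "\<not> ron Y l" using off_rim[OF e] by metis
  obtain R where R: "foot l R Y" "inc R l" "reflection l Y = h R Y" using reflection_ex[OF Y] by metis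
  show thesis
  proof (cases "R = P")
    case True then show ?thesis using that Y R by blast
  next
    case False
    obtain M where M: "inc M (ln R P)" "\<And>Z. h M (h R (h M Z)) = h P Z" using midpoint[OF False] by metis
    have Ml: "inc M l" using M ln_eq False R P by metis
    have X: "h M Y \<in> rim" "\<not> ron (h M Y) l" using half_turn_side[OF e Ml Y] half_turn_rim Y by auto
    have "reflection l (h M Y) = h P (h M Y)" using reflection_half_turn[OF Ml] R(3) M(2)[of "h M Y"] by simp
    then show ?thesis using that X foot_of_reflection[OF X P] by blast
  qed
qed

text \<open>Apart from the ends of \<open>l\<close> and \<open>n\<close>, every end is the image of
  \<open>A\<close> or \<open>B\<close> under a half-turn about a point of \<open>n\<close>. By
  \<open>perp_point\<close> that image also arises through half-turns about points of
  \<open>l\<close>, and these commute with the reflection in \<open>l\<close>.\<close>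

lemma reflection_perp:
  assumes f: "foot l P X" and X: "X \<in> rim" "\<not> ron X l"
  shows "reflection (rjoin X (h P X)) Z = reflection l (h P Z)"
proof -
  have P: "inc P l" using foot_on f .
  obtain A B where e: "ends l A B" by (rule ends_ex)
  note E = endsD[OF e]
  define n where "n = rjoin X (h P X)"
  have n: "\<not> ron A n" "\<not> ron B n" "ends n X (h P X)" "inc P n"
    using perp_off[OF P X E(2)] perp_off[OF P X E(3)] n_def by auto
  have X': "h P X \<in> rim" "\<not> ron (h P X) l" "crosses A B X (h P X)" using half_turn_side[OF e P X] half_turn_rim X by auto
  have rX: "reflection l X = h P X" using reflection_foot[OF f X] .
  have gen: "reflection n (h Q A) = reflection l (h P (h Q A))"
    if e: "ends l A B" and Q: "inc Q n" "Q \<noteq> P" for Q A B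
  proof -
    note E = endsD[OF e]
    have nA: "\<not> ron A n" using perp_off[OF P X E(2)] n_def by auto
    have *: "reflection l (h P (h Q A)) = h Q B"
      if f: "foot l P X" and X: "X \<in> rim" "\<not> ron X l" and Q: "inc Q (rjoin X (h P X))" and c: "crosses A B (h P X) (h Q A)" for X
    proof -
      obtain S where S: "inc S l" "h Q A = h S (h P X)" "h Q B = h P (h S X)" using perp_point[OF f X e Q \<open>Q \<noteq> P\<close> c] by metis
      have "reflection l (h P X) = X" using reflection_half_turn[OF P] reflection_foot[OF f X] by simp
      then show ?thesis using reflection_half_turn[OF P] reflection_half_turn[OF S(1)] S by simp
    qed
    have "\<not> ron (h Q A) l"
    proof
      assume "ron (h Q A) l"
      then have "h Q A = B" using E(7) half_turn_rim E(4) by metis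
      then have "Q = P" using half_turn_unique[OF E(4), of Q P n] ends_half_turn[OF e P] n Q nA by metis
      then show False using Q by blast
    qed
    moreover have "crosses A B X (h P X)" using half_turn_side[OF e P X] by simp
    ultimately consider "crosses A B (h P X) (h Q A)" | "crosses A B X (h Q A)"
      using side_parity[OF e X X'(1,2) half_turn_rim(1)[OF E(4)]] by blast
    then have "reflection l (h P (h Q A)) = h Q B"
    proof cases
      case 1 then show ?thesis using *[OF f X] Q n_def by blast
    next
      case 2
      then show ?thesis using *[OF foot_half_turn[OF f X] X'(1,2)] Q n_def rjoin_sym by simp
    qed
    moreover have "reflection n (h Q A) = h Q B" using perp_commute[OF f X e _ Q(2)] Q n_def by blast
    ultimately show ?thesis by simp
  qed
  consider "Z \<notin> rim" | "ron Z n" | "Z = A" | "Z = B" | "Z \<in> rim" "\<not> ron Z n" "Z \<noteq> A" "Z \<noteq> B" by blast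
  then have "reflection n Z = reflection l (h P Z)"
  proof cases
    case 1 then show ?thesis using reflection_fix half_turn_off by metis
  next
    case 2
    then have "Z = X \<or> Z = h P X" using endsD(7)[OF n(3)] by blast
    then show ?thesis using 2 reflection_fix rX reflection_half_turn[OF P] reflection_reflection by (metis half_turn_half_turn)
  next
    case 3
    have "reflection n A = h P A" using reflection_foot[OF foot_perp[OF f X e]] E(4) n n_def by blast
    then show ?thesis using 3 reflection_fix ends_half_turn[OF e P] E by metis
  next
    case 4
    have "reflection n B = h P B" using reflection_foot[OF foot_perp[OF f X e[unfolded ends_sym[of l A B]]]] E(5) n n_def by blast
    then show ?thesis using 4 reflection_fix ends_half_turn[OF e P] E by metis
  next
    case 5
    have "crosses X (h P X) A B" using half_turn_side[OF n(3,4) E(4) n(1)] ends_half_turn[OF e P] by simp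
    then consider "crosses X (h P X) A Z" | "crosses X (h P X) B Z"
      using side_parity[OF n(3) E(4) n(1) 5(1,2) E(5) n(2)] crosses_sym by metis
    then show ?thesis
    proof cases
      case 1
      obtain Q where Q: "inc Q n" "h Q A = Z" using side_meet[OF n(3) 1 E(4) 5(1)] by metis
      then have "Q \<noteq> P" using 5 ends_half_turn[OF e P] by metis
      then show ?thesis using gen[OF e Q(1)] Q(2) by simp
    next
      case 2
      obtain Q where Q: "inc Q n" "h Q B = Z" using side_meet[OF n(3) 2 E(5) 5(1)] by metis
      then have "Q \<noteq> P" using 5 ends_half_turn[OF e P] by metis
      then show ?thesis using gen[OF e[unfolded ends_sym[of l A B]] Q(1)] Q(2) by simp
    qed
  qed
  then show ?thesis unfolding n_def .
qed

section \<open>The oval and its secant lines\<close>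

abbreviation involutions :: "('b rimpoint \<Rightarrow> 'b rimpoint) set" where
  "involutions \<equiv> range reflection \<union> range h"

lemma reflection_permutes: "reflection l permutes rim"
  unfolding permutes_def using reflection_fix reflection_reflection by metis

text \<open>A reflection in \<open>m\<close> taking \<open>A\<close> to \<open>B\<close> has
  \<open>l\<close> as a perpendicular to \<open>m\<close>, and \<open>reflection_perp\<close>
  expresses it through \<open>l\<close>. Conversely, \<open>perp_ex\<close> makes each product with
  the reflection in \<open>l\<close> a reflection itself.\<close>

lemma swaps_iff:
  assumes e: "ends l A B"
  shows "s \<in> involutions \<and> s A = B \<longleftrightarrow> (\<exists>P. inc P l \<and> (s = h P \<or> s = reflection l \<circ> h P))"
proof
  note E = endsD[OF e]
  assume s: "s \<in> involutions \<and> s A = B"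
  then consider P where "s = h P" | m where "s = reflection m" by blast
  then show "\<exists>P. inc P l \<and> (s = h P \<or> s = reflection l \<circ> h P)"
  proof cases
    case 1
    then show ?thesis using s half_turn_inc[OF E(4)] E(6) by metis
  next
    case 2
    then have A: "\<not> ron A m" using s reflection_fix E(1) by metis
    obtain R where R: "foot m R A" "reflection m A = h R A" using reflection_ex[OF E(4) A] by metis
    have B: "h R A = B" using R 2 s by simp
    then have l: "rjoin A (h R A) = l" "inc R l" using E(6) half_turn_inc[OF E(4), of R] by auto
    have "reflection l (h R Z) = reflection m Z" for Z using reflection_perp[OF R(1) E(4) A, of "h R Z"] l by simp
    then have "s = reflection l \<circ> h R" using 2 by auto
    then show ?thesis using l by blast
  qed
next
  note E = endsD[OF e]
  assume "\<exists>P. inc P l \<and> (s = h P \<or> s = reflection l \<circ> h P)"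
  then obtain P where P: "inc P l" "s = h P \<or> s = reflection l \<circ> h P" by blast
  have B: "h P A = B" "reflection l B = B" using ends_half_turn[OF e P(1)] reflection_fix E by auto
  obtain X where X: "X \<in> rim" "\<not> ron X l" "foot l P X" using perp_ex[OF P(1)] by metis
  have "reflection (rjoin X (h P X)) = reflection l \<circ> h P" using reflection_perp[OF X(3,1,2)] by auto
  then have "reflection l \<circ> h P \<in> range reflection" by (metis rangeI)
  then have "s \<in> involutions" using P(2) by blast
  moreover have "s A = B" using P(2) B by auto
  ultimately show "s \<in> involutions \<and> s A = B" by blast
qed

text \<open>Half-turns about points of \<open>l\<close> take \<open>C\<close> across
  \<open>l\<close>, while their products with the reflection in \<open>l\<close> leave it on its
  side. So the side of \<open>D\<close> decides the type of the map, and \<open>D\<close> itself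
  decides the centre.\<close>

lemma oval_swap:
  assumes e: "ends l A B" and C: "C \<in> rim" "\<not> ron C l" "D \<in> rim" "\<not> ron D l"
  shows "\<exists>!s. s \<in> involutions \<and> s A = B \<and> s C = D"
proof -
  have side: "crosses A B C (h P C)" "\<not> crosses A B C (reflection l (h P C))" if P: "inc P l" for P
    using half_turn_side[OF e P C(1,2)] half_turn_rim[OF C(1), of P] reflection_side[OF e, of "h P C"]
      side_parity[OF e C(1,2), of "h P C" "reflection l (h P C)"] by blast+
  define D' where "D' = (if crosses A B C D then D else reflection l D)"
  have D': "D' \<in> rim" "crosses A B C D'"
    using reflection_side[OF e C(3,4)] side_parity[OF e C, of "reflection l D"] C D'_def by auto
  obtain P where P: "inc P l" "h P C = D'" using side_meet[OF e D'(2) C(1) D'(1)] by metis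
  define s where "s = (if crosses A B C D then h P else reflection l \<circ> h P)"
  have "s \<in> involutions \<and> s A = B" using swaps_iff[OF e] P s_def by metis
  moreover have "s C = D" using P unfolding s_def D'_def by auto
  moreover have "s' = s" if s': "s' \<in> involutions \<and> s' A = B \<and> s' C = D" for s'
  proof -
    obtain Q where Q: "inc Q l" "s' = h Q \<or> s' = reflection l \<circ> h Q" using swaps_iff[OF e, of s'] s' by blast
    have sC: "s' C = D" using s' by blast
    have k: "s' = (if crosses A B C D then h Q else reflection l \<circ> h Q)"
      using Q(2) side[OF Q(1)] sC by (metis comp_apply)
    have "h Q C = D'"
    proof (cases "crosses A B C D")
      case True
      then have "h Q C = D" using k sC by simp
      then show ?thesis using True D'_def by simp
    next
      case False
      then have "D = reflection l (h Q C)" using k sC by simp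
      then show ?thesis using False D'_def by simp
    qed
    then have "Q = P" using half_turn_unique[OF C(1), of Q P l] C(2) P Q by metis
    then show ?thesis using k unfolding s_def by simp
  qed
  ultimately show ?thesis by (intro ex1I[of _ s]) blast+
qed

lemma reflection_moves: "X \<in> rim \<Longrightarrow> \<not> ron X l \<Longrightarrow> reflection l X \<noteq> X"
  using reflection_ex half_turn_rim by metis

lemma abstract_oval_inv_set: "abstract_oval rim involutions"
  unfolding abstract_oval_def
proof (intro conjI ballI impI)
  obtain N where N: "N \<in> rim" using rims_of_two by metis
  obtain a b where ab: "a \<in> rim" "b \<in> rim" "a \<noteq> b" "a \<noteq> N" "b \<noteq> N" using three_rims[OF N] by metis
  have c: "card {N, a, b} = 3" using ab by auto
  have sub: "{N, a, b} \<subseteq> rim" using ab N by blast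
  show "infinite rim \<or> 3 \<le> card rim" using card_mono[OF _ sub] unfolding c by blast
next
  fix s assume "s \<in> involutions"
  then consider P where "s = h P" | m where "s = reflection m" by blast
  then show "s permutes rim" "s \<circ> s = id"
    using half_turn_permutes reflection_permutes by (cases; auto)+
next
  fix A1 A2 B1 B2 assume r: "A1 \<in> rim" "A2 \<in> rim" "B1 \<in> rim" "B2 \<in> rim" and "{A1, A2} \<inter> {B1, B2} = {}"
  then have d: "A1 \<noteq> B1" "A1 \<noteq> B2" "A2 \<noteq> B1" "A2 \<noteq> B2" by auto
  consider "A1 \<noteq> A2" | "B1 \<noteq> B2" | "A1 = A2" "B1 = B2" by blast
  then show "\<exists>!s. s \<in> involutions \<and> s A1 = A2 \<and> s B1 = B2"
  proof cases
    case 1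
    then have e: "ends (rjoin A1 A2) A1 A2" unfolding ends_def using rjoin_on r by metis
    then show ?thesis using oval_swap[OF e r(3) _ r(4)] endsD(7)[OF e] d by metis
  next
    case 2
    then have e: "ends (rjoin B1 B2) B1 B2" unfolding ends_def using rjoin_on r by metis
    have "\<exists>!s. s \<in> involutions \<and> s B1 = B2 \<and> s A1 = A2" using oval_swap[OF e r(1) _ r(2)] endsD(7)[OF e] d by metis
    then show ?thesis by (simp add: conj_commute)
  next
    case 3
    have e: "ends (rjoin A1 B1) A1 B1" unfolding ends_def using rjoin_on r d by metis
    note E = endsD[OF e]
    \<comment> \<open>Half-turns fix no end, and a reflection fixes the ends of its axis only, so
      two fixed ends determine the map.\<close>
    have "s = reflection (rjoin A1 B1)" if s: "s \<in> involutions \<and> s A1 = A1 \<and> s B1 = B1" for s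
    proof -
      consider P where "s = h P" | m where "s = reflection m" using s by blast
      then show ?thesis
      proof cases
        case 1 then show ?thesis using s half_turn_rim r by metis
      next
        case 2
        then have "ron A1 m" "ron B1 m" using s reflection_moves r by metis+
        then show ?thesis using 2 rjoin_eq d by metis
      qed
    qed
    moreover have "reflection (rjoin A1 B1) A1 = A1" "reflection (rjoin A1 B1) B1 = B1" using reflection_fix E by auto
    moreover have "reflection (rjoin A1 B1) \<in> involutions" by blast
    ultimately show ?thesis unfolding 3[symmetric] by (intro ex1I[of _ "reflection (rjoin A1 B1)"] conjI)
  qed
qed

text \<open>The reflection in \<open>l\<close> is an involution commuting with the half-turns about
  points of \<open>l\<close>. In a product of three elements the reflections collect to at most one,
  and the three half-turns reduce to one.\<close>

lemma pascalian_secant: assumes "L \<in> secant_lines rim involutions" shows "pascalian involutions L"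
proof -
  obtain A B where AB: "A \<in> rim" "B \<in> rim" "A \<noteq> B" "L = oval_line involutions A B" using assms unfolding secant_lines_def by blast
  define l where "l = rjoin A B"
  have e: "ends l A B" unfolding ends_def l_def using rjoin_on AB by metis
  have L: "Inr s \<in> L \<longleftrightarrow> s \<in> involutions \<and> s A = B" for s unfolding AB(4) oval_line_def by auto
  have *: "K \<circ> J \<circ> I \<in> involutions \<and> (K \<circ> J \<circ> I) A = B" if I: "Inr I \<in> L" "Inr J \<in> L" "Inr K \<in> L" for I J K
  proof -
    obtain P where P: "inc P l" "I = h P \<or> I = reflection l \<circ> h P" using I(1) L swaps_iff[OF e] by blast
    obtain Q where Q: "inc Q l" "J = h Q \<or> J = reflection l \<circ> h Q" using I(2) L swaps_iff[OF e] by blast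
    obtain R where R: "inc R l" "K = h R \<or> K = reflection l \<circ> h R" using I(3) L swaps_iff[OF e] by blast
    obtain S where S: "inc S l" "\<And>X. h R (h Q (h P X)) = h S X" using half_turns_product[OF P(1) Q(1) R(1)] by metis
    note c = reflection_half_turn[OF P(1)] reflection_half_turn[OF Q(1)] reflection_half_turn[OF R(1)] reflection_half_turn[OF S(1)]
    have "K \<circ> J \<circ> I = h S \<or> K \<circ> J \<circ> I = reflection l \<circ> h S"
      using P(2) Q(2) R(2) by (elim disjE) (simp_all add: fun_eq_iff c S(2))
    then show ?thesis using swaps_iff[OF e] S(1) by blast
  qed
  show ?thesis unfolding pascalian_def
  proof (intro ballI impI)
    fix I J K assume "Inr I \<in> L \<and> Inr J \<in> L \<and> Inr K \<in> L"
    then have "K \<circ> J \<circ> I \<in> involutions \<and> (K \<circ> J \<circ> I) A = B" using * by blast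
    then show "K \<circ> J \<circ> I \<in> involutions \<and> Inr (K \<circ> J \<circ> I) \<in> L" using L by (intro conjI; elim conjE; simp)
  qed
qed

end

theorem theorem7p1:
  fixes inc :: "'p \<Rightarrow> 'l \<Rightarrow> bool"
    and T :: "('l rimpoint \<Rightarrow> 'l rimpoint) set"
  assumes "incidence.A1 inc" and "incidence.A2 inc" and "incidence.A3 inc"
    and "incidence.A4 inc" and "incidence.A5 inc" and "incidence.A6 inc"
    and "incidence.A7 inc" and "incidence.A10 inc" and "incidence.A11 inc"
  defines "T \<equiv> range (incidence.reflection inc) \<union> range (incidence.half_turn inc)"
  shows "abstract_oval (incidence.rim inc) T \<and>
         (\<forall>l \<in> secant_lines (incidence.rim inc) T. pascalian T l)"
proof -
  interpret oval_plane inc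
    using assms(1-9)
    by (intro oval_plane.intro ordered_plane.intro separated_plane.intro ordered_plane_axioms.intro oval_plane_axioms.intro)
  show ?thesis
    unfolding T_def using abstract_oval_inv_set pascalian_secant by blast
qed

end
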